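(* Let $\rho_o$ be the positive root of $\sum_{k=1}^{\infty}\rho^{k^2}=\tfrac12$ (so $\rho_o^2=0.2078\ldots$), and let $f^\flat(x)=\sum_{n\ge 0}A_n^\flat x^n$ be the entire function attached to the Riemann Xi function, with $y$-Borel transform $B_y(f^\flat)(x)=\sum_{n\ge0}A_n^\flat x^n y^{n(n+1)/2}$. For $p\ge 1$ let $\alpha_p(y)=\sum_{q\ge p}u_p(q)y^q$ be the power series defined in the context. Then: (1) for every $y\in\mathbb{C}$ with $0<|y|<\rho_o^2$, the series $\alpha_p(y)$ converge for all $p\ge1$, and the zeros of $x\mapsto B_y(f^\flat)(x)$ are exactly the numbers $$x_p(y)=-\frac{1}{\alpha_p(y)},$$ where $p$ runs over all integers $p\geq 1$ such that $\alpha_p(y)\ne0$; (2) for every real $y$ with $0<y\le\rho_o^2$, all zeros of $B_y(f^\flat)$ are real.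
   Context: The Riemann Xi function is $\Xi(z)=\tfrac12 s(s-1)\pi^{-s/2}\Gamma(s/2)\zeta(s)$ with $s=\tfrac12+iz$. It is entire, and $\Xi(z)=\sum_{n\ge0}(-1)^nA_n^\flat z^{2n}$ with all $A_n^\flat>0$. Put $f^\flat(x)=\Xi(-i\sqrt{x})=\sum_{n\ge0}A_n^\flat x^n$, an entire function. Definition of $\alpha_p$: write $A_n=A_n^\flat$ and $Q(x,y)=\sum_{n\ge0}A_nx^ny^{n(n+1)/2}$. For $p\ge1$ set $$Q_p(x,y)=\frac{y^{(p-2)(p-1)/2}}{A_{p-1}x^{p-1}}\,Q\!\left(xy^{-(p-1)},y\right)=\sum_{m\ge-(p-1)}\frac{A_{p-1+m}}{A_{p-1}}x^my^{m(m+1)/2}=1+Z_p(x,y),$$ where $Z_p$ is the sum of the terms with $m\neq0$. For $p\ge1$ and $q\ge p$ set $$v_p(q)=[x^1y^{q-(p-1)}]\,\operatorname{Log}Q_p(x,y),$$ where $[x^iy^j]$ denotes the coefficient of $x^iy^j$ and $\operatorname{Log}Q_p=\sum_{k\ge1}\frac{(-1)^{k-1}}{k}Z_p^k$ is understood formally, coefficient by coefficient (only finitely many products of terms of $Z_p$ contribute to each coefficient $[x^1y^j]$, so this is a finite sum). Set $v_p(q)=0$ for $q<p$. Finally $u_p(q)=v_p(q)-v_{p+1}(q)$ and $\alpha_p(y)=\sum_{q\ge p}u_p(q)y^q$. *)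

theory Defs
  imports "HOL-Complex_Analysis.Complex_Analysis"
begin

text \<open>
  The Riemann zeta function, as the analytic continuation of its Dirichlet series to the
  plane without the point 1. The value 0 at the pole only serves to single out one
  function; it does not enter into \<open>riemann_Xi\<close>.
\<close>

definition riemann_zeta :: "complex \<Rightarrow> complex" where
  "riemann_zeta = (THE g. g holomorphic_on - {1} \<and> g 1 = 0 \<and>
     (\<forall>s. Re s > 1 \<longrightarrow> (\<lambda>n. 1 / of_nat (Suc n) powr s) sums g s))"

text \<open>
  The product below has removable singularities at the pole of the zeta function and at the
  poles of the Gamma function (where the library sets the Gamma function to 0); the entire
  function meant by the formula is obtained by removing them.
\<close>

definition riemann_Xi :: "complex \<Rightarrow> complex" where
  "riemann_Xi = remove_sings (\<lambda>z. let s = 1/2 + \<i> * z in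
     1/2 * s * (s - 1) * of_real pi powr (- s/2) * Gamma (s/2) * riemann_zeta s)"

text \<open>The coefficients in \<open>\<Xi>(z) = \<Sum>n. (-1)^n A n z^(2n)\<close>.\<close>

definition A_flat :: "nat \<Rightarrow> complex" where
  "A_flat n = (-1) ^ n * fps_nth (fps_expansion riemann_Xi 0) (2 * n)"

text \<open>As \<open>\<Xi>\<close> is even, the choice of the branch of the square root is immaterial.\<close>

definition f_flat :: "complex \<Rightarrow> complex" where
  "f_flat x = riemann_Xi (- \<i> * csqrt x)"

definition y_borel :: "complex \<Rightarrow> (complex \<Rightarrow> complex) \<Rightarrow> complex \<Rightarrow> complex" where
  "y_borel y f x = (\<Sum>n. fps_nth (fps_expansion f 0) n * x ^ n * y ^ (n * (n + 1) div 2))"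

text \<open>
  \<open>Qser p\<close> is the formal series \<open>Q_p(x,y)\<close>, a Laurent series in \<open>x\<close> whose coefficients are
  power series in \<open>y\<close>: the coefficient of \<open>x^m y^j\<close> in \<open>F\<close> is \<open>fps_nth (fls_nth F m) j\<close>.
\<close>

definition Qser :: "nat \<Rightarrow> complex fps fls" where
  "Qser p = Abs_fls (\<lambda>m. if m < - (int p - 1) then 0
     else fps_const (A_flat (nat (int p - 1 + m)) / A_flat (p - 1)) * fps_X ^ nat (m * (m + 1) div 2))"

definition Zser :: "nat \<Rightarrow> complex fps fls" where
  "Zser p = Qser p - 1"

text \<open>
  The coefficient of \<open>x^i y^j\<close> in \<open>Log Q_p\<close>, with the series for \<open>Log\<close> taken coefficient by
  coefficient. Only finitely many summands are nonzero, see \<open>Zser_power_coeff_eq_0\<close>.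
\<close>

definition LogQ_coeff :: "nat \<Rightarrow> int \<Rightarrow> nat \<Rightarrow> complex" where
  "LogQ_coeff p i j = (\<Sum>k. (-1) ^ k / of_nat (Suc k) * fps_nth (fls_nth (Zser p ^ Suc k) i) j)"

definition v_coeff :: "nat \<Rightarrow> nat \<Rightarrow> complex" where
  "v_coeff p q = (if q < p then 0 else LogQ_coeff p 1 (q - (p - 1)))"

definition u_coeff :: "nat \<Rightarrow> nat \<Rightarrow> complex" where
  "u_coeff p q = v_coeff p q - v_coeff (p + 1) q"

definition alpha :: "nat \<Rightarrow> complex \<Rightarrow> complex" where
  "alpha p y = (\<Sum>n. u_coeff p (p + n) * y ^ (p + n))"

lemma fls_nth_Qser:
  "fls_nth (Qser p) m = (if m < - (int p - 1) then 0
     else fps_const (A_flat (nat (int p - 1 + m)) / A_flat (p - 1)) * fps_X ^ nat (m * (m + 1) div 2))"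
  unfolding Qser_def
  by (subst nth_Abs_fls_ex_lower_bound) (auto intro!: exI[of _ "- (int p - 1)"])

lemma fls_nth_Zser_0:
  assumes "p \<ge> 1" "A_flat (p - 1) \<noteq> 0"
  shows "fls_nth (Zser p) 0 = 0"
proof -
  have "nat (int p - 1) = p - 1"
    using assms(1) by simp
  then show ?thesis
    using assms by (simp add: Zser_def fls_nth_Qser)
qed

lemma Zser_coeff_nonzeroD:
  assumes "p \<ge> 1" "A_flat (p - 1) \<noteq> 0" "fps_nth (fls_nth (Zser p) m) j \<noteq> 0"
  shows "2 * int j - m \<ge> 1"
proof -
  have m: "m \<noteq> 0"
    using fls_nth_Zser_0[OF assms(1,2)] assms(3) by auto
  then have "fls_nth (Zser p) m = fls_nth (Qser p) m"
    by (simp add: Zser_def)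
  then have "j = nat (m * (m + 1) div 2)"
    using assms(3) by (auto simp: fls_nth_Qser fps_X_power_nth split: if_splits)
  moreover have "m * (m + 1) \<ge> 0"
    using m by (cases "m > 0") (auto intro: mult_nonpos_nonpos)
  moreover have "even (m * (m + 1))"
    by simp
  ultimately have "2 * int j = m * (m + 1)"
    by auto
  moreover have "m * m \<ge> 1"
    using m by (smt (verit) mult_pos_pos mult_neg_neg)
  ultimately show ?thesis
    by (simp add: algebra_simps)
qed

lemma Zser_power_coeff_eq_0:
  assumes "p \<ge> 1" "A_flat (p - 1) \<noteq> 0" "int k > 2 * int j - i"
  shows "fps_nth (fls_nth (Zser p ^ k) i) j = 0"
  using assms(3)
proof (induction k arbitrary: i j)
  case 0
  then show ?case by (auto split: if_splits)
next
  case (Suc k)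
  have "fps_nth (fls_nth (Zser p) m * fls_nth (Zser p ^ k) (i - m)) j = 0" for m
  proof -
    have "fps_nth (fls_nth (Zser p) m) l * fps_nth (fls_nth (Zser p ^ k) (i - m)) (j - l) = 0"
      if "l \<le> j" for l
    proof (cases "fps_nth (fls_nth (Zser p) m) l = 0")
      case False
      from Zser_coeff_nonzeroD[OF assms(1,2) this] have "2 * int l - m \<ge> 1" .
      then have "int k > 2 * int (j - l) - (i - m)"
        using Suc.prems that by (simp add: of_nat_diff)
      then show ?thesis using Suc.IH by simp
    qed simp
    then show ?thesis
      unfolding fps_mult_nth by (intro sum.neutral) auto
  qed
  then show ?case
    by (simp add: fls_times_nth(2) fps_sum_nth)
qed

end

theory Submission
  imports Defs "HOL-Probability.Characteristic_Functions"
begin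

text \<open>
  Let \<open>r = sqrt \<bar>y\<bar>\<close>. If the positive numbers \<open>A n\<close> are log-concave, then on the circle with radius
  \<open>R q = (A q / A (q + 1)) * r powr (- 2 q - 1)\<close> the term of index \<open>n\<close> of the \<open>y\<close>-Borel transform
  is at most \<open>r ^ (n - q)\<^sup>2\<close> times the term of index \<open>q\<close>. Since \<open>2 * (\<Sum>k\<ge>1. r ^ k\<^sup>2) < 1\<close>, the
  term of index \<open>q\<close> dominates, so there are exactly \<open>q\<close> zeros in the disc and exactly one zero \<open>x\<close>
  between the circles for \<open>q = p - 1\<close> and \<open>q = p\<close>. The same majorant makes the formal logarithm of
  \<open>Q_p\<close> converge absolutely, so that \<open>v_p\<close> is a contour integral of \<open>B' / (B x)\<close> up to the factor
  \<open>2 \<pi> \<i>\<close>, and \<open>\<alpha>_p = v_p - v_(p+1) = - 1 / x\<close> by the residue theorem. For real \<open>y\<close> the zero in each annulus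
  equals its conjugate; the case \<open>y = \<rho>\<^sup>2\<close> follows by Hurwitz' theorem.

  The coefficients are \<open>A n = 2 m_(2n) / (2n)!\<close> for the moments \<open>m_k\<close> on \<open>{0<..}\<close> of the even theta
  kernel \<open>\<Phi>\<close>, which is log-concave because its first term dominates. Since \<open>- \<Phi>' / \<Phi>\<close> is increasing there, Chebyshev's association inequality and an
  integration by parts show that \<open>m_k / k!\<close> is log-concave.
\<close>

section \<open>Double series attached to Laurent series over power series\<close>

text \<open>The coefficients of \<open>Qser\<close> are formal, so they must be evaluated before
  they can meet a function of x. The products of terms of all powers of \<open>Zser\<close> are
  treated as one absolutely summable family: summed over the exponents of x and y first, it is the
  logarithm series of a number 1 + z; summed over the power first, it has the terms
  \<open>LogQ_coeff\<close>.

  A single v_p also collects the pole at 0 and all zeros inside its circle. These contributions are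
  never computed: they are the same for the next circle and cancel in v_p - v_(p+1).

  For Xi the usual order is reversed. The kernel comes first: its moments define the entire function
  \<open>XI\<close>, and solving the formula for Xi gives a candidate for zeta. A Mellin transform
  identifies it with the Dirichlet series for real s > 1, and the identity theorem does the rest.
  Positivity and log-concavity thus concern moments from the outset. Evenness of the kernel is
  invisible in its series; it comes from the theta functional equation, obtained by comparing the
  Fourier coefficients of two even periodic functions.\<close>

definition bi_term :: "complex fps fls \<Rightarrow> complex \<Rightarrow> complex \<Rightarrow> int \<times> nat \<Rightarrow> complex" where
  "bi_term F x y = (\<lambda>(i, j). fps_nth (fls_nth F i) j * x powi i * y ^ j)"

lemma has_sum_mult_Times:
  fixes f :: "'a \<Rightarrow> 'c::{banach, real_normed_div_algebra}" and g :: "'b \<Rightarrow> 'c"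
  assumes "(\<lambda>x. norm (f x)) summable_on A" "(\<lambda>x. norm (g x)) summable_on B"
    and "(f has_sum s) A" "(g has_sum t) B"
  shows "((\<lambda>(x, y). f x * g y) has_sum (s * t)) (A \<times> B)"
proof (rule has_sum_SigmaI)
  show "((\<lambda>y. case (x, y) of (x, y) \<Rightarrow> f x * g y) has_sum f x * t) B" for x
    using has_sum_cmult_right[OF assms(4)] by simp
  show "((\<lambda>x. f x * t) has_sum s * t) A"
    using has_sum_cmult_left[OF assms(3)] .
  have "(\<lambda>z. norm (case z of (x, y) \<Rightarrow> f x * g y)) summable_on (A \<times> B)"
    unfolding Infinite_Sum.abs_summable_on_Sigma_iff
    using assms(1,2)
    by (auto simp: norm_mult abs_mult infsum_cmult_right' infsum_nonneg
          intro!: summable_on_cmult_right summable_on_cmult_left)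
  then show "(\<lambda>(x, y). f x * g y) summable_on A \<times> B"
    by (rule abs_summable_summable)
qed

text \<open>The sum over all pairs of exponents is regrouped by the exponent (i, j) of the product.
  In \<open>?S\<close> the power of y is cut at j because its exponents are natural numbers; the
  power of x runs over all integers, but the subdegrees leave finitely many nonzero summands. The
  last claim says that the weighted l1 norm is submultiplicative, which controls the powers.\<close>

lemma bi_term_mult:
  assumes "(bi_term F x y has_sum s) UNIV" "(bi_term G x y has_sum t) UNIV"
    and "((\<lambda>e. norm (bi_term F x y e)) has_sum M) UNIV"
    and "((\<lambda>e. norm (bi_term G x y e)) has_sum N) UNIV"
    and [simp]: "x \<noteq> 0"
  shows "(bi_term (F * G) x y has_sum (s * t)) UNIV"
    and "(\<lambda>e. norm (bi_term (F * G) x y e)) summable_on UNIV"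
    and "(\<Sum>\<^sub>\<infinity>e. norm (bi_term (F * G) x y e)) \<le> M * N"
proof -
  let ?S = "SIGMA (i::int,j::nat):UNIV. (UNIV::int set) \<times> {..j}"
  let ?h = "\<lambda>((i,j),(k,l)). bi_term F x y (k,l) * bi_term G x y (i - k, j - l)"
  have absF: "(\<lambda>e. norm (bi_term F x y e)) summable_on UNIV" and absG: "(\<lambda>e. norm (bi_term G x y e)) summable_on UNIV"
    using assms(3,4) has_sum_imp_summable by blast+
  have reidx: "bij_betw (\<lambda>((i,j),(k,l)). ((k,l),(i-k,j-l))) ?S (UNIV \<times> UNIV)"
    by (rule bij_betwI[where g = "\<lambda>((k,l),(i,j)). ((i+k,j+l),(k,l))"]) auto
  have "((\<lambda>(a,b). bi_term F x y a * bi_term G x y b) has_sum (s * t)) (UNIV \<times> UNIV)"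
    by (rule has_sum_mult_Times) (use assms absF absG in auto)
  then have h_sum: "(?h has_sum (s * t)) ?S"
    by (subst (asm) has_sum_reindex_bij_betw[OF reidx, symmetric])
       (simp add: case_prod_unfold)
  have "((\<lambda>(a,b). norm (bi_term F x y a) * norm (bi_term G x y b)) has_sum (M * N)) (UNIV \<times> UNIV)"
    by (rule has_sum_mult_Times) (use assms absF absG in auto)
  then have nh_sum: "((\<lambda>e. norm (?h e)) has_sum (M * N)) ?S"
    by (subst (asm) has_sum_reindex_bij_betw[OF reidx, symmetric])
       (simp add: case_prod_unfold norm_mult)
  have inner: "((\<lambda>kl. ?h (ij, kl)) has_sum bi_term (F * G) x y ij) (case ij of (i,j) \<Rightarrow> UNIV \<times> {..j})" for ij
  proof -
    obtain i j where ij: "ij = (i,j)" by force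
    let ?I = "{fls_subdegree F..i - fls_subdegree G}"
    have "((\<lambda>kl. ?h (ij, kl)) has_sum bi_term (F * G) x y ij) (?I \<times> {..j})"
    proof (rule has_sum_finiteI)
      have "bi_term (F * G) x y ij = (\<Sum>k\<in>?I. \<Sum>l\<le>j. fps_nth (fls_nth F k) l * fps_nth (fls_nth G (i-k)) (j-l) * x powi i * y^j)"
        by (simp add: bi_term_def ij fls_times_nth(2) fps_sum_nth fps_mult_nth sum_distrib_right atMost_atLeast0)
      also have "\<dots> = (\<Sum>k\<in>?I. \<Sum>l\<le>j. ?h (ij, (k,l)))"
      proof (intro sum.cong refl)
        fix k l assume "l \<in> {..j}"
        then have "y ^ j = y ^ l * y ^ (j - l)" by (simp flip: power_add)
        moreover have "x powi i = x powi k * x powi (i - k)"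
          by (simp flip: power_int_add)
        ultimately show "fps_nth (fls_nth F k) l * fps_nth (fls_nth G (i-k)) (j-l) * x powi i * y^j = ?h (ij, (k,l))"
          by (simp add: bi_term_def ij)
      qed
      finally show "bi_term (F * G) x y ij = (\<Sum>kl\<in>?I \<times> {..j}. ?h (ij, kl))"
        by (simp add: sum.cartesian_product case_prod_unfold)
    qed auto
    also have "?this \<longleftrightarrow> ?thesis"
    proof (rule has_sum_cong_neutral)
      fix kl assume "kl \<in> (case ij of (i,j) \<Rightarrow> UNIV \<times> {..j}) - ?I \<times> {..j}"
      then have "fst kl < fls_subdegree F \<or> i - fst kl < fls_subdegree G"
        by (auto simp: ij)
      then show "?h (ij, kl) = 0"
        by (auto simp: bi_term_def case_prod_unfold ij)
    qed (auto simp: ij)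
    finally show ?thesis .
  qed
  show "(bi_term (F * G) x y has_sum (s * t)) UNIV"
    by (rule has_sum_SigmaD[OF h_sum]) (use inner in \<open>auto simp: case_prod_unfold\<close>)
  let ?B = "\<lambda>ij. case ij of (i::int,j::nat) \<Rightarrow> (UNIV::int set) \<times> {..j}"
  have "(\<lambda>z. norm (?h z)) summable_on ?S"
    using nh_sum has_sum_imp_summable by blast
  then have inner_abs: "\<And>ij. (\<lambda>kl. norm (?h (ij, kl))) summable_on ?B ij"
    and outer_abs: "(\<lambda>ij. norm (\<Sum>\<^sub>\<infinity>kl\<in>?B ij. norm (?h (ij, kl)))) summable_on UNIV"
    unfolding Infinite_Sum.abs_summable_on_Sigma_iff by auto
  have le: "norm (bi_term (F * G) x y ij) \<le> (\<Sum>\<^sub>\<infinity>kl\<in>?B ij. norm (?h (ij,kl)))" for ij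
    using norm_infsum_bound[OF inner_abs[of ij]] inner[of ij] by (simp add: infsumI)
  have outer: "((\<lambda>ij. \<Sum>\<^sub>\<infinity>kl\<in>?B ij. norm (?h (ij, kl))) has_sum (M * N)) UNIV"
    by (rule has_sum_SigmaD[OF nh_sum]) (use inner_abs in auto)
  show abs: "(\<lambda>e. norm (bi_term (F * G) x y e)) summable_on UNIV"
    by (rule Infinite_Sum.abs_summable_on_comparison_test[OF outer_abs])
       (use le in \<open>auto intro: order_trans[OF _ abs_ge_self]\<close>)
  show "(\<Sum>\<^sub>\<infinity>e. norm (bi_term (F * G) x y e)) \<le> M * N"
    by (rule has_sum_mono[OF has_sum_infsum[OF abs] outer]) (use le in auto)
qed

text \<open>Each square comes from m and from -m; this is the factor 2 in the condition
  \<open>2 * s < 1\<close>.\<close>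

lemma has_sum_int_squares:
  fixes r :: real
  assumes "(\<lambda>k. r ^ (Suc k)\<^sup>2) sums s" "r \<ge> 0"
  shows "((\<lambda>m::int. r ^ nat (m\<^sup>2)) has_sum (2 * s)) (-{0})"
proof -
  have s: "((\<lambda>k. r ^ (Suc k)\<^sup>2) has_sum s) UNIV"
    by (rule sums_nonneg_imp_has_sum) (use assms in auto)
  have sq: "nat ((int n)\<^sup>2) = n\<^sup>2" for n
    by (metis nat_int of_nat_power)
  have "bij_betw (\<lambda>k. int (Suc k)) UNIV {1..}"
    by (rule bij_betwI[where g = "\<lambda>m. nat (m - 1)"]) auto
  from has_sum_reindex_bij_betw[OF this, of "\<lambda>m. r ^ nat (m\<^sup>2)" s] s
  have "((\<lambda>m::int. r ^ nat (m\<^sup>2)) has_sum s) {1..}"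
    by (simp only: sq)
  moreover have "bij_betw (\<lambda>k. - int (Suc k)) UNIV {..-1}"
    by (rule bij_betwI[where g = "\<lambda>m. nat (- m - 1)"]) auto
  from has_sum_reindex_bij_betw[OF this, of "\<lambda>m. r ^ nat (m\<^sup>2)" s] s
  have "((\<lambda>m::int. r ^ nat (m\<^sup>2)) has_sum s) {..-1}"
    by (simp only: sq power2_minus)
  ultimately have "((\<lambda>m::int. r ^ nat (m\<^sup>2)) has_sum (s + s)) ({1..} \<union> {..-1})"
    by (rule has_sum_Un_disjoint) auto
  also have "{1..} \<union> {..-1} = -{0::int}" by auto
  finally show ?thesis by simp
qed

lemma bi_term_1: "bi_term 1 x y e = (if e = (0, 0) then 1 else 0)"
  by (auto simp: bi_term_def split: prod.splits)

lemma has_sum_bi_term_power: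
  assumes "(bi_term F x y has_sum s) UNIV"
    and "((\<lambda>e. norm (bi_term F x y e)) has_sum M) UNIV"
    and "x \<noteq> 0"
  shows "(bi_term (F ^ k) x y has_sum (s ^ k)) UNIV \<and>
    (\<lambda>e. norm (bi_term (F ^ k) x y e)) summable_on UNIV \<and>
    (\<Sum>\<^sub>\<infinity>e. norm (bi_term (F ^ k) x y e)) \<le> M ^ k"
proof (induction k)
  case 0
  have "((\<lambda>e. norm (bi_term 1 x y e)) has_sum 1) {(0, 0)}"
    by (rule has_sum_finiteI) (auto simp: bi_term_1)
  then have "((\<lambda>e. norm (bi_term 1 x y e)) has_sum 1) UNIV"
    by (rule has_sum_cong_neutral[THEN iffD1, rotated -1]) (auto simp: bi_term_1)
  moreover have "(bi_term 1 x y has_sum 1) {(0, 0)}"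
    by (rule has_sum_finiteI) (auto simp: bi_term_1)
  then have "(bi_term 1 x y has_sum 1) UNIV"
    by (rule has_sum_cong_neutral[THEN iffD1, rotated -1]) (auto simp: bi_term_1)
  ultimately show ?case by (auto simp: infsumI dest: has_sum_imp_summable)
next
  case (Suc k)
  then have IH: "(bi_term (F ^ k) x y has_sum (s ^ k)) UNIV"
    "((\<lambda>e. norm (bi_term (F ^ k) x y e)) has_sum (\<Sum>\<^sub>\<infinity>e. norm (bi_term (F ^ k) x y e))) UNIV"
    "(\<Sum>\<^sub>\<infinity>e. norm (bi_term (F ^ k) x y e)) \<le> M ^ k" by auto
  have "M \<ge> 0" using assms(2) by (rule has_sum_nonneg) auto
  with bi_term_mult[OF assms(1) IH(1) assms(2) IH(2) assms(3)] IH(3) show ?case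
    by (auto intro: order_trans mult_left_mono)
qed

text \<open>All that the analysis of the Borel transform has to know about Xi. The sequence is real,
  so that log-concavity can be stated as an inequality; \<open>xi_coeff\<close> instantiates it at
  the end.\<close>

locale logconcave_A_flat =
  fixes a :: "nat \<Rightarrow> real"
  assumes A_flat_eq: "A_flat n = of_real (a n)"
    and a_pos: "a n > 0"
    and a_logconcave: "a n * a (n + 2) \<le> (a (n + 1))\<^sup>2"
    and fps_f_flat: "fps_expansion f_flat 0 = Abs_fps A_flat"
begin

section \<open>Quotients of terms and the formal logarithm\<close>

definition ratio :: "nat \<Rightarrow> real" where
  "ratio n = a (Suc n) / a n"

lemma ratio_pos: "ratio n > 0"
  by (simp add: ratio_def a_pos)

lemma ratio_antimono: "m \<le> n \<Longrightarrow> ratio n \<le> ratio m"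
proof (rule lift_Suc_antimono_le)
  show "ratio (Suc n) \<le> ratio n" for n
    using a_logconcave[of n] a_pos[of n] a_pos[of "Suc n"]
    by (simp add: ratio_def field_simps power2_eq_square)
qed

text \<open>Successive quotients decrease. Going up from q, each factor is at most
  \<open>ratio q\<close>; going down, each divisor is at least \<open>ratio q\<close>. So the
  sequence lies below the geometric sequence that agrees with it at q and q + 1.\<close>

lemma a_le_ratio_power: "a n / a q \<le> ratio q powi (int n - int q)"
proof (cases "q \<le> n")
  case True
  then show ?thesis
  proof (induction n rule: dec_induct)
    case base
    then show ?case using a_pos[of q] by simp
  next
    case (step n)
    have "a (Suc n) / a q = a n / a q * ratio n"
      using a_pos[of n] by (simp add: ratio_def)
    also have "\<dots> \<le> ratio q powi (int n - int q) * ratio q"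
      using step ratio_antimono[of q n] a_pos ratio_pos
      by (intro mult_mono step) (auto simp: less_imp_le)
    also have "\<dots> = ratio q powi (int (Suc n) - int q)"
      using ratio_pos[of q] power_int_add_1[of "ratio q" "int n - int q"]
      by (simp add: algebra_simps)
    finally show ?case .
  qed
next
  case False
  then have "n \<le> q" by simp
  then show ?thesis
  proof (induction n rule: inc_induct)
    case base
    then show ?case using a_pos[of q] by simp
  next
    case (step n)
    have "a n / a q = a (Suc n) / a q / ratio n"
      using a_pos[of n] a_pos[of "Suc n"] by (simp add: ratio_def)
    also have "\<dots> \<le> ratio q powi (int (Suc n) - int q) / ratio q"
      using step ratio_antimono[of n q] a_pos ratio_pos
      by (intro frac_le step) (auto simp: less_imp_le)
    also have "\<dots> = ratio q powi (int (Suc n) - int q - 1)"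
      using ratio_pos[of q] power_int_diff[of "ratio q" "int (Suc n) - int q" 1] by simp
    finally show ?case by simp
  qed
qed

lemma y_borel_eq: "y_borel y f_flat x = (\<Sum>n. of_real (a n) * x ^ n * y ^ (n * (n + 1) div 2))"
  by (simp add: y_borel_def fps_f_flat A_flat_eq)

definition tri :: "int \<Rightarrow> nat" where
  "tri m = nat (m * (m + 1) div 2)"

lemma two_tri: "2 * int (tri m) = m * (m + 1)"
proof -
  have "m * (m + 1) \<ge> 0"
    by (cases "m \<ge> 0") (auto intro: mult_nonpos_nonpos)
  moreover have "even (m * (m + 1))" by simp
  ultimately show ?thesis by (simp add: tri_def)
qed

text \<open>The term of x-exponent m in \<open>Q_p\<close> for p = q + 1. The index q is used
  instead of p because it is the number of zeros inside the circle on which term q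
  dominates.\<close>

definition zterm :: "nat \<Rightarrow> complex \<Rightarrow> complex \<Rightarrow> int \<Rightarrow> complex" where
  "zterm q x y m = (if m < - int q then 0
     else of_real (a (nat (int q + m)) / a q) * x powi m * y ^ tri m)"

lemma zterm_0: "zterm q x y 0 = 1"
  using a_pos[of q] by (simp add: zterm_def tri_def)

text \<open>Here x stands for x * y^q. The y-factor contributes r^(m(m+1)), the coefficients and x
  together at most r^(-m) by the choice of the radius. The result r^(m^2) is symmetric in m, so both
  neighbours of the dominating term are equally small.\<close>

lemma norm_zterm_le:
  assumes "norm y = r\<^sup>2" "norm x * ratio q * r = 1" "r \<ge> 0"
  shows "norm (zterm q x y m) \<le> r ^ nat (m\<^sup>2)"
proof (cases "m < - int q")
  case False
  have r: "r \<noteq> 0" using assms(2) by auto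
  have x: "norm x = 1 / (ratio q * r)"
    using assms(2) ratio_pos[of q] r by (simp add: field_simps)
  have "norm (zterm q x y m) = a (nat (int q + m)) / a q * norm x powi m * (r\<^sup>2) ^ tri m"
    using False a_pos[of q] a_pos[of "nat (int q + m)"] assms(1)
    by (simp add: zterm_def norm_mult norm_power norm_power_int norm_divide)
  also have "\<dots> \<le> ratio q powi m * norm x powi m * (r\<^sup>2) ^ tri m"
    using a_le_ratio_power[of "nat (int q + m)" q] False
    by (intro mult_right_mono) (auto simp: nat_add_distrib)
  also have "ratio q powi m * norm x powi m = (1 / r) powi m"
    using ratio_pos[of q] by (simp add: x flip: power_int_mult_distrib)
  also have "(r\<^sup>2) ^ tri m = r powi (int (2 * tri m))"
    by (simp only: power_int_of_nat power_mult)
  also have "(1 / r) powi m * r powi (int (2 * tri m)) = r powi (int (2 * tri m) - m)"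
    using r power_int_diff[of r "int (2 * tri m)" m] by (simp only: power_int_divide_distrib power_int_1_left) simp
  also have "int (2 * tri m) - m = int (nat (m\<^sup>2))"
    using two_tri[of m] by (simp add: power2_eq_square algebra_simps)
  finally show ?thesis unfolding power_int_of_nat .
qed (use assms(3) in \<open>simp add: zterm_def\<close>)

lemma bi_term_Zser:
  "bi_term (Zser (Suc q)) x y (m, j) = (if m \<noteq> 0 \<and> j = tri m then zterm q x y m else 0)"
proof (cases "m = 0")
  case True
  then show ?thesis using a_pos[of q]
    by (auto simp: bi_term_def fls_nth_Zser_0 A_flat_eq)
next
  case False
  then show ?thesis
    by (auto simp: bi_term_def Zser_def fls_nth_Qser zterm_def tri_def A_flat_eq fps_X_power_nth)
qed

text \<open>\<open>Zser\<close> is supported on the points (m, \<open>tri m\<close>), so its double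
  series is the single series of the \<open>zterm\<close>s with m different from 0.\<close>

lemma has_sum_bi_term_Zser:
  assumes "norm y = r\<^sup>2" "norm x * ratio q * r = 1"
    and "(\<lambda>k. r ^ (Suc k)\<^sup>2) sums s" "r \<ge> 0"
  obtains z M where "(zterm q x y has_sum z) (-{0})"
    "(bi_term (Zser (Suc q)) x y has_sum z) UNIV"
    "((\<lambda>e. norm (bi_term (Zser (Suc q)) x y e)) has_sum M) UNIV" "norm z \<le> M" "M \<le> 2 * s"
proof -
  have sq: "((\<lambda>m::int. r ^ nat (m\<^sup>2)) has_sum (2 * s)) (-{0})"
    using has_sum_int_squares[OF assms(3,4)] .
  have "(\<lambda>m. norm (zterm q x y m)) summable_on (-{0})"
    by (rule summable_on_comparison_test[OF has_sum_imp_summable[OF sq]])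
       (use norm_zterm_le[OF assms(1,2,4)] in auto)
  then obtain M where M: "((\<lambda>m. norm (zterm q x y m)) has_sum M) (-{0})"
    using summable_iff_has_sum_infsum by blast
  have "M \<le> 2 * s"
    by (rule has_sum_mono[OF M sq]) (use norm_zterm_le[OF assms(1,2,4)] in auto)
  have "zterm q x y summable_on (-{0})"
    using M abs_summable_summable has_sum_imp_summable by blast
  then obtain z where z: "(zterm q x y has_sum z) (-{0})"
    using summable_iff_has_sum_infsum by blast
  have inj: "inj_on (\<lambda>m. (m, tri m)) (-{0})" by (auto intro: inj_onI)
  have "(bi_term (Zser (Suc q)) x y has_sum z) ((\<lambda>m. (m, tri m)) ` (-{0}))"
    using z has_sum_cong[of "-{0}" "\<lambda>m. bi_term (Zser (Suc q)) x y (m, tri m)" "zterm q x y"]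
    by (subst has_sum_reindex[OF inj]) (simp add: o_def bi_term_Zser)
  then have 1: "(bi_term (Zser (Suc q)) x y has_sum z) UNIV"
    by (rule has_sum_cong_neutral[THEN iffD1, rotated -1]) (auto simp: bi_term_Zser)
  have "((\<lambda>e. norm (bi_term (Zser (Suc q)) x y e)) has_sum M) ((\<lambda>m. (m, tri m)) ` (-{0}))"
    using M has_sum_cong[of "-{0}" "\<lambda>m. norm (bi_term (Zser (Suc q)) x y (m, tri m))" "\<lambda>m. norm (zterm q x y m)"]
    by (subst has_sum_reindex[OF inj]) (simp add: o_def bi_term_Zser)
  then have 2: "((\<lambda>e. norm (bi_term (Zser (Suc q)) x y e)) has_sum M) UNIV"
    by (rule has_sum_cong_neutral[THEN iffD1, rotated -1]) (auto simp: bi_term_Zser)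
  have "norm z \<le> M" by (rule norm_has_sum_bound[OF M z])
  with z 1 2 \<open>M \<le> 2 * s\<close> show ?thesis using that by blast
qed

text \<open>Term q is factored out. For n = q + m the exponents of y satisfy
  \<open>tri n = tri q + tri m + q * m\<close>, and the mixed part q * m is absorbed by replacing x
  with x * y^q. This undoes the substitution in the definition of \<open>Q_p\<close>.\<close>

lemma y_borel_eq_zterm:
  assumes "(zterm q (x * y ^ q) y has_sum z) (-{0})" "x \<noteq> 0" "y \<noteq> 0"
  shows "y_borel y f_flat x = of_real (a q) * x ^ q * y ^ (q * (q + 1) div 2) * (1 + z)"
proof -
  let ?c = "of_real (a q) * x ^ q * y ^ (q * (q + 1) div 2)"
  have "(zterm q (x * y ^ q) y has_sum (1 + z)) ({0} \<union> -{0})"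
    by (rule has_sum_Un_disjoint[OF _ assms(1)]) (auto simp: zterm_0 intro!: has_sum_finiteI)
  then have "(zterm q (x * y ^ q) y has_sum (1 + z)) {- int q..}"
    by (rule has_sum_cong_neutral[THEN iffD1, rotated -1]) (auto simp: zterm_def)
  moreover have "bij_betw (\<lambda>n. int n - int q) UNIV {- int q..}"
    by (rule bij_betwI[where g = "\<lambda>m. nat (m + int q)"]) auto
  ultimately have "((\<lambda>n. zterm q (x * y ^ q) y (int n - int q)) has_sum (1 + z)) UNIV"
    using has_sum_reindex_bij_betw by blast
  then have "((\<lambda>n. ?c * zterm q (x * y ^ q) y (int n - int q)) has_sum (?c * (1 + z))) UNIV"
    by (rule has_sum_cmult_right)
  also have "(\<lambda>n. ?c * zterm q (x * y ^ q) y (int n - int q)) =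
      (\<lambda>n. of_real (a n) * x ^ n * y ^ (n * (n + 1) div 2))"
  proof
    fix n
    define m where "m = int n - int q"
    have tri_nat: "n * (n + 1) div 2 = tri (int n)" for n
      using two_tri[of "int n"] by (simp add: tri_def nat_div_distrib nat_mult_distrib nat_add_distrib)
    have "2 * (int (tri (int q)) + int (tri m) + int q * m) = 2 * int (tri (int n))"
      unfolding distrib_left two_tri by (simp add: m_def algebra_simps)
    then have tr: "int (tri (int q)) + int (tri m) + int q * m = int (tri (int n))"
      by (metis mult_cancel_left zero_neq_numeral)
    have "y ^ tri (int q) * y ^ tri m * (y ^ q) powi m = y powi (int (tri (int q)) + int (tri m) + int q * m)"
      using assms by (simp add: power_int_add power_int_mult flip: power_int_of_nat)
    then have y: "y ^ tri (int q) * y ^ tri m * (y ^ q) powi m = y ^ tri (int n)"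
      by (simp only: tr power_int_of_nat)
    have "x powi (int q + m) = x ^ q * x powi m"
      using assms by (simp add: power_int_add)
    then have x: "x ^ q * x powi m = x ^ n" by (simp add: m_def)
    have m: "\<not> m < - int q" "nat (int q + m) = n" by (simp_all add: m_def)
    have "?c * zterm q (x * y ^ q) y m = of_real (a q) * of_real (a n / a q) * (x ^ q * x powi m) * (y ^ tri (int q) * y ^ tri m * (y ^ q) powi m)"
      unfolding tri_nat zterm_def power_int_mult_distrib if_not_P[OF m(1)] m(2) by (simp only: mult_ac)
    moreover have "of_real (a q) * of_real (a n / a q) = (of_real (a n) :: complex)"
      using a_pos[of q] by simp
    ultimately have "?c * zterm q (x * y ^ q) y m = of_real (a n) * (x ^ q * x powi m) * (y ^ tri (int q) * y ^ tri m * (y ^ q) powi m)"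
      by simp
    then show "?c * zterm q (x * y ^ q) y m = of_real (a n) * x ^ n * y ^ (n * (n + 1) div 2)"
      by (simp only: x y tri_nat)
  qed
  finally show ?thesis
    unfolding y_borel_eq by (rule sums_unique[OF has_sum_imp_sums, symmetric])
qed

text \<open>For fixed exponents only finitely many powers contribute, so the sequential sum in
  \<open>LogQ_coeff\<close> is also an unconditional one, the form needed for exchanging
  summations.\<close>

lemma LogQ_coeff_has_sum:
  "((\<lambda>k. (-1) ^ k / of_nat (Suc k) * bi_term (Zser (Suc q) ^ Suc k) x y (i, j))
     has_sum (LogQ_coeff (Suc q) i j * x powi i * y ^ j)) UNIV"
proof -
  let ?f = "\<lambda>k. (-1) ^ k / of_nat (Suc k) * fps_nth (fls_nth (Zser (Suc q) ^ Suc k) i) j"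
  have 0: "?f k = 0" if "k \<notin> {..nat (2 * int j - i)}" for k
    using Zser_power_coeff_eq_0[of "Suc q" j i "Suc k"] that a_pos[of q] by (auto simp: A_flat_eq)
  have "LogQ_coeff (Suc q) i j = sum ?f {..nat (2 * int j - i)}"
    unfolding LogQ_coeff_def by (rule suminf_finite[OF finite_atMost 0])
  then have "(?f has_sum LogQ_coeff (Suc q) i j) {..nat (2 * int j - i)}"
    by (intro has_sum_finiteI finite_atMost)
  then have "(?f has_sum LogQ_coeff (Suc q) i j) UNIV"
    by (rule has_sum_cong_neutral[THEN iffD1, rotated -1]) (simp_all only: Diff_iff 0 UNIV_I not_True_eq_False simp_thms)
  from has_sum_cmult_left[OF this, of "x powi i * y ^ j"] show ?thesis
    by (simp only: bi_term_def prod.case mult.assoc)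
qed

text \<open>The family over (k, (i, j)) is absolutely summable since the norms for fixed k add up to
  at most M^(k+1) with M < 1. Both orders of summation are then evaluated: one gives
  \<open>ln (1 + z)\<close>, the other the series of \<open>LogQ_coeff\<close>.\<close>

lemma has_sum_LogQ:
  assumes "norm y = r\<^sup>2" "norm x * ratio q * r = 1"
    and "(\<lambda>k. r ^ (Suc k)\<^sup>2) sums s" "r \<ge> 0" "2 * s < 1"
  obtains z where "(zterm q x y has_sum z) (-{0})" "norm z < 1"
    "((\<lambda>(i, j). LogQ_coeff (Suc q) i j * x powi i * y ^ j) has_sum ln (1 + z)) UNIV"
    "(\<lambda>(i, j). norm (LogQ_coeff (Suc q) i j * x powi i * y ^ j)) summable_on UNIV"
proof -
  obtain z M where z: "(zterm q x y has_sum z) (-{0})"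
    and bz: "(bi_term (Zser (Suc q)) x y has_sum z) UNIV"
    and M: "((\<lambda>e. norm (bi_term (Zser (Suc q)) x y e)) has_sum M) UNIV" "norm z \<le> M" "M \<le> 2 * s"
    using has_sum_bi_term_Zser[OF assms(1-4)] .
  have M01: "0 \<le> M" "M < 1" using M assms(5) norm_ge_zero[of z] by linarith+
  have x: "x \<noteq> 0" using assms(2) by auto
  note pow = has_sum_bi_term_power[OF bz M(1) x]
  let ?b = "\<lambda>k. bi_term (Zser (Suc q) ^ Suc k) x y"
  let ?c = "\<lambda>k. (-1) ^ k / of_nat (Suc k) :: complex"
  let ?g = "\<lambda>(k, e). ?c k * ?b k e"
  have c: "norm (?c k) \<le> 1" for k by (simp add: norm_divide norm_power del: of_nat_Suc)
  have abs: "(\<lambda>z. norm (?g z)) summable_on (UNIV \<times> UNIV)"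
    unfolding Infinite_Sum.abs_summable_on_Sigma_iff
  proof (intro conjI ballI)
    fix k
    have "(\<lambda>e. norm (?c k) * norm (?b k e)) summable_on UNIV"
      by (rule summable_on_cmult_right[OF conjunct1[OF conjunct2[OF pow]]])
    then show "(\<lambda>e. norm (?g (k, e))) summable_on UNIV"
      by (simp only: norm_mult prod.case)
  next
    have "(\<lambda>k. M ^ Suc k) summable_on UNIV"
      by (rule summable_nonneg_imp_summable_on)
         (use M01 in \<open>simp_all only: summable_Suc_iff zero_le_power summable_geometric real_norm_def abs_of_nonneg\<close>)
    then show "(\<lambda>k. norm (\<Sum>\<^sub>\<infinity>e. norm (?g (k, e)))) summable_on UNIV"
    proof (rule summable_on_comparison_test)
      fix k :: nat
      have "(\<Sum>\<^sub>\<infinity>e. norm (?g (k, e))) = norm (?c k) * (\<Sum>\<^sub>\<infinity>e. norm (?b k e))"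
        by (simp only: norm_mult prod.case infsum_cmult_right')
      also have "\<dots> \<le> 1 * M ^ Suc k"
        by (intro mult_mono c conjunct2[OF conjunct2[OF pow]] infsum_nonneg norm_ge_zero zero_le_one)
      finally show "norm (\<Sum>\<^sub>\<infinity>e. norm (?g (k, e))) \<le> M ^ Suc k"
        by (simp only: real_norm_def abs_of_nonneg[OF infsum_nonneg[OF norm_ge_zero]] mult_1)
    qed (rule norm_ge_zero)
  qed
  have inner: "((\<lambda>e. ?g (k, e)) has_sum (?c k * z ^ Suc k)) UNIV" for k
    using has_sum_cmult_right[OF conjunct1[OF pow[of "Suc k"]], of "?c k"] by (simp only: prod.case)
  have "norm z < 1" using M M01 by simp
  have "((\<lambda>k. ?c k * z ^ Suc k) has_sum ln (1 + z)) UNIV"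
  proof (rule norm_summable_imp_has_sum)
    have "summable (\<lambda>k. norm z ^ Suc k)"
      using \<open>norm z < 1\<close> by (simp only: summable_Suc_iff summable_geometric real_norm_def abs_norm_cancel)
    then show "summable (\<lambda>k. norm (?c k * z ^ Suc k))"
    proof (rule summable_comparison_test'[where N = 0])
      show "norm (norm (?c k * z ^ Suc k)) \<le> norm z ^ Suc k" for k
        unfolding real_norm_def abs_norm_cancel
        unfolding norm_mult norm_power[of z]
        by (intro mult_left_le_one_le c) (simp_all only: zero_le_power norm_ge_zero)
    qed
    have "(\<lambda>n. (-1) ^ Suc n / of_nat n * z ^ n) sums ln (1 + z)"
      using Ln_series[OF \<open>norm z < 1\<close>] .
    \<comment> \<open>The added term of index 0 is zero, because division by \<open>of_nat 0\<close>
      gives 0; it has the form required for shifting the index by one.\<close>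
    then have "(\<lambda>n. (-1) ^ Suc n / of_nat n * z ^ n) sums (ln (1 + z) + (-1) ^ Suc 0 / of_nat 0 * z ^ 0)"
      by simp
    then have "(\<lambda>n. (-1) ^ Suc (Suc n) / of_nat (Suc n) * z ^ Suc n) sums ln (1 + z)"
      by (rule sums_Suc_iff[where f = "\<lambda>n. (-1) ^ Suc n / of_nat n * z ^ n", THEN iffD2])
    then show "(\<lambda>k. ?c k * z ^ Suc k) sums ln (1 + z)"
      by (simp only: power_Suc mult_minus1 minus_minus)
  qed
  then have g: "(?g has_sum ln (1 + z)) (UNIV \<times> UNIV)"
    by (rule has_sum_SigmaI[OF inner]) (rule abs_summable_summable[OF abs])
  have swap: "bij_betw prod.swap (UNIV \<times> UNIV) (UNIV \<times> UNIV)"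
    by (simp add: bij_betw_def)
  have g_swap: "?g (prod.swap w) = (case w of (e, k) \<Rightarrow> ?c k * ?b k e)" for w
    unfolding split_def fst_swap snd_swap ..
  have sum: "((\<lambda>(e, k). ?c k * ?b k e) has_sum ln (1 + z)) (UNIV \<times> UNIV)"
    using has_sum_reindex_bij_betw[OF swap, THEN iffD2, OF g] unfolding g_swap .
  have abs': "(\<lambda>w. norm (case w of (e, k) \<Rightarrow> ?c k * ?b k e)) summable_on (UNIV \<times> UNIV)"
    using summable_on_reindex_bij_betw[OF swap, THEN iffD2, OF abs] unfolding g_swap .
  let ?L = "\<lambda>(i, j). LogQ_coeff (Suc q) i j * x powi i * y ^ j"
  have inner': "((\<lambda>k. ?c k * ?b k e) has_sum ?L e) UNIV" for e
    using LogQ_coeff_has_sum[of q x y "fst e" "snd e"] by (simp only: split_def prod.collapse)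
  have L: "(?L has_sum ln (1 + z)) UNIV"
    by (rule has_sum_SigmaD[OF sum]) (unfold prod.case, rule inner')
  have *: "(\<lambda>k. norm (?c k * ?b k e)) summable_on UNIV"
    "(\<lambda>e. norm (\<Sum>\<^sub>\<infinity>k. norm (?c k * ?b k e))) summable_on UNIV" for e
    using abs' unfolding Infinite_Sum.abs_summable_on_Sigma_iff prod.case by blast+
  have "(\<lambda>e. norm (?L e)) summable_on UNIV"
  proof (rule Infinite_Sum.abs_summable_on_comparison_test[OF *(2)])
    fix e
    have "norm (?L e) \<le> (\<Sum>\<^sub>\<infinity>k. norm (?c k * ?b k e))"
      using norm_infsum_bound[OF *(1)[of e]] unfolding infsumI[OF inner'[of e]] .
    also have "\<dots> \<le> norm \<dots>"
      unfolding real_norm_def by (rule abs_ge_self)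
    finally show "norm (?L e) \<le> norm (\<Sum>\<^sub>\<infinity>k. norm (?c k * ?b k e))" .
  qed
  then have "(\<lambda>(i, j). norm (LogQ_coeff (Suc q) i j * x powi i * y ^ j)) summable_on UNIV"
    by (simp only: split_def)
  then show ?thesis by (rule that[OF z \<open>norm z < 1\<close> L])
qed

end

section \<open>Zeros in annuli\<close>

lemma contour_integral_powi_circlepath:
  assumes "r > 0"
  shows "((\<lambda>z. z powi n) has_contour_integral (if n = -1 then 2 * of_real pi * \<i> else 0)) (circlepath 0 r)"
proof (cases "n = -1")
  case True
  have "((\<lambda>u. 1 / (u - 0)) has_contour_integral (2 * of_real pi * \<i> * 1)) (circlepath 0 r)"
    by (rule Cauchy_integral_circlepath_simple) (use assms in auto)
  then show ?thesis using True by (simp add: power_int_minus field_simps)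
next
  case False
  then have n: "of_int (n + 1) \<noteq> (0::complex)"
    by (metis add.commute add_left_cancel add.right_inverse of_int_eq_0_iff)
  have "((\<lambda>z. z powi n) has_contour_integral
      (pathfinish (circlepath 0 r) powi (n + 1) / of_int (n + 1)
        - pathstart (circlepath 0 r) powi (n + 1) / of_int (n + 1))) (circlepath 0 r)"
  proof (rule contour_integral_primitive[where f = "\<lambda>z. z powi (n + 1) / of_int (n + 1)" and S = "-{0}"])
    show "((\<lambda>z. z powi (n + 1) / of_int (n + 1)) has_field_derivative x powi n) (at x within - {0})"
      if "x \<in> -{0}" for x :: complex
      using n that by (auto intro!: derivative_eq_intros simp del: of_int_add of_int_1)
  qed (use assms in auto)
  then show ?thesis using False by simp
qed

lemma circlepath_argument_principle:
  assumes "f holomorphic_on ball 0 S" "0 < r" "r < S" "\<And>z. norm z = r \<Longrightarrow> f z \<noteq> 0"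
    and "Z = {z \<in> ball 0 S. f z = 0}" "finite Z"
  shows "contour_integral (circlepath 0 r) (\<lambda>x. deriv f x / f x) =
    2 * of_real pi * \<i> * (\<Sum>z\<in>{z\<in>Z. norm z < r}. of_int (zorder f z))"
proof -
  have w0: "winding_number (circlepath 0 r) z = 0" if "norm z > r" for z
    by (rule winding_number_zero_outside[of _ "cball 0 r"]) (use that assms(2) in auto)
  have w1: "winding_number (circlepath 0 r) z = 1" if "norm z < r" for z
    by (rule winding_number_circlepath) (use that in auto)
  have out: "winding_number (circlepath 0 r) z = 0" if "z \<in> Z" "\<not> norm z < r" for z
    by (rule w0) (use that assms(4,5) in \<open>auto simp: order_less_le\<close>)
  have "contour_integral (circlepath 0 r) (\<lambda>x. deriv f x * 1 / f x) = 2 * of_real pi * \<i> *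
      (\<Sum>z\<in>{w\<in>ball 0 S. f w = 0 \<or> w \<in> {}}. winding_number (circlepath 0 r) z * 1 * of_int (zorder f z))"
    by (subst argument_principle[where S = "ball 0 S" and poles = "{}"])
       (use assms w0 in \<open>auto simp: sphere_def\<close>)
  also have "{w\<in>ball 0 S. f w = 0 \<or> w \<in> {}} = Z" using assms by auto
  also have "(\<Sum>z\<in>Z. winding_number (circlepath 0 r) z * 1 * of_int (zorder f z)) =
      (\<Sum>z\<in>{z\<in>Z. norm z < r}. of_int (zorder f z))"
    by (rule sum.mono_neutral_cong_right)
       (use \<open>finite Z\<close> out w1 in auto)
  finally show ?thesis by simp
qed

lemma circlepath_residue_theorem:
  assumes "f holomorphic_on ball 0 S - Z" "0 < r" "r < S" "\<And>z. norm z = r \<Longrightarrow> z \<notin> Z" "finite Z"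
  shows "contour_integral (circlepath 0 r) f =
    2 * of_real pi * \<i> * (\<Sum>z\<in>{z\<in>Z. norm z < r}. residue f z)"
proof -
  have w0: "winding_number (circlepath 0 r) z = 0" if "norm z > r" for z
    by (rule winding_number_zero_outside[of _ "cball 0 r"]) (use that assms(2) in auto)
  have w1: "winding_number (circlepath 0 r) z = 1" if "norm z < r" for z
    by (rule winding_number_circlepath) (use that in auto)
  have out: "winding_number (circlepath 0 r) z = 0" if "z \<in> Z" "\<not> norm z < r" for z
    by (rule w0) (use that assms(4) in \<open>auto simp: order_less_le\<close>)
  have "contour_integral (circlepath 0 r) f = 2 * of_real pi * \<i> *
      (\<Sum>z\<in>Z. winding_number (circlepath 0 r) z * residue f z)"
    by (subst Residue_theorem[where S = "ball 0 S" and pts = Z])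
       (use assms w0 in \<open>auto simp: sphere_def\<close>)
  also have "(\<Sum>z\<in>Z. winding_number (circlepath 0 r) z * residue f z) =
      (\<Sum>z\<in>{z\<in>Z. norm z < r}. residue f z)"
    by (rule sum.mono_neutral_cong_right)
       (use \<open>finite Z\<close> out w1 in auto)
  finally show ?thesis .
qed

text \<open>The difference of the two counts is the total order of the zeros in the annulus. It
  equals 1, so there is exactly one zero z and it is simple. At z the function f' / (f x) has
  residue 1 / z; the residues at 0 and inside the inner circle occur in both integrals and
  cancel.\<close>

lemma unique_zero_in_annulus:
  fixes f :: "complex \<Rightarrow> complex" and q :: nat
  assumes f: "f holomorphic_on UNIV" and R: "0 < R" "R < R'"
    and nz: "\<And>z. norm z = R \<Longrightarrow> f z \<noteq> 0" "\<And>z. norm z = R' \<Longrightarrow> f z \<noteq> 0" "f 0 \<noteq> 0"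
    and cnt: "contour_integral (circlepath 0 R) (\<lambda>x. deriv f x / f x) = 2 * of_real pi * \<i> * of_nat q"
      "contour_integral (circlepath 0 R') (\<lambda>x. deriv f x / f x) = 2 * of_real pi * \<i> * of_nat (Suc q)"
  obtains z where "\<And>w. R \<le> norm w \<Longrightarrow> norm w \<le> R' \<Longrightarrow> f w = 0 \<longleftrightarrow> w = z"
    "R < norm z" "norm z < R'"
    "contour_integral (circlepath 0 R') (\<lambda>x. deriv f x / (f x * x))
      - contour_integral (circlepath 0 R) (\<lambda>x. deriv f x / (f x * x)) = 2 * of_real pi * \<i> / z"
proof -
  define S where "S = R' + 1"
  define Z where "Z = {z \<in> ball 0 S. f z = 0}"
  \<comment> \<open>A constant f would make the integral on the outer circle 0, but q + 1 is
    positive. Non-constancy gives finitely many zeros in a disc.\<close>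
  have "\<not> f constant_on UNIV"
  proof
    assume "f constant_on UNIV"
    then have "f = (\<lambda>_. f 0)" by (auto simp: constant_on_def)
    then have "deriv f = (\<lambda>_. 0)" by (metis deriv_const)
    then show False using cnt(2) by (simp del: of_nat_Suc)
  qed
  then have "finite {z \<in> cball 0 S. f z = 0}"
    by (intro holomorphic_compact_finite_zeros[of f UNIV]) (use f in auto)
  then have "finite Z"
    by (rule rev_finite_subset) (auto simp: Z_def)
  have RS: "R < S" "R' < S" "0 < R'" using R by (auto simp: S_def)
  have fS: "f holomorphic_on ball 0 S" using f holomorphic_on_subset by blast
  define D where "D = {z\<in>Z. R < norm z \<and> norm z < R'}"
  have split: "{z\<in>Z. norm z < R'} = {z\<in>Z. norm z < R} \<union> D" "{z\<in>Z. norm z < R} \<inter> D = {}"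
    using R nz by (auto simp: D_def Z_def) (meson linorder_neqE_linordered_idom)
  have fin: "finite {z\<in>Z. norm z < R}" "finite D"
    using \<open>finite Z\<close> by (auto simp: D_def)
  have nz0: "\<exists>w\<in>UNIV. f w \<noteq> 0" using nz(3) by blast
  have ord: "zorder f z \<ge> 1" if "z \<in> Z" for z
    using zorder_exist_zero[OF f open_UNIV connected_UNIV UNIV_I nz0, of z] that
    by (auto simp: Z_def)
  have "2 * of_real pi * \<i> * of_nat (Suc q) - 2 * of_real pi * \<i> * of_nat q
      = 2 * of_real pi * \<i> * (\<Sum>z\<in>D. of_int (zorder f z))"
    unfolding cnt[symmetric]
    using circlepath_argument_principle[OF fS \<open>0 < R\<close> RS(1) nz(1) Z_def \<open>finite Z\<close>]
      circlepath_argument_principle[OF fS RS(3) RS(2) nz(2) Z_def \<open>finite Z\<close>]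
    by (simp add: split fin sum.union_disjoint algebra_simps)
  then have "2 * of_real pi * \<i> * (\<Sum>z\<in>D. of_int (zorder f z)) = 2 * of_real pi * \<i> * of_int 1"
    by (simp add: algebra_simps)
  then have "of_int (\<Sum>z\<in>D. zorder f z) = (of_int 1 :: complex)" by simp
  then have sum1: "(\<Sum>z\<in>D. zorder f z) = 1" by (simp only: of_int_eq_iff)
  then obtain z where z: "z \<in> D" by fastforce
  have "(\<Sum>w\<in>D - {z}. zorder f w) + zorder f z = 1"
    using sum1 sum.remove[OF fin(2) z, of "zorder f"] by simp
  moreover have "(\<Sum>w\<in>D - {z}. zorder f w) \<ge> of_nat (card (D - {z})) * 1"
    by (rule sum_bounded_below) (use ord in \<open>auto simp: D_def\<close>)
  moreover have "zorder f z \<ge> 1" using ord z by (auto simp: D_def)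
  ultimately have "card (D - {z}) = 0" and z1: "zorder f z = 1" by linarith+
  then have "D - {z} = {}" using fin(2) by (simp only: card_0_eq finite_Diff)
  with z have D: "D = {z}" by blast
  have zR: "R < norm z" "norm z < R'" "f z = 0" using z by (auto simp: D_def Z_def)
  have z0: "z \<noteq> 0" using zR R by auto
  \<comment> \<open>Order 1 means f(w) = g(w)(w - z) near z with g(z) nonzero, so the derivative at
    z is g(z). The formula for the residue divides by it.\<close>
  have "deriv f z \<noteq> 0"
  proof -
    obtain r where r: "r > 0" "zor_poly f z holomorphic_on cball z r"
      "\<forall>w\<in>cball z r. f w = zor_poly f z w * (w - z) ^ nat (zorder f z) \<and> zor_poly f z w \<noteq> 0"
      using zorder_exist_zero[OF f open_UNIV connected_UNIV UNIV_I nz0, of z] by auto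
    have "((\<lambda>w. zor_poly f z w * (w - z)) has_field_derivative
        deriv (zor_poly f z) z * (z - z) + (1 - 0) * zor_poly f z z) (at z)"
      by (intro DERIV_mult DERIV_diff DERIV_ident DERIV_const holomorphic_derivI[of _ "ball z r"])
         (use r in \<open>auto intro: holomorphic_on_subset\<close>)
    then have "(f has_field_derivative
        deriv (zor_poly f z) z * (z - z) + (1 - 0) * zor_poly f z z) (at z)"
      by (rule has_field_derivative_transform_within_open[where S = "ball z r"])
         (use r z1 in auto)
    then show ?thesis using r by (auto dest: DERIV_imp_deriv)
  qed
  have res: "residue (\<lambda>x. deriv f x / (f x * x)) z = 1 / z"
  proof -
    have "residue (\<lambda>x. deriv f x / x / f x) z = deriv f z / z / deriv f z"
      by (rule residue_simple_pole_deriv[of _ "ball z (norm z)"])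
         (use f z0 \<open>deriv f z \<noteq> 0\<close> zR in \<open>auto intro!: holomorphic_intros holomorphic_derivI[of f UNIV]
            intro: holomorphic_on_subset[of _ UNIV] simp: dist_norm\<close>)
    then show ?thesis using \<open>deriv f z \<noteq> 0\<close> by (simp add: mult.commute)
  qed
  have hol: "(\<lambda>x. deriv f x / (f x * x)) holomorphic_on ball 0 S - insert 0 Z"
    by (intro holomorphic_intros holomorphic_on_subset[OF holomorphic_deriv[OF f]] holomorphic_on_subset[OF f])
       (auto simp: Z_def)
  have fin0: "finite (insert 0 Z)" using \<open>finite Z\<close> by simp
  have out: "w \<notin> insert 0 Z" if "norm w = R \<or> norm w = R'" for w
    using that nz R by (auto simp: Z_def)
  have res_R: "contour_integral (circlepath 0 R) (\<lambda>x. deriv f x / (f x * x)) =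
      2 * of_real pi * \<i> * (\<Sum>w\<in>{w \<in> insert 0 Z. norm w < R}. residue (\<lambda>x. deriv f x / (f x * x)) w)"
    by (rule circlepath_residue_theorem[OF hol \<open>0 < R\<close> RS(1) _ fin0]) (use out in blast)
  have res_R': "contour_integral (circlepath 0 R') (\<lambda>x. deriv f x / (f x * x)) =
      2 * of_real pi * \<i> * (\<Sum>w\<in>{w \<in> insert 0 Z. norm w < R'}. residue (\<lambda>x. deriv f x / (f x * x)) w)"
    by (rule circlepath_residue_theorem[OF hol RS(3) RS(2) _ fin0]) (use out in blast)
  have "contour_integral (circlepath 0 R') (\<lambda>x. deriv f x / (f x * x))
      - contour_integral (circlepath 0 R) (\<lambda>x. deriv f x / (f x * x)) = 
      2 * of_real pi * \<i> * ((\<Sum>w\<in>{w \<in> insert 0 Z. norm w < R'}. residue (\<lambda>x. deriv f x / (f x * x)) w)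
        - (\<Sum>w\<in>{w \<in> insert 0 Z. norm w < R}. residue (\<lambda>x. deriv f x / (f x * x)) w))"
    unfolding res_R res_R' by (simp only: right_diff_distrib)
  also have "{w \<in> insert 0 Z. norm w < R'} = insert z {w \<in> insert 0 Z. norm w < R}"
  proof -
    have "(w \<in> Z \<and> norm w < R') \<longleftrightarrow> (w \<in> Z \<and> norm w < R) \<or> w = z" for w
      using split(1) unfolding D by blast
    moreover have "norm (0::complex) < R" "norm (0::complex) < R'" using R by simp_all
    ultimately show ?thesis by blast
  qed
  also have "(\<Sum>w\<in>insert z {w \<in> insert 0 Z. norm w < R}. residue (\<lambda>x. deriv f x / (f x * x)) w)
      = 1 / z + (\<Sum>w\<in>{w \<in> insert 0 Z. norm w < R}. residue (\<lambda>x. deriv f x / (f x * x)) w)"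
    using fin0 zR(1) by (subst sum.insert) (simp_all add: res del: mem_Collect_eq insert_iff, simp)
  finally have "contour_integral (circlepath 0 R') (\<lambda>x. deriv f x / (f x * x))
      - contour_integral (circlepath 0 R) (\<lambda>x. deriv f x / (f x * x)) = 2 * of_real pi * \<i> / z"
    by simp
  moreover have "f w = 0 \<longleftrightarrow> w = z" if "R \<le> norm w" "norm w \<le> R'" for w
  proof -
    have "w \<in> D" if w: "f w = 0"
    proof -
      have "norm w \<noteq> R" "norm w \<noteq> R'" using nz w by blast+
      then show ?thesis using \<open>R \<le> norm w\<close> \<open>norm w \<le> R'\<close> w RS by (simp add: D_def Z_def)
    qed
    then show ?thesis using D zR by auto
  qed
  ultimately show ?thesis using that[of z] zR(1,2) by blast
qed

section \<open>The zeros of the Borel transform\<close>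

context logconcave_A_flat
begin

abbreviation B :: "complex \<Rightarrow> complex \<Rightarrow> complex" where
  "B y \<equiv> y_borel y f_flat"

lemma summable_y_borel_real:
  assumes "0 \<le> X" "0 \<le> Y" "Y < 1"
  shows "summable (\<lambda>n. a n * X ^ n * Y ^ (n * (n + 1) div 2))"
proof -
  \<comment> \<open>This bounds the quotient of terms n + 1 and n: \<open>ratio 0\<close> is the
    largest quotient of coefficients, and consecutive triangular numbers differ by n + 1.\<close>
  have "(\<lambda>n. ratio 0 * X * Y ^ Suc n) \<longlonglongrightarrow> ratio 0 * X * 0"
    by (intro tendsto_intros LIMSEQ_Suc[OF LIMSEQ_power_zero]) (use assms in auto)
  then have "eventually (\<lambda>n. ratio 0 * X * Y ^ Suc n < 1/2) sequentially"
    by (rule order_tendstoD) auto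
  then obtain N where N: "\<And>n. n \<ge> N \<Longrightarrow> ratio 0 * X * Y ^ Suc n < 1/2"
    unfolding eventually_sequentially by blast
  show ?thesis
  proof (rule summable_ratio_test[of "1/2" N])
    fix n assume "n \<ge> N"
    let ?f = "\<lambda>n. a n * X ^ n * Y ^ (n * (n + 1) div 2)"
    have f0: "?f n \<ge> 0" for n using assms a_pos[of n] by simp
    have tri: "Suc n * (Suc n + 1) div 2 = n * (n + 1) div 2 + Suc n"
      by simp
    have "?f (Suc n) = ?f n * (ratio n * X * Y ^ Suc n)"
      unfolding tri power_add using a_pos[of n] by (simp add: ratio_def field_simps)
    also have "\<dots> \<le> ?f n * (ratio 0 * X * Y ^ Suc n)"
      using ratio_antimono[of 0 n] assms f0[of n] by (intro mult_left_mono mult_right_mono) auto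
    also have "\<dots> \<le> ?f n * (1/2)"
      using N[OF \<open>n \<ge> N\<close>] f0[of n] by (intro mult_left_mono) auto
    finally show "norm (?f (Suc n)) \<le> 1/2 * norm (?f n)"
      using f0[of n] f0[of "Suc n"] by (simp only: real_norm_def abs_of_nonneg)
  qed simp
qed

lemma summable_y_borel:
  fixes x y :: complex
  assumes "norm y < 1"
  shows "summable (\<lambda>n. of_real (a n) * x ^ n * y ^ (n * (n + 1) div 2))"
  by (rule summable_norm_cancel)
     (use summable_y_borel_real[of "norm x" "norm y"] assms a_pos
      in \<open>simp add: norm_mult norm_power less_imp_le\<close>)

lemma holomorphic_y_borel:
  assumes "norm y < 1"
  shows "B y holomorphic_on UNIV"
proof -
  have "B y holomorphic_on ball 0 r" for r
  proof (rule power_series_holomorphic)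
    fix w :: complex
    show "(\<lambda>n. of_real (a n) * y ^ (n * (n + 1) div 2) * (w - 0) ^ n) sums B y w"
      using summable_sums[OF summable_y_borel[OF assms, of w]]
      by (simp add: y_borel_eq mult_ac)
  qed
  then have "B y holomorphic_on (\<Union>r. ball 0 r)"
    by (intro holomorphic_on_UN_open) auto
  also have "(\<Union>r. ball 0 r) = (UNIV :: complex set)"
    by (auto simp: gt_ex)
  finally show ?thesis .
qed

lemma y_borel_0: "B y 0 = of_real (a 0)"
proof -
  have "B y 0 = (\<Sum>n. of_real (a n) * 0 ^ n * y ^ (n * (n + 1) div 2))" by (simp add: y_borel_eq)
  also have "\<dots> = (\<Sum>n\<in>{0}. of_real (a n) * 0 ^ n * y ^ (n * (n + 1) div 2))"
    by (rule suminf_finite) auto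
  finally show ?thesis by simp
qed

text \<open>Solves |x y^q| * \<open>ratio q\<close> * r = 1 for |x| when |y| = r^2, which is the
  radius condition of \<open>norm_zterm_le\<close> after the substitution.\<close>

definition rad :: "real \<Rightarrow> nat \<Rightarrow> real" where
  "rad r q = 1 / (ratio q * r ^ (2 * q + 1))"

lemma rad_pos: "r > 0 \<Longrightarrow> rad r q > 0"
  by (simp add: rad_def ratio_pos)

lemma rad_less_Suc:
  assumes "0 < r" "r < 1"
  shows "rad r q < rad r (Suc q)"
  unfolding rad_def
proof (rule divide_strict_left_mono)
  have "r ^ (2 * Suc q + 1) < r ^ (2 * q + 1)"
    by (rule power_strict_decreasing) (use assms in auto)
  then show "ratio (Suc q) * r ^ (2 * Suc q + 1) < ratio q * r ^ (2 * q + 1)"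
    using ratio_antimono[of q "Suc q"] ratio_pos assms by (intro mult_le_less_imp_less) auto
qed (use assms ratio_pos in auto)

lemma rad_unbounded:
  assumes "0 < r" "r < 1"
  obtains q where "x < rad r q"
proof -
  have "(\<lambda>n. r ^ n) \<longlonglongrightarrow> 0" by (rule LIMSEQ_power_zero) (use assms in auto)
  then have "filterlim (\<lambda>n. r ^ n) (at_right 0) sequentially"
    using assms by (auto simp: filterlim_at)
  then have "filterlim (\<lambda>n. inverse (r ^ n)) at_top sequentially"
    by (rule filterlim_compose[OF filterlim_inverse_at_top_right])
  then have "eventually (\<lambda>n. inverse (r ^ n) > x * ratio 0) sequentially"
    by (auto simp: filterlim_at_top_dense)
  then obtain n where n: "inverse (r ^ n) > x * ratio 0"
    by (auto simp: eventually_sequentially)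
  have "x < inverse (r ^ n) / ratio 0"
    using n ratio_pos[of 0] by (simp add: pos_less_divide_eq)
  also have "\<dots> = 1 / (ratio 0 * r ^ n)" by (simp add: field_simps)
  also have "\<dots> \<le> rad r n"
    unfolding rad_def using ratio_antimono[of 0 n] ratio_pos[of n] ratio_pos[of 0] assms
    by (intro divide_left_mono mult_mono power_decreasing mult_pos_pos) auto
  finally show ?thesis using that by blast
qed

text \<open>On the circle, B divided by its term of index q is a function W with |W - 1| < 1, so the
  principal logarithm of W is available along the whole closed curve. Hence W has no net change of
  argument, and the count q comes from the factor x^q alone. Integrating
  \<open>ln (W x) * x powi (-2)\<close> term by term selects the exponent 1 of x, and an integration
  by parts turns this integral into that of B' / (B x).\<close>

lemma y_borel_circle:
  fixes q :: nat and r s :: real and y :: complex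
  assumes r: "0 < r" "r < 1" "(\<lambda>k. r ^ (Suc k)\<^sup>2) sums s" "2 * s < 1"
    and y: "norm y = r\<^sup>2"
  defines "R \<equiv> rad r q"
  shows y_borel_circle_nonzero: "\<And>x. norm x = R \<Longrightarrow> B y x \<noteq> 0"
    and y_borel_circle_count:
      "contour_integral (circlepath 0 R) (\<lambda>x. deriv (B y) x / B y x) = 2 * of_real pi * \<i> * of_nat q"
    and y_borel_circle_LogQ:
      "((\<lambda>j. 2 * of_real pi * \<i> * (y ^ q * LogQ_coeff (Suc q) 1 j * y ^ j)) has_sum
        contour_integral (circlepath 0 R) (\<lambda>x. deriv (B y) x / (B y x * x))) UNIV"
proof -
  let ?\<gamma> = "circlepath 0 R"
  have "R > 0" unfolding R_def by (rule rad_pos) fact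
  have y0: "y \<noteq> 0" and y1: "norm y < 1"
    using y r by (auto simp: power_less_one_iff)
  have hol: "B y holomorphic_on UNIV" by (rule holomorphic_y_borel) fact
  define C where "C = of_real (a q) * y ^ (q * (q + 1) div 2)"
  have C: "C \<noteq> 0" using a_pos[of q] y0 by (simp add: C_def)
  define W where "W = (\<lambda>x. B y x / (C * x ^ q))"
  have nrm: "norm (x * y ^ q) * ratio q * r = 1" if "norm x = R" for x
  proof -
    have "norm (x * y ^ q) = rad r q * r ^ (2 * q)"
      by (simp add: norm_mult norm_power y that R_def power_mult)
    moreover have "1 / (k * (p * r)) * p * k * r = 1" if "p > 0" "k > 0" for p k :: real
      using that r(1) by (simp add: field_simps)
    from this[of "r ^ (2 * q)" "ratio q"] have "rad r q * r ^ (2 * q) * ratio q * r = 1"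
      unfolding rad_def power_add power_one_right using ratio_pos r(1) by simp
    ultimately show ?thesis by (simp only:)
  qed
  have circ: "norm (W x - 1) < 1 \<and>
      ((\<lambda>(i, j). LogQ_coeff (Suc q) i j * (x * y ^ q) powi i * y ^ j) has_sum ln (W x)) UNIV \<and>
      (\<lambda>(i, j). norm (LogQ_coeff (Suc q) i j * (x * y ^ q) powi i * y ^ j)) summable_on UNIV"
    if x: "norm x = R" for x
  proof -
    have x0: "x \<noteq> 0" using x \<open>R > 0\<close> by auto
    obtain z where z: "(zterm q (x * y ^ q) y has_sum z) (-{0})" "norm z < 1"
      "((\<lambda>(i, j). LogQ_coeff (Suc q) i j * (x * y ^ q) powi i * y ^ j) has_sum ln (1 + z)) UNIV"
      "(\<lambda>(i, j). norm (LogQ_coeff (Suc q) i j * (x * y ^ q) powi i * y ^ j)) summable_on UNIV"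
      using has_sum_LogQ[OF y nrm[OF x] r(3) less_imp_le[OF r(1)] r(4)] .
    have "W x = 1 + z"
      using y_borel_eq_zterm[OF z(1) x0 y0] C x0 by (simp add: W_def C_def)
    then show ?thesis using z by (simp only: add_diff_cancel_left')
  qed
  have W0: "W x \<noteq> 0" "W x \<notin> \<real>\<^sub>\<le>\<^sub>0" if "norm x = R" for x
  proof -
    have "norm (W x - 1) < 1" using circ that by blast
    then have "\<bar>Re (W x - 1)\<bar> < 1" using abs_Re_le_cmod[of "W x - 1"] by linarith
    then have "Re (W x) > 0" by simp
    then show "W x \<noteq> 0" "W x \<notin> \<real>\<^sub>\<le>\<^sub>0" by (auto simp: complex_nonpos_Reals_iff)
  qed
  show nz: "B y x \<noteq> 0" if "norm x = R" for x
    using W0(1)[OF that] by (auto simp: W_def)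
  have dW: "(W has_field_derivative W x * (deriv (B y) x / B y x - of_nat q / x)) (at x)"
    if "norm x = R" for x
  proof -
    have x0: "x \<noteq> 0" using that \<open>R > 0\<close> by auto
    have "(B y has_field_derivative deriv (B y) x) (at x)"
      using hol holomorphic_derivI by blast
    then have "(W has_field_derivative (deriv (B y) x * (C * x ^ q) - B y x * (C * (of_nat q * x ^ (q - 1)))) / ((C * x ^ q) * (C * x ^ q))) (at x)"
      unfolding W_def using C x0 by (auto intro!: derivative_eq_intros)
    also have "(deriv (B y) x * (C * x ^ q) - B y x * (C * (of_nat q * x ^ (q - 1)))) / ((C * x ^ q) * (C * x ^ q))
        = W x * (deriv (B y) x / B y x - of_nat q / x)"
      using C x0 nz[OF that] unfolding W_def by (cases q) (auto simp: field_simps)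
    finally show ?thesis .
  qed
  have loop: "pathfinish ?\<gamma> = pathstart ?\<gamma>" by simp
  have img: "path_image ?\<gamma> = {x. norm x = R}" using \<open>R > 0\<close> by (auto simp: sphere_def)
  have cont_B: "continuous_on S (B y)" "continuous_on S (deriv (B y))" for S
    using hol holomorphic_deriv[OF hol open_UNIV]
    by (meson holomorphic_on_imp_continuous_on continuous_on_subset subset_UNIV)+
  have int1: "(\<lambda>x. deriv (B y) x / B y x) contour_integrable_on ?\<gamma>"
    by (rule contour_integrable_continuous_circlepath)
       (use \<open>R > 0\<close> nz cont_B in \<open>auto intro!: continuous_intros simp: sphere_def\<close>)
  have int2: "(\<lambda>x. deriv (B y) x / (B y x * x)) contour_integrable_on ?\<gamma>"
    by (rule contour_integrable_continuous_circlepath)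
       (use \<open>R > 0\<close> nz cont_B in \<open>auto intro!: continuous_intros simp: sphere_def\<close>)
  \<comment> \<open>The integrand is the logarithmic derivative of W, whose primitive takes equal
    values at both ends of the circle.\<close>
  have "((\<lambda>x. deriv (B y) x / B y x - of_nat q / x) has_contour_integral
      (ln (W (pathfinish ?\<gamma>)) - ln (W (pathstart ?\<gamma>)))) ?\<gamma>"
  proof (rule contour_integral_primitive[where f = "\<lambda>x. ln (W x)" and S = "{x. norm x = R}"])
    fix x :: complex assume "x \<in> {x. norm x = R}"
    then have x: "norm x = R" by simp
    show "((\<lambda>x. ln (W x)) has_field_derivative deriv (B y) x / B y x - of_nat q / x) (at x within {x. norm x = R})"
      using W0[OF x] by (auto intro!: derivative_eq_intros DERIV_subset[OF dW[OF x]])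
  qed (use img in auto)
  then have *: "((\<lambda>x. deriv (B y) x / B y x - of_nat q / x) has_contour_integral 0) ?\<gamma>"
    by (simp only: loop diff_self)
  have "((\<lambda>x. of_nat q * x powi -1) has_contour_integral of_nat q * (2 * of_real pi * \<i>)) ?\<gamma>"
    using has_contour_integral_lmul[OF contour_integral_powi_circlepath[OF \<open>R > 0\<close>, of "-1"]] by simp
  from has_contour_integral_add[OF * this]
  show "contour_integral ?\<gamma> (\<lambda>x. deriv (B y) x / B y x) = 2 * of_real pi * \<i> * of_nat q"
    by (intro contour_integral_unique) (simp add: field_simps)

  define T where "T = (\<lambda>(i, j) x. LogQ_coeff (Suc q) i j * (y ^ q) powi i * y ^ j * x powi (i - 2))"
  have T_eq: "T e x = (case e of (i, j) \<Rightarrow> LogQ_coeff (Suc q) i j * (x * y ^ q) powi i * y ^ j) * x powi (-2)"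
    if "norm x = R" for e x
    using that \<open>R > 0\<close>
    by (auto simp: T_def power_int_mult_distrib power_int_diff power_int_minus field_simps split: prod.splits)
  \<comment> \<open>On the circle the norm of a term does not depend on x, so its value at the point
    R serves as a Weierstrass majorant.\<close>
  let ?M = "\<lambda>e. norm (T e (of_real R))"
  have R_nrm: "norm (complex_of_real R) = R" using \<open>R > 0\<close> by simp
  have "?M summable_on UNIV"
  proof -
    have "(\<lambda>e. (case e of (i, j) \<Rightarrow> norm (LogQ_coeff (Suc q) i j * (of_real R * y ^ q) powi i * y ^ j)) * norm (of_real R powi (-2) :: complex)) summable_on UNIV"
      by (rule summable_on_cmult_left) (use circ[OF R_nrm] in blast)
    then show ?thesis
      by (simp add: T_eq[OF R_nrm] norm_mult split_def)
  qed
  have "uniform_limit (path_image ?\<gamma>) (\<lambda>S x. \<Sum>e\<in>S. T e x) (\<lambda>x. ln (W x) * x powi (-2)) (finite_subsets_at_top UNIV)"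
  proof (rule Weierstrass_m_test_general'[where M = ?M])
    fix e :: "int \<times> nat" and x :: complex assume "x \<in> path_image ?\<gamma>"
    then have x: "norm x = R" unfolding img by simp
    show "norm (T e x) \<le> ?M e"
      using x \<open>R > 0\<close> by (simp add: T_def norm_mult norm_power norm_power_int split_def)
  next
    fix x :: complex assume "x \<in> path_image ?\<gamma>"
    then have x: "norm x = R" unfolding img by simp
    show "((\<lambda>e. T e x) has_sum ln (W x) * x powi (-2)) UNIV"
      unfolding T_eq[OF x] by (rule has_sum_cmult_left) (use circ[OF x] in blast)
  qed fact
  note ul = this
  \<comment> \<open>The integrals of the terms: x^(i-2) contributes only if i = 1.\<close>
  define K :: "int \<times> nat \<Rightarrow> complex" where
    "K = (\<lambda>(i, j). if i = 1 then 2 * of_real pi * \<i> * (y ^ q * LogQ_coeff (Suc q) 1 j * y ^ j) else 0)"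
  have T_int: "(T e has_contour_integral K e) ?\<gamma>" for e
  proof -
    obtain i j where e: "e = (i, j)" by force
    show ?thesis
      using has_contour_integral_lmul[OF contour_integral_powi_circlepath[OF \<open>R > 0\<close>, of "i - 2"],
        of "LogQ_coeff (Suc q) i j * (y ^ q) powi i * y ^ j"]
      by (auto simp: e T_def K_def split: if_splits) (auto simp: mult_ac)
  qed
  have Tsum: "((\<lambda>x. \<Sum>e\<in>S. T e x) has_contour_integral (\<Sum>e\<in>S. K e)) ?\<gamma>"
    if "finite S" for S
    using that T_int by (intro has_contour_integral_sum) auto
  have T_int_ev: "\<forall>\<^sub>F S in finite_subsets_at_top UNIV. (\<lambda>x. \<Sum>e\<in>S. T e x) contour_integrable_on ?\<gamma>"
    using Tsum by (auto intro!: eventually_finite_subsets_at_top_weakI simp: contour_integrable_on_def)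
  have "norm (vector_derivative ?\<gamma> (at t)) \<le> 2 * pi * R" for t
    using \<open>R > 0\<close> by (simp add: vector_derivative_circlepath norm_mult)
  note lim = contour_integral_uniform_limit[OF T_int_ev ul this valid_path_circlepath finite_subsets_at_top_neq_bot]
  have ev: "eventually (\<lambda>S. contour_integral ?\<gamma> (\<lambda>x. \<Sum>e\<in>S. T e x) = (\<Sum>e\<in>S. K e)) (finite_subsets_at_top UNIV)"
    using Tsum by (auto intro!: eventually_finite_subsets_at_top_weakI contour_integral_unique)
  have "(K
      has_sum contour_integral ?\<gamma> (\<lambda>x. ln (W x) * x powi (-2))) UNIV"
    unfolding has_sum_def
    by (rule Lim_transform_eventually[OF lim(2) ev])
  then have "(K
      has_sum contour_integral ?\<gamma> (\<lambda>x. ln (W x) * x powi (-2))) (Pair 1 ` UNIV)"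
    by (rule has_sum_cong_neutral[THEN iffD1, rotated -1]) (auto simp: K_def)
  then have sum: "((\<lambda>j. 2 * of_real pi * \<i> * (y ^ q * LogQ_coeff (Suc q) 1 j * y ^ j))
      has_sum contour_integral ?\<gamma> (\<lambda>x. ln (W x) * x powi (-2))) UNIV"
    by (subst (asm) has_sum_reindex) (auto simp: o_def K_def inj_on_def)
  \<comment> \<open>Integration by parts with the primitive - ln W / x. The logarithmic derivative
    of W differs from that of B by q / x, which leaves q / x^2; its integral is 0.\<close>
  have "((\<lambda>x. ln (W x) * x powi (-2) - (deriv (B y) x / B y x - of_nat q / x) / x) has_contour_integral
      (- ln (W (pathfinish ?\<gamma>)) / pathfinish ?\<gamma> - (- ln (W (pathstart ?\<gamma>)) / pathstart ?\<gamma>))) ?\<gamma>"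
  proof (rule contour_integral_primitive[where f = "\<lambda>x. - ln (W x) / x" and S = "{x. norm x = R}"])
    fix x :: complex assume "x \<in> {x. norm x = R}"
    then have x: "norm x = R" by simp
    then have x0: "x \<noteq> 0" using \<open>R > 0\<close> by auto
    show "((\<lambda>x. - ln (W x) / x) has_field_derivative ln (W x) * x powi (-2) - (deriv (B y) x / B y x - of_nat q / x) / x) (at x within {x. norm x = R})"
      using W0[OF x] x0
      by (auto intro!: derivative_eq_intros DERIV_subset[OF dW[OF x]])
         (simp add: power_int_minus power2_eq_square field_simps)
  qed (use img in auto)
  then have 1: "((\<lambda>x. ln (W x) * x powi (-2) - (deriv (B y) x / B y x - of_nat q / x) / x) has_contour_integral 0) ?\<gamma>"
    by (simp only: loop diff_self)
  have 2: "((\<lambda>x. ln (W x) * x powi (-2)) has_contour_integral contour_integral ?\<gamma> (\<lambda>x. ln (W x) * x powi (-2))) ?\<gamma>"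
    by (rule has_contour_integral_integral[OF lim(1)])
  have 3: "((\<lambda>x. of_nat q * x powi (-2)) has_contour_integral 0) ?\<gamma>"
    using has_contour_integral_lmul[OF contour_integral_powi_circlepath[OF \<open>R > 0\<close>, of "-2"]] by simp
  have "((\<lambda>x. deriv (B y) x / (B y x * x)) has_contour_integral contour_integral ?\<gamma> (\<lambda>x. ln (W x) * x powi (-2)) - 0 + 0) ?\<gamma>"
    by (rule has_contour_integral_eq[OF has_contour_integral_add[OF has_contour_integral_diff[OF 2 1] 3]])
       (use img \<open>R > 0\<close> in \<open>auto simp: power_int_minus power2_eq_square divide_inverse ring_distribs\<close>)
  then have "contour_integral ?\<gamma> (\<lambda>x. deriv (B y) x / (B y x * x)) = contour_integral ?\<gamma> (\<lambda>x. ln (W x) * x powi (-2))"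
    by (simp add: contour_integral_unique)
  with sum show "((\<lambda>j. 2 * of_real pi * \<i> * (y ^ q * LogQ_coeff (Suc q) 1 j * y ^ j)) has_sum
        contour_integral ?\<gamma> (\<lambda>x. deriv (B y) x / (B y x * x))) UNIV" by simp
qed

text \<open>Up to 2 pi i, the integrals on the two circles are v_p and v_(p+1) for p = q + 1, and
  the difference outer minus inner is 1 / z for the zero z between them. Hence
  \<open>alpha p y\<close> is -1 / z, which is nonzero, and z is recovered as -1 /
  \<open>alpha p y\<close>.\<close>

lemma y_borel_zero_alpha:
  assumes r: "0 < r" "r < 1" "(\<lambda>k. r ^ (Suc k)\<^sup>2) sums s" "2 * s < 1"
    and y: "norm y = r\<^sup>2"
  shows "summable (\<lambda>n. u_coeff (Suc q) (Suc q + n) * y ^ (Suc q + n))"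
    and "alpha (Suc q) y \<noteq> 0"
    and "rad r q < norm (- 1 / alpha (Suc q) y)" "norm (- 1 / alpha (Suc q) y) < rad r (Suc q)"
    and "\<And>x. rad r q \<le> norm x \<Longrightarrow> norm x \<le> rad r (Suc q) \<Longrightarrow>
      B y x = 0 \<longleftrightarrow> x = - 1 / alpha (Suc q) y"
proof -
  note circ = y_borel_circle[OF r y]
  have y1: "norm y < 1" and y0: "y \<noteq> 0" using r y by (auto simp: power_less_one_iff)
  let ?I = "\<lambda>q. contour_integral (circlepath 0 (rad r q)) (\<lambda>x. deriv (B y) x / (B y x * x))"
  obtain z where z: "\<And>w. rad r q \<le> norm w \<Longrightarrow> norm w \<le> rad r (Suc q) \<Longrightarrow> B y w = 0 \<longleftrightarrow> w = z"
    "rad r q < norm z" "norm z < rad r (Suc q)"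
    and zI: "?I (Suc q) - ?I q = 2 * of_real pi * \<i> / z"
  proof (rule unique_zero_in_annulus[OF holomorphic_y_borel[OF y1] rad_pos[OF r(1)] rad_less_Suc[OF r(1,2)]])
    show "B y 0 \<noteq> 0" using a_pos[of 0] by (simp add: y_borel_0)
  qed (use circ(1) in blast, use circ(1) in blast, rule circ(2), rule circ(2), blast)
  define L where "L = (\<lambda>q j. y ^ q * LogQ_coeff (Suc q) 1 j * y ^ j)"
  have L_sums: "L q sums (?I q / (2 * of_real pi * \<i>))" for q
  proof -
    have "(\<lambda>j. 2 * of_real pi * \<i> * L q j) sums (?I q)"
      using has_sum_imp_sums[OF circ(3)[of q]] by (simp add: L_def)
    from sums_divide[OF this, of "2 * of_real pi * \<i>"] show ?thesis by simp
  qed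
  \<comment> \<open>A contribution to [x^1 y^0] would need 2 * 0 - 1 to be at least the power of
    \<open>Zser\<close>. This zero allows the first series to start at y^(q+1), and it matches the
    convention v_p(q) = 0 for q < p in the second.\<close>
  have LogQ_0: "LogQ_coeff (Suc q) 1 0 = 0" for q
    using Zser_power_coeff_eq_0[of "Suc q" 0 1] a_pos[of q] by (simp add: LogQ_coeff_def A_flat_eq del: power_Suc)
  have "(\<lambda>n. L q (Suc n) - L (Suc q) n) sums
      (?I q / (2 * of_real pi * \<i>) - ?I (Suc q) / (2 * of_real pi * \<i>))"
  proof (rule sums_diff[OF _ L_sums])
    show "(\<lambda>n. L q (Suc n)) sums (?I q / (2 * of_real pi * \<i>))"
      using L_sums[of q] LogQ_0[of q] by (subst sums_Suc_iff) (simp add: L_def)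
  qed
  also have "(\<lambda>n. L q (Suc n) - L (Suc q) n) = (\<lambda>n. u_coeff (Suc q) (Suc q + n) * y ^ (Suc q + n))"
  proof
    fix n
    show "L q (Suc n) - L (Suc q) n = u_coeff (Suc q) (Suc q + n) * y ^ (Suc q + n)"
      using LogQ_0[of "Suc q"]
      by (cases n) (auto simp: L_def u_coeff_def v_coeff_def power_add algebra_simps)
  qed
  also have "?I q / (2 * of_real pi * \<i>) - ?I (Suc q) / (2 * of_real pi * \<i>) = - (?I (Suc q) - ?I q) / (2 * of_real pi * \<i>)"
    by (simp only: diff_divide_distrib minus_diff_eq)
  also have "\<dots> = - 1 / z" unfolding zI by simp
  finally have sums: "(\<lambda>n. u_coeff (Suc q) (Suc q + n) * y ^ (Suc q + n)) sums (- 1 / z)" .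
  then show "summable (\<lambda>n. u_coeff (Suc q) (Suc q + n) * y ^ (Suc q + n))"
    by (rule sums_summable)
  have alpha: "alpha (Suc q) y = - 1 / z"
    unfolding alpha_def by (rule sums_unique[OF sums, symmetric])
  have "z \<noteq> 0" using z(2) rad_pos[OF r(1), of q] by auto
  then show "alpha (Suc q) y \<noteq> 0" by (simp add: alpha)
  have "- 1 / alpha (Suc q) y = z" by (simp add: alpha)
  with z show "rad r q < norm (- 1 / alpha (Suc q) y)" "norm (- 1 / alpha (Suc q) y) < rad r (Suc q)"
    "\<And>x. rad r q \<le> norm x \<Longrightarrow> norm x \<le> rad r (Suc q) \<Longrightarrow> B y x = 0 \<longleftrightarrow> x = - 1 / alpha (Suc q) y"
    by auto
qed

text \<open>Take the first circle that encloses x. It is not circle 0: there the zeros inside are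
  counted with total order 0, while each of them has positive order.\<close>

lemma y_borel_zero_annulus:
  assumes r: "0 < r" "r < 1" "(\<lambda>k. r ^ (Suc k)\<^sup>2) sums s" "2 * s < 1"
    and y: "norm y = r\<^sup>2" and x: "B y x = 0"
  obtains q where "rad r q \<le> norm x" "norm x \<le> rad r (Suc q)"
proof -
  have "\<exists>q. norm x < rad r q" using rad_unbounded[OF r(1,2), of "norm x"] by blast
  then obtain n where least: "norm x < rad r n" "\<And>q. q < n \<Longrightarrow> rad r q \<le> norm x"
    using exists_least_iff[of "\<lambda>q. norm x < rad r q"] by (auto simp: not_less)
  show ?thesis
  proof (cases n)
    case (Suc q)
    then show ?thesis using that[of q] least(1) least(2)[of q] by (simp add: less_imp_le)
  next
    case 0
    then have "norm x < rad r 0" using least by simp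
    have y1: "norm y < 1" using r y by (auto simp: power_less_one_iff)
    note hol = holomorphic_y_borel[OF y1]
    define S where "S = rad r 0 + 1"
    have b0: "B y 0 \<noteq> 0" using a_pos[of 0] by (simp add: y_borel_0)
    have "\<not> B y constant_on UNIV" using b0 x by (metis UNIV_I constant_on_def)
    then have "finite {z \<in> cball 0 S. B y z = 0}"
      by (intro holomorphic_compact_finite_zeros[of _ UNIV]) (use hol in auto)
    then have fin: "finite {z \<in> ball 0 S. B y z = 0}"
      by (rule rev_finite_subset) auto
    have "(\<Sum>z\<in>{z\<in>{z \<in> ball 0 S. B y z = 0}. norm z < rad r 0}. of_int (zorder (B y) z)) = (0 :: complex)"
      using circlepath_argument_principle[of "B y" S "rad r 0", OF holomorphic_on_subset[OF hol] rad_pos[OF r(1)] _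
          y_borel_circle_nonzero[OF r y] refl fin] y_borel_circle_count[OF r y, of 0]
      by (simp add: S_def)
    then have "(\<Sum>z\<in>{z\<in>{z \<in> ball 0 S. B y z = 0}. norm z < rad r 0}. zorder (B y) z) = 0"
      by (simp only: of_int_sum[symmetric] of_int_eq_0_iff)
    moreover have "zorder (B y) z > 0" if "B y z = 0" for z
      using zorder_exist_zero[OF hol open_UNIV connected_UNIV UNIV_I, of z] that b0 by auto
    ultimately have "{z\<in>{z \<in> ball 0 S. B y z = 0}. norm z < rad r 0} = {}"
      using fin sum_pos[of "{z\<in>{z \<in> ball 0 S. B y z = 0}. norm z < rad r 0}" "zorder (B y)"]
      by fastforce
    moreover have "x \<in> {z\<in>{z \<in> ball 0 S. B y z = 0}. norm z < rad r 0}"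
      using x \<open>norm x < rad r 0\<close> by (simp add: S_def)
    ultimately show ?thesis by blast
  qed
qed

lemma y_borel_zeros:
  assumes r: "0 < r" "r < 1" "(\<lambda>k. r ^ (Suc k)\<^sup>2) sums s" "2 * s < 1"
    and y: "norm y = r\<^sup>2"
  shows "{x. B y x = 0} = {- 1 / alpha p y | p. p \<ge> 1 \<and> alpha p y \<noteq> 0}"
proof (intro equalityI subsetI)
  fix x assume "x \<in> {x. B y x = 0}"
  then have x: "B y x = 0" by simp
  obtain q where "rad r q \<le> norm x" "norm x \<le> rad r (Suc q)"
    using y_borel_zero_annulus[OF r y x] .
  then have "x = - 1 / alpha (Suc q) y"
    using y_borel_zero_alpha(5)[OF r y] x by blast
  moreover have "alpha (Suc q) y \<noteq> 0" by (rule y_borel_zero_alpha(2)[OF r y])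
  ultimately show "x \<in> {- 1 / alpha p y | p. p \<ge> 1 \<and> alpha p y \<noteq> 0}"
    by (intro CollectI exI[of _ "Suc q"]) simp
next
  fix x assume "x \<in> {- 1 / alpha p y | p. p \<ge> 1 \<and> alpha p y \<noteq> 0}"
  then obtain q where "x = - 1 / alpha (Suc q) y"
    by (auto simp: Suc_le_eq gr0_conv_Suc)
  then show "x \<in> {x. B y x = 0}"
    using y_borel_zero_alpha(3-5)[OF r y, of q] by (simp add: less_imp_le)
qed

lemma y_borel_cnj: "norm y < 1 \<Longrightarrow> B (cnj y) (cnj x) = cnj (B y x)"
  unfolding y_borel_eq
  using sums_cnj[THEN iffD2, OF summable_sums[OF summable_y_borel[of y x]]]
  by (auto dest!: sums_unique)

lemma y_borel_zeros_real:
  assumes r: "0 < r" "r < 1" "(\<lambda>k. r ^ (Suc k)\<^sup>2) sums s" "2 * s < 1"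
    and x: "B (of_real (r\<^sup>2)) x = 0"
  shows "x \<in> \<real>"
proof -
  let ?y = "complex_of_real (r\<^sup>2)"
  have y: "norm ?y = r\<^sup>2" by (simp only: norm_of_real abs_power2)
  have y1: "norm ?y < 1" unfolding y using r by (simp add: power_less_one_iff)
  obtain q where q: "rad r q \<le> norm x" "norm x \<le> rad r (Suc q)"
    using y_borel_zero_annulus[OF r y x] .
  have "B ?y (cnj x) = 0"
    using y_borel_cnj[OF y1, of x] x by simp
  then have "cnj x = x"
    using y_borel_zero_alpha(5)[OF r y q] y_borel_zero_alpha(5)[OF r y, of q "cnj x"] x q by simp
  then show ?thesis by (simp add: complex_is_Real_iff complex_eq_iff)
qed

section \<open>Continuity in y from the left and the boundary case\<close>

lemma tendsto_y_borel_real: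
  assumes "0 \<le> M" "0 \<le> Y" "Y < 1"
  shows "((\<lambda>t. \<Sum>n. a n * M ^ n * t ^ (n * (n + 1) div 2)) \<longlongrightarrow> (\<Sum>n. a n * M ^ n * Y ^ (n * (n + 1) div 2))) (at Y within {0..Y})"
proof -
  have "uniform_limit {0..Y} (\<lambda>N t. \<Sum>n<N. a n * M ^ n * t ^ (n * (n + 1) div 2))
      (\<lambda>t. \<Sum>n. a n * M ^ n * t ^ (n * (n + 1) div 2)) sequentially"
    by (rule Weierstrass_m_test[OF _ summable_y_borel_real[OF assms]])
       (use assms a_pos in \<open>auto simp: abs_mult power_abs less_imp_le intro!: mult_left_mono power_mono\<close>)
  then have "continuous_on {0..Y} (\<lambda>t. \<Sum>n. a n * M ^ n * t ^ (n * (n + 1) div 2))"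
    by (rule uniform_limit_theorem[rotated]) (auto intro!: always_eventually continuous_intros)
  then show ?thesis using assms by (auto simp: continuous_on)
qed

text \<open>The coefficients are positive and powers of y increase, so the majorant of the
  difference is itself a difference of two real series in M. Uniform convergence on a disc thus
  reduces to left continuity of one real function.\<close>

lemma y_borel_dist_le:
  fixes t Y :: real and x :: complex
  assumes "norm x \<le> M" "0 \<le> t" "t \<le> Y" "Y < 1"
  shows "dist (B (of_real t) x) (B (of_real Y) x) \<le>
    (\<Sum>n. a n * M ^ n * Y ^ (n * (n + 1) div 2)) - (\<Sum>n. a n * M ^ n * t ^ (n * (n + 1) div 2))"
proof -
  let ?e = "\<lambda>n. n * (n + 1) div 2"
  have M: "0 \<le> M" using assms(1) norm_ge_zero order_trans by blast
  have sY: "summable (\<lambda>n. a n * M ^ n * Y ^ ?e n)" and st: "summable (\<lambda>n. a n * M ^ n * t ^ ?e n)"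
    by (rule summable_y_borel_real, use assms M in linarith, use assms in linarith, use assms in linarith)+
  have cY: "summable (\<lambda>n. of_real (a n) * x ^ n * of_real Y ^ ?e n)"
    and ct: "summable (\<lambda>n. of_real (a n) * x ^ n * of_real t ^ ?e n)"
    by (rule summable_y_borel, use assms in simp)+
  have "norm (B (of_real Y) x - B (of_real t) x) =
      norm (\<Sum>n. of_real (a n) * x ^ n * of_real Y ^ ?e n - of_real (a n) * x ^ n * of_real t ^ ?e n)"
    unfolding y_borel_eq suminf_diff[OF cY ct] ..
  also have "\<dots> \<le> (\<Sum>n. a n * M ^ n * Y ^ ?e n - a n * M ^ n * t ^ ?e n)"
  proof (rule norm_suminf_le[OF _ summable_diff[OF sY st]])
    fix n
    have le: "t ^ ?e n \<le> Y ^ ?e n" using assms by (intro power_mono)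
    have "norm (of_real (a n) * x ^ n * of_real Y ^ ?e n - of_real (a n) * x ^ n * of_real t ^ ?e n)
        = norm (of_real (a n) * x ^ n * of_real (Y ^ ?e n - t ^ ?e n))"
      by (simp only: right_diff_distrib of_real_diff of_real_power)
    also have "\<dots> = a n * norm x ^ n * (Y ^ ?e n - t ^ ?e n)"
      unfolding norm_mult norm_of_real norm_power using le a_pos[of n] by (simp add: less_imp_le)
    also have "\<dots> \<le> a n * M ^ n * (Y ^ ?e n - t ^ ?e n)"
      using le a_pos[of n] assms by (intro mult_right_mono mult_left_mono power_mono) auto
    finally show "norm (of_real (a n) * x ^ n * of_real Y ^ ?e n - of_real (a n) * x ^ n * of_real t ^ ?e n)
        \<le> a n * M ^ n * Y ^ ?e n - a n * M ^ n * t ^ ?e n"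
      by (simp only: right_diff_distrib)
  qed
  also have "\<dots> = (\<Sum>n. a n * M ^ n * Y ^ ?e n) - (\<Sum>n. a n * M ^ n * t ^ ?e n)"
    by (rule suminf_diff[OF sY st, symmetric])
  finally show ?thesis by (simp only: dist_norm norm_minus_commute)
qed

text \<open>A nonreal zero x lies in an open half-plane without real points. There the transforms
  for parameters t < Y have no zeros, so by Hurwitz their locally uniform limit has none either,
  unless it is constant.\<close>

lemma y_borel_zeros_real_limit:
  fixes Y :: real
  assumes Y: "0 < Y" "Y < 1"
    and real: "\<And>t x. 0 < t \<Longrightarrow> t < Y \<Longrightarrow> B (of_real t) x = 0 \<Longrightarrow> x \<in> \<real>"
    and x: "B (of_real Y) x = 0"
  shows "x \<in> \<real>"
proof (rule ccontr)
  assume "x \<notin> \<real>"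
  then have x_im: "Im x \<noteq> 0" by (simp add: complex_is_Real_iff)
  define S where "S = (if Im x > 0 then {z. Im z > 0} else {z. Im z < 0})"
  have S: "open S" "connected S" "x \<in> S" "S \<inter> \<real> = {}"
    using x_im by (auto simp: S_def open_halfspace_Im_gt open_halfspace_Im_lt complex_is_Real_iff
      intro!: convex_connected convex_halfspace_Im_gt convex_halfspace_Im_lt)
  \<comment> \<open>The shift by 2 keeps every parameter strictly between 0 and Y, including n =
    0.\<close>
  define t where "t = (\<lambda>n. Y * (1 - 1 / of_nat (n + 2)))"
  have t: "0 < t n" "t n < Y" for n using Y by (auto simp: t_def field_simps intro!: add_pos_nonneg)
  have "t \<longlonglongrightarrow> Y * (1 - 0)"
    unfolding t_def by (intro tendsto_intros LIMSEQ_ignore_initial_segment[OF lim_1_over_n])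
  then have t_lim: "filterlim t (at Y within {0..Y}) sequentially"
    using t by (auto simp: filterlim_at less_imp_le less_imp_neq)
  have holt: "B (of_real (t n)) holomorphic_on S" for n
    using t[of n] Y by (intro holomorphic_on_subset[OF holomorphic_y_borel]) auto
  have holY: "B (of_real Y) holomorphic_on S"
    using Y by (intro holomorphic_on_subset[OF holomorphic_y_borel]) auto
  have ul: "uniform_limit K (\<lambda>n. B (of_real (t n))) (B (of_real Y)) sequentially" if K: "compact K" for K
  proof -
    obtain M where M: "M > 0" "\<And>z. z \<in> K \<Longrightarrow> norm z \<le> M"
      using compact_imp_bounded[OF K] by (auto simp: bounded_pos)
    let ?b = "\<lambda>t. \<Sum>n. a n * M ^ n * t ^ (n * (n + 1) div 2)"
    have "(\<lambda>n. ?b (t n)) \<longlonglongrightarrow> ?b Y"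
      using filterlim_compose[OF tendsto_y_borel_real t_lim] M Y by simp
    show ?thesis
    proof (rule uniform_limitI)
      fix e :: real assume "e > 0"
      then have "eventually (\<lambda>n. dist (?b (t n)) (?b Y) < e) sequentially"
        using \<open>(\<lambda>n. ?b (t n)) \<longlonglongrightarrow> ?b Y\<close> by (rule tendstoD[rotated])
      then show "eventually (\<lambda>n. \<forall>z\<in>K. dist (B (of_real (t n)) z) (B (of_real Y) z) < e) sequentially"
      proof eventually_elim
        case (elim n)
        show ?case
        proof
          fix z assume "z \<in> K"
          have "dist (B (of_real (t n)) z) (B (of_real Y) z) \<le> ?b Y - ?b (t n)"
            by (rule y_borel_dist_le) (use t[of n] Y M \<open>z \<in> K\<close> in auto)
          also have "\<dots> < e" using elim by (simp add: dist_real_def)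
          finally show "dist (B (of_real (t n)) z) (B (of_real Y) z) < e" .
        qed
      qed
    qed
  qed
  \<comment> \<open>Since x is a zero, constancy would mean zero on the half-plane, hence
    everywhere, contradicting the value \<open>a 0\<close> at the origin.\<close>
  have "\<not> B (of_real Y) constant_on S"
  proof
    assume "B (of_real Y) constant_on S"
    then have "B (of_real Y) z = 0" if "z \<in> S" for z
      using x S(3) that by (metis constant_on_def)
    note zero = this
    have "x islimpt S"
      by (rule interior_limit_point) (simp only: interior_open S)
    have "B (of_real Y) 0 = 0"
      by (rule analytic_continuation[OF holomorphic_y_borel open_UNIV connected_UNIV
            subset_UNIV UNIV_I \<open>x islimpt S\<close> zero UNIV_I]) (use Y in simp)
    then show False using a_pos[of 0] by (simp add: y_borel_0)
  qed
  have "B (of_real Y) x \<noteq> 0"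
  proof (rule Hurwitz_no_zeros[OF S(1,2) holt holY ul])
    show "B (of_real (t n)) z \<noteq> 0" if "z \<in> S" for n z
      using real[of "t n" z] t[of n] that S(4) by blast
  qed (use S(3) \<open>\<not> B (of_real Y) constant_on S\<close> in auto)
  then show False using x by simp
qed

end

section \<open>The functional equation of the theta series\<close>

text \<open>An even function of period 1 is a continuous function of cos(2 pi v) on [0, 1], so
  Stone-Weierstrass approximates it uniformly by polynomials in the cosine. D is orthogonal to these
  polynomials, so the integral of D^2 is arbitrarily small.\<close>

lemma even_periodic_eq_0:
  fixes D :: "real \<Rightarrow> real"
  assumes cont: "continuous_on UNIV D" and even: "\<And>v. D (- v) = D v" and per: "\<And>v. D (v + 1) = D v"
    and zero: "\<And>k::nat. integral {0..1} (\<lambda>v. D v * cos (2 * pi * real k * v)) = 0"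
  shows "D 0 = 0"
proof -
  have [continuous_intros]: "continuous_on A D" for A
    using cont continuous_on_subset by blast
  have zero': "integral {0..1} (\<lambda>v. D v * cos (2 * pi * of_int k * v)) = 0" for k :: int
  proof (cases "k \<ge> 0")
    case True
    then show ?thesis using zero[of "nat k"] by simp
  next
    case False
    then have "cos (2 * pi * of_int k * v) = cos (2 * pi * real (nat (- k)) * v)" for v
      using cos_minus[of "2 * pi * of_int k * v"] by simp
    then show ?thesis using zero[of "nat (- k)"] by simp
  qed
  \<comment> \<open>The extra factor cos(2 pi k v) makes the induction work: multiplying by one more
    cosine only shifts k to k + 1 and k - 1. Negative k occur on the way, hence integer
    frequencies.\<close>
  have pow: "integral {0..1} (\<lambda>v. D v * cos (2 * pi * v) ^ j * cos (2 * pi * of_int k * v)) = 0" for j k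
  proof (induction j arbitrary: k)
    case 0
    then show ?case using zero' by simp
  next
    case (Suc j)
    let ?g = "\<lambda>k v. D v * cos (2 * pi * v) ^ j * cos (2 * pi * of_int k * v)"
    have "D v * cos (2 * pi * v) ^ Suc j * cos (2 * pi * of_int k * v) = 1/2 * ?g (k + 1) v + 1/2 * ?g (k - 1) v" for v
    proof -
      have *: "2 * (cos (2 * pi * of_int k * v) * cos (2 * pi * v)) = cos (2 * pi * of_int (k + 1) * v) + cos (2 * pi * of_int (k - 1) * v)"
        using cos_times_cos[of "2 * pi * of_int k * v" "2 * pi * v"] by (simp add: algebra_simps)
      have "D v * cos (2 * pi * v) ^ Suc j * cos (2 * pi * of_int k * v) =
          D v * cos (2 * pi * v) ^ j * (2 * (cos (2 * pi * of_int k * v) * cos (2 * pi * v))) / 2"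
        by simp
      then show ?thesis unfolding * by (simp add: distrib_left add_divide_distrib)
    qed
    then have "integral {0..1} (\<lambda>v. D v * cos (2 * pi * v) ^ Suc j * cos (2 * pi * of_int k * v)) =
        integral {0..1} (\<lambda>v. 1/2 * ?g (k + 1) v + 1/2 * ?g (k - 1) v)" by (simp only:)
    also have "\<dots> = 1/2 * integral {0..1} (?g (k + 1)) + 1/2 * integral {0..1} (?g (k - 1))"
      by (subst integral_add) (auto intro!: integrable_continuous_interval continuous_intros)
    finally show ?case by (simp only: Suc.IH mult_zero_right add_0)
  qed
  have approx: "integral {0..1} (\<lambda>v. D v * D v) \<le> e * integral {0..1} (\<lambda>v. \<bar>D v\<bar>)" if e: "e > 0" for e
  proof -
    define d where "d = (\<lambda>s. D (arccos s / (2 * pi)))"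
    have "continuous_on {-1..1} d"
      unfolding d_def
      by (rule continuous_on_compose2[OF cont]) (auto intro!: continuous_intros continuous_on_arccos)
    then obtain g where g: "real_polynomial_function g" "\<And>s. s \<in> {-1..1} \<Longrightarrow> \<bar>d s - g s\<bar> < e"
      using Stone_Weierstrass_real_polynomial_function[of "{-1..1}" d e] e by auto
    then obtain c N where c: "g = (\<lambda>s. \<Sum>i\<le>N. c i * s ^ i)"
      by (auto simp: real_polynomial_function_iff_sum)
    \<comment> \<open>On the upper half of the interval the arccosine returns 2 pi (1 - v), and D(1
      - v) = D(v) by evenness and periodicity.\<close>
    have d_cos: "d (cos (2 * pi * v)) = D v" if "v \<in> {0..1}" for v
    proof (cases "v \<le> 1/2")
      case True
      then have "arccos (cos (2 * pi * v)) = 2 * pi * v"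
        using that by (intro arccos_cos) auto
      then show ?thesis by (simp add: d_def)
    next
      case False
      have "cos (2 * pi * v) = cos (2 * pi * (1 - v))"
        using cos_periodic[of "- 2 * pi * v"] by (simp add: algebra_simps)
      moreover have "arccos (cos (2 * pi * (1 - v))) = 2 * pi * (1 - v)"
        using that False by (intro arccos_cos) auto
      moreover have "D (1 - v) = D v"
        using per[of "- v"] even[of v] by (simp add: algebra_simps)
      ultimately show ?thesis by (simp add: d_def)
    qed
    have contg [continuous_intros]: "continuous_on A (\<lambda>v. g (cos (2 * pi * v)))" for A
      unfolding c by (intro continuous_intros)
    have "integral {0..1} (\<lambda>v. D v * g (cos (2 * pi * v))) = integral {0..1} (\<lambda>v. \<Sum>i\<le>N. c i * (D v * cos (2 * pi * v) ^ i))"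
      by (simp add: c sum_distrib_left mult_ac)
    also have "\<dots> = (\<Sum>i\<le>N. integral {0..1} (\<lambda>v. c i * (D v * cos (2 * pi * v) ^ i)))"
      by (rule integral_sum) (auto intro!: integrable_continuous_interval continuous_intros)
    also have "\<dots> = 0"
      using pow[of _ 0] by (intro sum.neutral) auto
    finally have g0: "integral {0..1} (\<lambda>v. D v * g (cos (2 * pi * v))) = 0" .
    have "integral {0..1} (\<lambda>v. D v * D v) = integral {0..1} (\<lambda>v. D v * (D v - g (cos (2 * pi * v))))"
      using g0 by (simp add: right_diff_distrib, subst integral_diff)
        (auto intro!: integrable_continuous_interval continuous_intros)
    also have "\<dots> \<le> integral {0..1} (\<lambda>v. e * \<bar>D v\<bar>)"
    proof (rule integral_le)
      fix v :: real assume v: "v \<in> {0..1}"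
      have "\<bar>D v - g (cos (2 * pi * v))\<bar> \<le> e"
        using g(2)[of "cos (2 * pi * v)"] d_cos[OF v] by (simp add: less_imp_le)
      then have "\<bar>D v\<bar> * \<bar>D v - g (cos (2 * pi * v))\<bar> \<le> \<bar>D v\<bar> * e"
        by (intro mult_left_mono) auto
      then show "D v * (D v - g (cos (2 * pi * v))) \<le> e * \<bar>D v\<bar>"
        using abs_ge_self[of "D v * (D v - g (cos (2 * pi * v)))"] by (simp add: abs_mult mult.commute)
    qed (auto intro!: integrable_continuous_interval continuous_intros)
    finally show ?thesis by simp
  qed
  let ?K = "integral {0..1} (\<lambda>v. \<bar>D v\<bar>)"
  have K: "?K \<ge> 0" by (intro integral_nonneg integrable_continuous_interval continuous_intros) auto
  have "integral {0..1} (\<lambda>v. D v * D v) \<le> 0"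
  proof (rule field_le_epsilon)
    fix e :: real assume "e > 0"
    \<comment> \<open>The summand 1 keeps the tolerance well defined when the integral of |D|
      vanishes.\<close>
    have "integral {0..1} (\<lambda>v. D v * D v) \<le> e / (?K + 1) * ?K"
      using approx[of "e / (?K + 1)"] \<open>e > 0\<close> K by simp
    also have "\<dots> \<le> e" using K \<open>e > 0\<close> by (simp add: field_simps)
    finally show "integral {0..1} (\<lambda>v. D v * D v) \<le> 0 + e" by simp
  qed
  moreover have "integral {0..1} (\<lambda>v. D v * D v) \<ge> 0"
    by (intro integral_nonneg integrable_continuous_interval continuous_intros) auto
  ultimately have "integral {0..1} (\<lambda>v. D v * D v) = 0" by simp
  then have "\<forall>v\<in>{0..1}. D v * D v = 0"
    by (subst (asm) integral_eq_0_iff) (auto intro!: continuous_intros)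
  then show ?thesis by simp
qed

lemma gaussian_fourier:
  fixes x k :: real
  assumes "x > 0"
  shows "integrable lborel (\<lambda>v. exp (- pi * x * v\<^sup>2) * cos (2 * pi * k * v))"
    and "(LINT v|lborel. exp (- pi * x * v\<^sup>2) * cos (2 * pi * k * v)) = exp (- pi * k\<^sup>2 / x) / sqrt x"
proof -
  \<comment> \<open>Substituting w = c v in the characteristic function of the normal law: c^2 / 2 =
    pi x produces the required Gaussian, and t c = 2 pi k the required frequency.\<close>
  define c where "c = sqrt (2 * pi * x)"
  have c: "c > 0" "c\<^sup>2 = 2 * pi * x" using assms by (auto simp: c_def)
  define t where "t = 2 * pi * k / c"
  have int: "integrable lborel (\<lambda>w. std_normal_density w * cos (t * w))"
  proof (rule Bochner_Integration.integrable_bound[OF integrable_normal_density[of 1 0]])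
    show "AE w in lborel. norm (std_normal_density w * cos (t * w)) \<le> norm (std_normal_density w)"
      by (auto simp: abs_mult intro!: mult_left_le)
  qed auto
  have intc: "integrable std_normal_distribution (\<lambda>w. iexp (t * w))"
    by (rule prob_space.integrable_iexp) (auto intro: prob_space_normal_density)
  have "exp (- (t\<^sup>2) / 2) = Re (char std_normal_distribution t)"
    by (simp add: char_std_normal_distribution)
  also have "\<dots> = (LINT w|std_normal_distribution. Re (iexp (t * w)))"
    unfolding char_def using intc by simp
  also have "\<dots> = (LINT w|lborel. std_normal_density w * cos (t * w))"
    by (subst integral_density) (auto simp: Re_exp)
  also have "\<dots> = \<bar>c\<bar> *\<^sub>R (LINT v|lborel. std_normal_density (0 + c * v) * cos (t * (0 + c * v)))"
    using c by (intro lborel_integral_real_affine) auto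
  also have "(\<lambda>v. std_normal_density (0 + c * v) * cos (t * (0 + c * v))) =
      (\<lambda>v. 1 / sqrt (2 * pi) * (exp (- pi * x * v\<^sup>2) * cos (2 * pi * k * v)))"
    using c by (auto simp: std_normal_density_def t_def power_mult_distrib mult.assoc)
  finally have eq: "exp (- (t\<^sup>2) / 2) = c / sqrt (2 * pi) * (LINT v|lborel. exp (- pi * x * v\<^sup>2) * cos (2 * pi * k * v))"
    using c by simp
  have "c / sqrt (2 * pi) = sqrt x" using assms by (simp add: c_def real_sqrt_mult)
  moreover have "- (t\<^sup>2) / 2 = - pi * k\<^sup>2 / x"
    using c assms by (simp add: t_def power_divide power_mult_distrib power2_eq_square field_simps)
  ultimately have e: "exp (- pi * k\<^sup>2 / x) = sqrt x * (LINT v|lborel. exp (- pi * x * v\<^sup>2) * cos (2 * pi * k * v))"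
    using eq by (simp only:)
  show "(LINT v|lborel. exp (- pi * x * v\<^sup>2) * cos (2 * pi * k * v)) = exp (- pi * k\<^sup>2 / x) / sqrt x"
    unfolding e using assms by simp
  have "integrable lborel (\<lambda>v. sqrt (2 * pi) * (std_normal_density (0 + c * v) * cos (t * (0 + c * v))))"
    by (intro integrable_mult_right) (use lborel_integrable_real_affine[OF int, of c 0] c in simp)
  also have "(\<lambda>v. sqrt (2 * pi) * (std_normal_density (0 + c * v) * cos (t * (0 + c * v)))) =
      (\<lambda>v. exp (- pi * x * v\<^sup>2) * cos (2 * pi * k * v))"
    using c by (auto simp: std_normal_density_def t_def power_mult_distrib mult.assoc)
  finally show "integrable lborel (\<lambda>v. exp (- pi * x * v\<^sup>2) * cos (2 * pi * k * v))" .
qed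

lemma has_sum_integral:
  fixes f :: "int \<Rightarrow> real \<Rightarrow> real"
  assumes "\<And>m. continuous_on {0..1} (f m)" "\<And>m v. v \<in> {0..1} \<Longrightarrow> \<bar>f m v\<bar> \<le> M m" "M summable_on UNIV"
  shows "((\<lambda>m. integral {0..1} (f m)) has_sum integral {0..1} (\<lambda>v. \<Sum>\<^sub>\<infinity>m. f m v)) UNIV"
proof -
  have ul: "uniform_limit {0..1} (\<lambda>S v. \<Sum>m\<in>S. f m v) (\<lambda>v. \<Sum>\<^sub>\<infinity>m. f m v) (finite_subsets_at_top UNIV)"
    by (rule Weierstrass_m_test_general[OF _ assms(3)]) (use assms(2) in auto)
  obtain I J where I: "\<And>S. ((\<lambda>v. \<Sum>m\<in>S. f m v) has_integral I S) {0..1}"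
    and J: "((\<lambda>v. \<Sum>\<^sub>\<infinity>m. f m v) has_integral J) {0..1}" "(I \<longlongrightarrow> J) (finite_subsets_at_top UNIV)"
    by (rule uniform_limit_integral[OF ul]) (auto intro!: continuous_intros assms(1))
  have "eventually (\<lambda>S. I S = (\<Sum>m\<in>S. integral {0..1} (f m))) (finite_subsets_at_top UNIV)"
  proof (rule eventually_finite_subsets_at_top_weakI)
    fix S :: "int set" assume "finite S"
    then have "((\<lambda>v. \<Sum>m\<in>S. f m v) has_integral (\<Sum>m\<in>S. integral {0..1} (f m))) {0..1}"
      by (intro has_integral_sum integrable_integral integrable_continuous_interval assms(1))
    then show "I S = (\<Sum>m\<in>S. integral {0..1} (f m))"
      using I has_integral_unique by blast
  qed
  with J show ?thesis
    unfolding has_sum_def by (auto intro: Lim_transform_eventually simp: integral_unique)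
qed

lemma summable_gaussian_int:
  assumes "(x::real) > 0"
  shows "(\<lambda>m::int. exp (- x * of_int (m\<^sup>2))) summable_on UNIV"
    and "((\<lambda>m::int. exp (- x * of_int (m\<^sup>2))) has_sum (1 + 2 * (\<Sum>k. exp (- x * (real (Suc k))\<^sup>2)))) UNIV"
proof -
  let ?r = "exp (- x)"
  have pow: "?r ^ n = exp (- x * real n)" for n by (simp add: mult.commute flip: exp_of_nat_mult)
  have sq: "n \<le> n\<^sup>2" for n :: nat by (simp add: power2_eq_square)
  have "summable (\<lambda>k. ?r ^ k)" using assms by (intro summable_geometric) auto
  then have "summable (\<lambda>k. ?r ^ (Suc k)\<^sup>2)"
    by (rule summable_comparison_test'[where N = 0])
       (use assms sq[of "Suc _"] in \<open>auto intro!: power_decreasing simp: Suc_le_eq less_imp_le\<close>)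
  from has_sum_int_squares[OF summable_sums[OF this]]
  have "((\<lambda>m::int. ?r ^ nat (m\<^sup>2)) has_sum (2 * (\<Sum>k. ?r ^ (Suc k)\<^sup>2))) (-{0})" by simp
  moreover have "((\<lambda>m::int. ?r ^ nat (m\<^sup>2)) has_sum 1) {0}" by (rule has_sum_finiteI) auto
  ultimately have "((\<lambda>m::int. ?r ^ nat (m\<^sup>2)) has_sum (1 + 2 * (\<Sum>k. ?r ^ (Suc k)\<^sup>2))) ({0} \<union> -{0})"
    by (intro has_sum_Un_disjoint) auto
  then show S: "((\<lambda>m::int. exp (- x * of_int (m\<^sup>2))) has_sum (1 + 2 * (\<Sum>k. exp (- x * (real (Suc k))\<^sup>2)))) UNIV"
    unfolding pow by simp
  then show "(\<lambda>m::int. exp (- x * of_int (m\<^sup>2))) summable_on UNIV"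
    by (rule has_sum_imp_summable)
qed

lemma integral_int_intervals:
  fixes f :: "real \<Rightarrow> real"
  assumes "continuous_on UNIV f"
  shows "(\<Sum>m\<in>{- int N..<int N}. integral {of_int m..of_int m + 1} f) = integral {- real N..real N} f"
proof (induction N)
  case (Suc N)
  have int: "f integrable_on {a..b}" for a b
    by (rule integrable_continuous_interval) (rule continuous_on_subset[OF assms], simp)
  have "{- int (Suc N)..<int (Suc N)} = insert (- int N - 1) (insert (int N) {- int N..<int N})" by auto
  then have "(\<Sum>m\<in>{- int (Suc N)..<int (Suc N)}. integral {of_int m..of_int m + 1} f) =
      integral {- real N - 1..- real N} f + (integral {real N..real N + 1} f + integral {- real N..real N} f)"
    using Suc.IH by simp
  also have "integral {real N..real N + 1} f + integral {- real N..real N} f = integral {- real N..real N + 1} f"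
    using Henstock_Kurzweil_Integration.integral_combine[OF _ _ int, of "- real N" "real N" "real N + 1"] by simp
  also have "integral {- real N - 1..- real N} f + \<dots> = integral {- real N - 1..real N + 1} f"
    using Henstock_Kurzweil_Integration.integral_combine[OF _ _ int, of "- real N - 1" "- real N" "real N + 1"] by simp
  also have "- real N - 1 = - real (Suc N)" by simp
  also have "real N + 1 = real (Suc N)" by simp
  finally show ?case .
qed simp

lemma integral_intervals_tendsto:
  fixes f :: "real \<Rightarrow> real"
  assumes "integrable lborel f"
  shows "(\<lambda>N. integral {- real N..real N} f) \<longlonglongrightarrow> (LINT v|lborel. f v)"
proof -
  have "(\<lambda>N. LINT v|lborel. indicator {- real N..real N} v *\<^sub>R f v) \<longlonglongrightarrow> (LINT v|lborel. f v)"
  proof (rule integral_dominated_convergence[where w = "\<lambda>v. norm (f v)"])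
    show "AE v in lborel. (\<lambda>N. indicator {- real N..real N} v *\<^sub>R f v) \<longlonglongrightarrow> f v"
    proof (rule AE_I2)
      fix v :: real
      have "eventually (\<lambda>N. indicator {- real N..real N} v *\<^sub>R f v = f v) sequentially"
        using eventually_ge_at_top[of "nat \<lceil>\<bar>v\<bar>\<rceil>"]
        by eventually_elim (auto simp: indicator_def nat_le_iff ceiling_le_iff abs_le_iff)
      then show "(\<lambda>N. indicator {- real N..real N} v *\<^sub>R f v) \<longlonglongrightarrow> f v"
        by (rule tendsto_eventually)
    qed
  qed (use assms in \<open>auto simp: indicator_def\<close>)
  moreover have "(LINT v|lborel. indicator {- real N..real N} v *\<^sub>R f v) = integral {- real N..real N} f" for N
  proof -
    have "set_integrable lborel {- real N..real N} f"
      using assms integrable_mult_indicator[of "{- real N..real N}" lborel f]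
      by (simp add: set_integrable_def)
    then show ?thesis
      using set_borel_integral_eq_integral(2)[of "{- real N..real N}" f] by (simp only: set_lebesgue_integral_def)
  qed
  ultimately show ?thesis by simp
qed

text \<open>Poisson summation for the Gaussian. G is its periodisation and H / sqrt x is the
  candidate Fourier series of G; both are even, continuous and of period 1 with equal cosine
  coefficients, hence they agree at 0.\<close>

lemma theta_functional_equation:
  fixes x :: real
  assumes x: "x > 0"
  shows "1 + 2 * (\<Sum>k. exp (- pi * x * (real (Suc k))\<^sup>2)) =
    (1 + 2 * (\<Sum>k. exp (- pi * (1 / x) * (real (Suc k))\<^sup>2))) / sqrt x"
proof -
  define g where "g = (\<lambda>v::real. exp (- pi * x * v\<^sup>2))"
  define c where "c = (\<lambda>k::int. exp (- pi * (1 / x) * of_int (k\<^sup>2)))"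
  define G where "G = (\<lambda>v. \<Sum>\<^sub>\<infinity>m::int. g (v + of_int m))"
  define H where "H = (\<lambda>v. \<Sum>\<^sub>\<infinity>k::int. c k * cos (2 * pi * of_int k * v))"
  have g_bound: "\<bar>g (v + of_int m)\<bar> \<le> exp (pi * x * V\<^sup>2) * exp (- (pi * x / 2) * of_int (m\<^sup>2))"
    if "\<bar>v\<bar> \<le> V" for v V and m :: int
  proof -
    have "v\<^sup>2 \<le> V\<^sup>2" using that by (metis abs_ge_zero power2_abs power_mono)
    \<comment> \<open>Half of this square is (v + m)^2 + v^2 - m^2 / 2, so the shifted Gaussian is
      dominated by one in m alone, uniformly for bounded v.\<close>
    moreover have "0 \<le> (2 * v + of_int m)\<^sup>2" by simp
    ultimately have "- (v + of_int m)\<^sup>2 \<le> V\<^sup>2 - of_int (m\<^sup>2) / 2"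
      by (simp add: power2_eq_square algebra_simps)
    then have "pi * x * (- (v + of_int m)\<^sup>2) \<le> pi * x * (V\<^sup>2 - of_int (m\<^sup>2) / 2)"
      using x by (intro mult_left_mono) auto
    then show ?thesis by (simp add: g_def algebra_simps flip: exp_add)
  qed
  have M_sum: "(\<lambda>m::int. exp (pi * x * V\<^sup>2) * exp (- (pi * x / 2) * of_int (m\<^sup>2))) summable_on UNIV" for V
    using x by (intro summable_on_cmult_right summable_gaussian_int) auto
  have c_pos: "c k > 0" for k by (simp add: c_def)
  have c_sum: "c summable_on UNIV"
    unfolding c_def using x summable_gaussian_int(1)[of "pi * (1 / x)"] by simp
  have c_bound: "\<bar>c k * cos t\<bar> \<le> c k" for k t
    using c_pos[of k] by (simp add: abs_mult mult_left_le)
  have contG: "continuous_on UNIV G"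
  proof -
    have "continuous_on {-V<..<V} G" for V
    proof (rule uniform_limit_theorem)
      show "uniform_limit {-V<..<V} (\<lambda>S v. \<Sum>m\<in>S. g (v + of_int m)) G (finite_subsets_at_top UNIV)"
        unfolding G_def
        by (rule Weierstrass_m_test_general[OF _ M_sum[of V]]) (use g_bound[of _ V] in auto)
      show "\<forall>\<^sub>F S in finite_subsets_at_top UNIV. continuous_on {-V<..<V} (\<lambda>v. \<Sum>m\<in>S. g (v + of_int m))"
        unfolding g_def by (intro always_eventually allI continuous_intros)
    qed auto
    then have "continuous_on (\<Union>V. {-V<..<V}) G"
      by (intro continuous_on_open_UN) auto
    also have "(\<Union>V. {-V<..<V}) = (UNIV :: real set)"
    proof -
      have "v \<in> {-(\<bar>v\<bar> + 1)<..<\<bar>v\<bar> + 1}" for v :: real by auto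
      then show ?thesis by blast
    qed
    finally show ?thesis .
  qed
  have contH: "continuous_on UNIV H"
  proof (rule uniform_limit_theorem)
    show "uniform_limit UNIV (\<lambda>S v. \<Sum>k\<in>S. c k * cos (2 * pi * of_int k * v)) H (finite_subsets_at_top UNIV)"
      unfolding H_def by (rule Weierstrass_m_test_general[OF _ c_sum]) (use c_bound in auto)
    show "\<forall>\<^sub>F S in finite_subsets_at_top UNIV. continuous_on UNIV (\<lambda>v. \<Sum>k\<in>S. c k * cos (2 * pi * of_int k * v))"
      by (intro always_eventually allI continuous_intros)
  qed auto
  have G_per: "G (v + 1) = G v" for v
  proof -
    have "bij (\<lambda>m::int. m + 1)" by (rule bij_betwI[where g = "\<lambda>m. m - 1"]) auto
    from infsum_reindex_bij_betw[OF this, of "\<lambda>m. g (v + of_int m)"] show ?thesis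
      by (simp add: G_def add_ac)
  qed
  have G_even: "G (- v) = G v" for v
  proof -
    have "bij (\<lambda>m::int. - m)" by (rule bij_betwI[where g = "\<lambda>m. - m"]) auto
    moreover have "g (- v + of_int (- m)) = g (v + of_int m)" for m :: int
      by (simp add: g_def power2_eq_square algebra_simps)
    ultimately show ?thesis
      unfolding G_def using infsum_reindex_bij_betw[of uminus UNIV UNIV "\<lambda>m. g (- v + of_int m)"] by simp
  qed
  have H_per: "H (v + 1) = H v" for v
  proof -
    have "cos (2 * pi * of_int k * (v + 1)) = cos (2 * pi * of_int k * v)" for k :: int
      using cos_int_2pin[of k] sin_int_2pin[of k] by (simp add: distrib_left cos_add mult_ac)
    then show ?thesis by (simp add: H_def)
  qed
  have H_even: "H (- v) = H v" for v by (simp add: H_def)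
  have G_int: "integral {0..1} (\<lambda>v. G v * cos (2 * pi * real l * v)) = exp (- pi * (real l)\<^sup>2 / x) / sqrt x" for l
  proof -
    let ?f = "\<lambda>v. g v * cos (2 * pi * real l * v)"
    let ?F = "\<lambda>(m::int) v. g (v + of_int m) * cos (2 * pi * real l * v)"
    have F_bound: "\<bar>?F m v\<bar> \<le> exp (pi * x * 1\<^sup>2) * exp (- (pi * x / 2) * of_int (m\<^sup>2))" if "v \<in> {0..1}" for m v
    proof -
      have "\<bar>?F m v\<bar> \<le> \<bar>g (v + of_int m)\<bar>" by (simp add: abs_mult mult_left_le)
      also note g_bound[of v 1 m]
      finally show ?thesis using that by simp
    qed
    have cont: "continuous_on A ?f" for A unfolding g_def by (intro continuous_intros)
    have "((\<lambda>m. integral {0..1} (?F m)) has_sum integral {0..1} (\<lambda>v. \<Sum>\<^sub>\<infinity>m. ?F m v)) UNIV"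
      by (rule has_sum_integral[OF _ F_bound M_sum]) (auto simp: g_def intro!: continuous_intros)
    moreover have "(\<Sum>\<^sub>\<infinity>m. ?F m v) = G v * cos (2 * pi * real l * v)" for v
      unfolding G_def by (rule infsum_cmult_left')
    \<comment> \<open>The cosine has integer periods, so the translates on [0, 1] are pieces of one
      integral over the line.\<close>
    moreover have "integral {0..1} (?F m) = integral {of_int m..of_int m + 1} ?f" for m
    proof -
      have "?F m = ?f \<circ> ((+) (of_int m))"
        using cos_int_2pin[of "m * int l"] sin_int_2pin[of "m * int l"]
        by (auto simp: fun_eq_iff distrib_left cos_add add.commute mult_ac)
      then show ?thesis using integral_shift_Icc_real[of 0 1 ?f "of_int m"] by (simp add: add.commute)
    qed
    ultimately have "((\<lambda>m. integral {of_int m..of_int m + 1} ?f) has_sum integral {0..1} (\<lambda>v. G v * cos (2 * pi * real l * v))) UNIV"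
      by simp
    then have "((\<lambda>S. \<Sum>m\<in>S. integral {of_int m..of_int m + 1} ?f) \<longlongrightarrow> integral {0..1} (\<lambda>v. G v * cos (2 * pi * real l * v))) (finite_subsets_at_top UNIV)"
      by (simp add: has_sum_def)
    \<comment> \<open>The unconditional sum is taken along symmetric intervals, whose partial sums
      are integrals over [-N, N].\<close>
    moreover have "filterlim (\<lambda>N. {- int N..<int N}) (finite_subsets_at_top UNIV) sequentially"
      unfolding filterlim_finite_subsets_at_top
    proof safe
      fix X :: "int set" assume "finite X"
      then obtain b where b: "\<And>m. m \<in> X \<Longrightarrow> \<bar>m\<bar> \<le> b"
        by (metis finite_imageI finite_nat_set_iff_bounded_le Max_ge image_eqI)
      show "\<forall>\<^sub>F N in sequentially. finite {- int N..<int N} \<and> X \<subseteq> {- int N..<int N} \<and> {- int N..<int N} \<subseteq> UNIV"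
        using eventually_gt_at_top[of "nat b"]
        by eventually_elim (use b in \<open>auto simp: abs_le_iff, fastforce+\<close>)
    qed
    ultimately have "(\<lambda>N. \<Sum>m\<in>{- int N..<int N}. integral {of_int m..of_int m + 1} ?f) \<longlonglongrightarrow> integral {0..1} (\<lambda>v. G v * cos (2 * pi * real l * v))"
      by (rule filterlim_compose)
    then have "(\<lambda>N. integral {- real N..real N} ?f) \<longlonglongrightarrow> integral {0..1} (\<lambda>v. G v * cos (2 * pi * real l * v))"
      unfolding integral_int_intervals[OF cont] .
    moreover have "(\<lambda>N. integral {- real N..real N} ?f) \<longlonglongrightarrow> exp (- pi * (real l)\<^sup>2 / x) / sqrt x"
      using integral_intervals_tendsto[OF gaussian_fourier(1)[OF x, of "real l"]] gaussian_fourier(2)[OF x, of "real l"]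
      unfolding g_def by simp
    ultimately show ?thesis by (rule LIMSEQ_unique)
  qed
  have cos_int: "integral {0..1} (\<lambda>v. cos (2 * pi * of_int k * v)) = (if k = 0 then 1 else 0)" for k :: int
  proof (cases "k = 0")
    case False
    have "((\<lambda>v. cos (2 * pi * of_int k * v)) has_integral
        (sin (2 * pi * of_int k * 1) / (2 * pi * of_int k) - sin (2 * pi * of_int k * 0) / (2 * pi * of_int k))) {0..1}"
      by (rule fundamental_theorem_of_calculus)
         (use False in \<open>auto intro!: derivative_eq_intros simp flip: has_real_derivative_iff_has_vector_derivative\<close>)
    then show ?thesis using False sin_int_2pin[of k] by (simp add: integral_unique)
  qed auto
  have H_int: "integral {0..1} (\<lambda>v. H v * cos (2 * pi * real l * v)) = exp (- pi * (real l)\<^sup>2 / x)" for l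
  proof -
    let ?F = "\<lambda>k v. c k * cos (2 * pi * of_int k * v) * cos (2 * pi * real l * v)"
    have "((\<lambda>k. integral {0..1} (?F k)) has_sum integral {0..1} (\<lambda>v. \<Sum>\<^sub>\<infinity>k. ?F k v)) UNIV"
    proof (rule has_sum_integral[OF _ _ c_sum])
      show "\<bar>?F k v\<bar> \<le> c k" for k v
        using c_bound[of k "2 * pi * of_int k * v"] by (subst abs_mult) (metis abs_cos_le_one abs_ge_zero mult_left_le order_trans)
    qed (auto intro!: continuous_intros)
    moreover have "(\<Sum>\<^sub>\<infinity>k. ?F k v) = H v * cos (2 * pi * real l * v)" for v
      unfolding H_def by (rule infsum_cmult_left')
    \<comment> \<open>The two indicators stay separate because they coincide for l = 0: then one
      index contributes twice one half, otherwise l and -l contribute one half each.\<close>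
    moreover have "integral {0..1} (?F k) = c k / 2 * ((if k = int l then 1 else 0) + (if k = - int l then 1 else 0))" for k
    proof -
      have "?F k v = c k / 2 * (cos (2 * pi * of_int (k - int l) * v) + cos (2 * pi * of_int (k + int l) * v))" for v
      proof -
        have "2 * (cos (2 * pi * of_int k * v) * cos (2 * pi * real l * v)) =
            cos (2 * pi * of_int (k - int l) * v) + cos (2 * pi * of_int (k + int l) * v)"
          using cos_times_cos[of "2 * pi * of_int k * v" "2 * pi * real l * v"] by (simp add: algebra_simps)
        from this[symmetric] show ?thesis by simp
      qed
      then have "integral {0..1} (?F k) = c k / 2 * (integral {0..1} (\<lambda>v. cos (2 * pi * of_int (k - int l) * v)) + integral {0..1} (\<lambda>v. cos (2 * pi * of_int (k + int l) * v)))"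
        by (simp only: integral_mult_right, subst integral_add)
           (auto intro!: integrable_continuous_interval continuous_intros)
      then show ?thesis by (simp only: cos_int) auto
    qed
    ultimately have 1: "((\<lambda>k. c k / 2 * ((if k = int l then 1 else 0) + (if k = - int l then 1 else 0))) has_sum integral {0..1} (\<lambda>v. H v * cos (2 * pi * real l * v))) UNIV"
      by simp
    have "((\<lambda>k. c k / 2 * ((if k = int l then 1 else 0) + (if k = - int l then 1 else 0))) has_sum c (int l)) {int l, - int l}"
    proof (rule has_sum_finiteI)
      show "c (int l) = (\<Sum>k\<in>{int l, - int l}. c k / 2 * ((if k = int l then 1 else 0) + (if k = - int l then 1 else 0)))"
      proof (cases "l = 0")
        case False
        then have "int l \<noteq> - int l" by simp
        then show ?thesis by (simp add: c_def)
      qed simp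
    qed simp
    then have "((\<lambda>k. c k / 2 * ((if k = int l then 1 else 0) + (if k = - int l then 1 else 0))) has_sum c (int l)) UNIV"
      by (rule has_sum_cong_neutral[THEN iffD1, rotated -1]) auto
    with 1 have "integral {0..1} (\<lambda>v. H v * cos (2 * pi * real l * v)) = c (int l)"
      using has_sum_unique by blast
    then show ?thesis by (simp add: c_def)
  qed
  have "(\<lambda>v. G v - H v / sqrt x) 0 = 0"
  proof (rule even_periodic_eq_0)
    show "continuous_on UNIV (\<lambda>v. G v - H v / sqrt x)" using x contG contH by (intro continuous_intros) auto
    fix l :: nat
    have "integral {0..1} (\<lambda>v. (G v - H v / sqrt x) * cos (2 * pi * real l * v)) =
        integral {0..1} (\<lambda>v. G v * cos (2 * pi * real l * v) - H v * cos (2 * pi * real l * v) / sqrt x)"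
      by (simp add: left_diff_distrib)
    also have "\<dots> = integral {0..1} (\<lambda>v. G v * cos (2 * pi * real l * v)) - integral {0..1} (\<lambda>v. H v * cos (2 * pi * real l * v)) / sqrt x"
      by (subst integral_diff) (auto intro!: integrable_continuous_interval continuous_intros
        continuous_on_subset[OF contG] continuous_on_subset[OF contH] simp: x less_imp_neq[symmetric])
    finally show "integral {0..1} (\<lambda>v. (G v - H v / sqrt x) * cos (2 * pi * real l * v)) = 0"
      by (simp add: G_int H_int)
  qed (simp_all add: G_per G_even H_per H_even)
  then have "G 0 = H 0 / sqrt x" by simp
  moreover have "G 0 = 1 + 2 * (\<Sum>k. exp (- (pi * x) * (real (Suc k))\<^sup>2))"
    using infsumI[OF summable_gaussian_int(2)[of "pi * x"]] x by (simp add: G_def g_def)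
  moreover have "H 0 = 1 + 2 * (\<Sum>k. exp (- (pi * (1 / x)) * (real (Suc k))\<^sup>2))"
    using infsumI[OF summable_gaussian_int(2)[of "pi * (1 / x)"]] x by (simp add: H_def c_def)
  ultimately show ?thesis by simp
qed

section \<open>The theta kernel and its moments\<close>

text \<open>The parameter exp(2u) turns the exchange of x and 1/x into u and -u, and d/du becomes 2
  t d/dt on functions of t.\<close>

definition thetat :: "nat \<Rightarrow> real \<Rightarrow> real" where
  "thetat n u = pi * (real (Suc n))\<^sup>2 * exp (2 * u)"

text \<open>These sums form a class closed under d/du, with \<open>theta_deriv\<close> as the action
  on the polynomial. Bounds for arbitrary P therefore cover the theta series, the kernel and all
  derivatives.\<close>

definition theta_sum :: "real poly \<Rightarrow> real \<Rightarrow> real" where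
  "theta_sum P u = (\<Sum>n. poly P (thetat n u) * exp (- thetat n u))"

definition theta_deriv :: "real poly \<Rightarrow> real poly" where
  "theta_deriv P = [:0, 2:] * (pderiv P - P)"

lemma thetat_pos: "thetat n u > 0"
  by (simp add: thetat_def)

lemma power_exp_minus_le_fact:
  fixes t :: real
  assumes "t \<ge> 0"
  shows "t ^ k * exp (- t) \<le> fact k"
proof -
  have "t ^ k / fact k = (\<Sum>n\<in>{k}. t ^ n / fact n)" by simp
  also have "\<dots> \<le> (\<Sum>n. t ^ n / fact n)"
    by (rule sum_le_suminf)
       (use assms summable_exp[of t] in \<open>auto simp: divide_inverse mult.commute\<close>)
  also have "\<dots> = exp t" by (simp add: exp_def divide_inverse mult.commute)
  finally have "t ^ k \<le> fact k * exp t" by (simp add: field_simps)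
  then show ?thesis by (simp add: exp_minus field_simps)
qed

lemma poly_exp_bounded:
  fixes P :: "real poly"
  obtains K where "K \<ge> 0" "\<And>t. t > 0 \<Longrightarrow> t ^ j * (\<bar>poly P t\<bar> * exp (- t)) \<le> K"
proof -
  have "\<exists>K\<ge>0. \<forall>t>0. t ^ j * (\<bar>poly P t\<bar> * exp (- t)) \<le> K"
  proof (induction P arbitrary: j)
    case (pCons a P)
    then obtain K where K: "K \<ge> 0" "\<And>t. t > 0 \<Longrightarrow> t ^ Suc j * (\<bar>poly P t\<bar> * exp (- t)) \<le> K" by metis
    have "t ^ j * (\<bar>poly (pCons a P) t\<bar> * exp (- t)) \<le> \<bar>a\<bar> * fact j + K" if t: "t > 0" for t
    proof -
      have "t ^ j * (\<bar>poly (pCons a P) t\<bar> * exp (- t)) \<le> t ^ j * ((\<bar>a\<bar> + t * \<bar>poly P t\<bar>) * exp (- t))"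
        using t abs_triangle_ineq[of a "t * poly P t"]
        by (intro mult_left_mono mult_right_mono) (auto simp: abs_mult)
      also have "\<dots> = \<bar>a\<bar> * (t ^ j * exp (- t)) + t ^ Suc j * (\<bar>poly P t\<bar> * exp (- t))"
        by (simp add: algebra_simps)
      also have "\<dots> \<le> \<bar>a\<bar> * fact j + K"
        using t by (intro add_mono mult_left_mono power_exp_minus_le_fact K) auto
      finally show ?thesis .
    qed
    then show ?case using K by (intro exI[of _ "\<bar>a\<bar> * fact j + K"]) auto
  qed (auto intro: exI[of _ 0])
  then show ?thesis using that by blast
qed

lemma summable_inverse_squares_Suc: "summable (\<lambda>n. 1 / (real (Suc n))\<^sup>2)"
  using inverse_squares_sums sums_summable by (simp add: add.commute) 

text \<open>Multiplying by t^(j+1) costs only a constant. In the lower bound for t^(j+1) one factor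
  n^2 is kept, for summability; the other factors pi n^2 exceed 1 and are dropped. The exponential
  rate in u is arbitrary.\<close>

lemma theta_term_bound:
  obtains K where "K \<ge> 0"
    "\<And>n u. \<bar>poly P (thetat n u) * exp (- thetat n u)\<bar> \<le> K * exp (- 2 * real (Suc j) * u) / (real (Suc n))\<^sup>2"
proof -
  obtain K where K: "K \<ge> 0" "\<And>t. t > 0 \<Longrightarrow> t ^ Suc j * (\<bar>poly P t\<bar> * exp (- t)) \<le> K"
    using poly_exp_bounded[of "Suc j" P] by blast
  have "\<bar>poly P (thetat n u) * exp (- thetat n u)\<bar> \<le> K * exp (- 2 * real (Suc j) * u) / (real (Suc n))\<^sup>2" for n u
  proof -
    have "\<bar>poly P (thetat n u) * exp (- thetat n u)\<bar> \<le> K / thetat n u ^ Suc j"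
      using K(2)[OF thetat_pos, of n u] thetat_pos[of n u] by (simp add: field_simps abs_mult)
    also have "thetat n u ^ Suc j \<ge> (real (Suc n))\<^sup>2 * exp (2 * u) ^ Suc j"
    proof -
      have "(real (Suc n))\<^sup>2 \<le> pi * (real (Suc n))\<^sup>2 * 1"
        using pi_gt3 by simp
      also have "\<dots> \<le> pi * (real (Suc n))\<^sup>2 * (pi * (real (Suc n))\<^sup>2) ^ j"
        using pi_gt3 by (intro mult_left_mono one_le_power mult_ge1_I) auto
      finally show ?thesis by (simp add: thetat_def power_mult_distrib)
    qed
    then have "K / thetat n u ^ Suc j \<le> K / ((real (Suc n))\<^sup>2 * exp (2 * u) ^ Suc j)"
      using K(1) thetat_pos by (intro divide_left_mono) auto
    also have "exp (2 * u) ^ Suc j = exp (2 * real (Suc j) * u)"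
      using exp_of_nat_mult[of "Suc j" "2 * u"] by (simp only: mult_ac)
    also have "K / ((real (Suc n))\<^sup>2 * exp (2 * real (Suc j) * u)) = K * exp (- 2 * real (Suc j) * u) / (real (Suc n))\<^sup>2"
    proof -
      have "- 2 * real (Suc j) * u = - (2 * real (Suc j) * u)" by (simp only: mult_minus_left)
      then show ?thesis
        by (simp only: exp_minus divide_inverse inverse_mult_distrib mult_ac)
    qed
    finally show ?thesis .
  qed
  with K(1) show ?thesis using that by blast
qed

lemma summable_theta_sum: "summable (\<lambda>n. \<bar>poly P (thetat n u) * exp (- thetat n u)\<bar>)"
proof -
  obtain K where "K \<ge> 0" and K: "\<And>n u. \<bar>poly P (thetat n u) * exp (- thetat n u)\<bar> \<le> K * exp (- 2 * real (Suc 0) * u) / (real (Suc n))\<^sup>2"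
    using theta_term_bound by blast
  have "summable (\<lambda>n. K * exp (- 2 * real (Suc 0) * u) * (1 / (real (Suc n))\<^sup>2))"
    by (intro summable_mult summable_inverse_squares_Suc)
  then show ?thesis
    by (rule summable_comparison_test'[where N = 0]) (use K[of _ u] in simp)
qed

lemma summable_theta_sum': "summable (\<lambda>n. poly P (thetat n u) * exp (- thetat n u))"
  using summable_theta_sum by (rule summable_rabs_cancel)

lemma theta_sum_bound:
  obtains K where "K \<ge> 0" "\<And>u. \<bar>theta_sum P u\<bar> \<le> K * exp (- 2 * real (Suc j) * u)"
proof -
  obtain K where K0: "K \<ge> 0" and K: "\<And>n u. \<bar>poly P (thetat n u) * exp (- thetat n u)\<bar> \<le> K * exp (- 2 * real (Suc j) * u) / (real (Suc n))\<^sup>2"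
    using theta_term_bound by blast
  let ?Z = "\<Sum>n. 1 / (real (Suc n))\<^sup>2"
  have "\<bar>theta_sum P u\<bar> \<le> K * ?Z * exp (- 2 * real (Suc j) * u)" for u
  proof -
    have "\<bar>theta_sum P u\<bar> \<le> (\<Sum>n. \<bar>poly P (thetat n u) * exp (- thetat n u)\<bar>)"
      unfolding theta_sum_def by (rule summable_rabs[OF summable_theta_sum])
    also have "\<dots> \<le> (\<Sum>n. K * exp (- 2 * real (Suc j) * u) * (1 / (real (Suc n))\<^sup>2))"
      using K by (intro suminf_le summable_theta_sum summable_mult summable_inverse_squares_Suc) simp
    also have "\<dots> = K * ?Z * exp (- 2 * real (Suc j) * u)"
      by (subst suminf_mult[OF summable_inverse_squares_Suc]) simp
    finally show ?thesis .
  qed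
  moreover have "K * ?Z \<ge> 0"
    using K0 by (intro mult_nonneg_nonneg suminf_nonneg summable_inverse_squares_Suc) auto
  ultimately show ?thesis using that by blast
qed

lemma theta_sum_add: "theta_sum (P + Q) u = theta_sum P u + theta_sum Q u"
  unfolding theta_sum_def
  by (subst suminf_add[OF summable_theta_sum' summable_theta_sum']) (simp add: algebra_simps)

lemma theta_sum_smult: "theta_sum (smult c P) u = c * theta_sum P u"
  unfolding theta_sum_def
  by (subst suminf_mult[OF summable_theta_sum', symmetric]) (simp add: algebra_simps)

lemma has_real_derivative_theta_sum:
  "(theta_sum P has_real_derivative theta_sum (theta_deriv P) u) (at u)"
proof -
  obtain K where K0: "K \<ge> 0" and K: "\<And>n u. \<bar>poly (theta_deriv P) (thetat n u) * exp (- thetat n u)\<bar> \<le> K * exp (- 2 * real (Suc 0) * u) / (real (Suc n))\<^sup>2"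
    using theta_term_bound by blast
  have "((\<lambda>u. \<Sum>n. poly P (thetat n u) * exp (- thetat n u)) has_real_derivative
      (\<Sum>n. poly (theta_deriv P) (thetat n u) * exp (- thetat n u))) (at u)"
  proof (rule has_field_derivative_series'(2)[where S = "{u - 1..u + 1}"])
    show "((\<lambda>u. poly P (thetat n u) * exp (- thetat n u)) has_real_derivative
        poly (theta_deriv P) (thetat n x) * exp (- thetat n x)) (at x within {u - 1..u + 1})" for n x
    proof -
      have d: "(thetat n has_real_derivative 2 * thetat n x) (at x within {u - 1..u + 1})"
        unfolding thetat_def by (auto intro!: derivative_eq_intros)
      show ?thesis
        by (rule derivative_eq_intros d DERIV_chain2[OF poly_DERIV d] refl)+
           (simp add: theta_deriv_def algebra_simps)
    qed
    show "uniformly_convergent_on {u - 1..u + 1} (\<lambda>n x. \<Sum>i<n. poly (theta_deriv P) (thetat i x) * exp (- thetat i x))"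
    proof (rule Weierstrass_m_test'[OF _ summable_mult[OF summable_inverse_squares_Suc]])
      fix n x assume "x \<in> {u - 1..u + 1}"
      then have "K * exp (- 2 * real (Suc 0) * x) / (real (Suc n))\<^sup>2 \<le> K * exp (- 2 * (u - 1)) / (real (Suc n))\<^sup>2"
        using K0 by (intro divide_right_mono mult_left_mono) auto
      with K[of n x] show "norm (poly (theta_deriv P) (thetat n x) * exp (- thetat n x)) \<le> K * exp (- 2 * (u - 1)) * (1 / (real (Suc n))\<^sup>2)"
        by simp
    qed
    show "u \<in> {u - 1..u + 1}" by simp
    show "summable (\<lambda>n. poly P (thetat n u) * exp (- thetat n u))" by (rule summable_theta_sum')
  qed auto
  then show ?thesis by (simp add: theta_sum_def[abs_def])
qed

text \<open>Applying d^2/du^2 - 1/4 to exp(u/2) times the full theta series gives 2 *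
  \<open>Phi\<close>. The operator kills exp(u/2), the part of the constant term, so that rapid
  decay at infinity remains.\<close>

definition Phi_poly :: "real poly" where "Phi_poly = [:0, -3, 2:]"

definition Phi :: "real \<Rightarrow> real" where
  "Phi u = 2 * exp (u / 2) * theta_sum Phi_poly u"

lemma theta_symmetry:
  "exp (u / 2) * (1 + 2 * theta_sum 1 u) = exp (- u / 2) * (1 + 2 * theta_sum 1 (- u))"
proof -
  have S: "theta_sum 1 v = (\<Sum>k. exp (- pi * exp (2 * v) * (real (Suc k))\<^sup>2))" for v
    by (simp add: theta_sum_def thetat_def mult_ac)
  have "sqrt (exp (2 * u)) = exp u"
    by (rule real_sqrt_unique) (simp_all add: power2_eq_square flip: exp_add)
  moreover have "1 / exp (2 * u) = exp (2 * (- u))" by (simp add: exp_minus divide_inverse)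
  ultimately have A: "1 + 2 * theta_sum 1 u = (1 + 2 * theta_sum 1 (- u)) / exp u"
    using theta_functional_equation[of "exp (2 * u)"] unfolding S by simp
  have "exp (u / 2) / exp u = exp (- u / 2)"
    by (simp flip: exp_diff)
  then show ?thesis unfolding A by (metis times_divide_eq_left times_divide_eq_right)
qed

text \<open>By the functional equation h is even, so h'' is even too, and \<open>Phi\<close> is half
  of h'' - h / 4.\<close>

lemma Phi_even: "Phi (- u) = Phi u"
proof -
  define h where "h = (\<lambda>u. exp (u / 2) * (1 + 2 * theta_sum 1 u))"
  define h1 where "h1 = (\<lambda>u. exp (u / 2) * (1 / 2 + theta_sum 1 u + 2 * theta_sum [:0, -2:] u))"
  define h2 where "h2 = (\<lambda>u. h u / 4 + 2 * Phi u)"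
  have d1: "theta_deriv 1 = [:0, -2:]" by (simp add: theta_deriv_def pderiv_1)
  have d2: "theta_deriv [:0, -2:] = [:0, -4, 4:]" by (simp add: theta_deriv_def pderiv_pCons)
  have h1: "(h has_real_derivative h1 u) (at u)" for u
    unfolding h_def h1_def
    by (auto intro!: derivative_eq_intros has_real_derivative_theta_sum simp: d1 algebra_simps)
  have h2: "(h1 has_real_derivative h2 u) (at u)" for u
  proof -
    have "theta_sum [:0, -2:] u + theta_sum [:0, -4, 4:] u = theta_sum (smult 2 Phi_poly) u"
      by (simp add: Phi_poly_def flip: theta_sum_add)
    then have *: "theta_sum [:0, -4, 4:] u = 2 * theta_sum Phi_poly u - theta_sum [:0, -2:] u"
      by (simp add: theta_sum_smult)
    show ?thesis
      unfolding h1_def h2_def h_def Phi_def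
      by (auto intro!: derivative_eq_intros has_real_derivative_theta_sum simp: d1 d2 * algebra_simps)
  qed
  have h_even: "h (- u) = h u" for u using theta_symmetry[of u] by (simp add: h_def)
  have h1_odd: "h1 (- u) = - h1 u" for u
  proof -
    have "((\<lambda>u. h (- u)) has_real_derivative h1 (- u) * (- 1)) (at u)"
      by (rule DERIV_chain2[OF h1]) (auto intro!: derivative_eq_intros)
    then have "(h has_real_derivative - h1 (- u)) (at u)" by (simp add: h_even)
    from DERIV_unique[OF this h1] show ?thesis by simp
  qed
  have "((\<lambda>u. h1 (- u)) has_real_derivative h2 (- u) * (- 1)) (at u)"
    by (rule DERIV_chain2[OF h2]) (auto intro!: derivative_eq_intros)
  then have "((\<lambda>u. - h1 u) has_real_derivative - h2 (- u)) (at u)" by (simp add: h1_odd)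
  from DERIV_unique[OF this DERIV_minus[OF h2]] show ?thesis by (simp add: h2_def h_even)
qed

section \<open>Log-concavity of the kernel\<close>

definition Phi_poly1 :: "real poly" where "Phi_poly1 = [:0, -6, 14, -4:]"
definition Phi_poly2 :: "real poly" where "Phi_poly2 = [:0, -12, 68, -52, 8:]"

lemma theta_deriv_Phi_poly: "theta_deriv Phi_poly = Phi_poly1" "theta_deriv Phi_poly1 = Phi_poly2"
  by (simp_all add: theta_deriv_def Phi_poly_def Phi_poly1_def Phi_poly2_def pderiv_pCons)

lemma poly_Phi:
  "poly Phi_poly t = 2 * t\<^sup>2 - 3 * t"
  "poly Phi_poly1 t = - (4 * t ^ 3) + 14 * t\<^sup>2 - 6 * t"
  "poly Phi_poly2 t = 8 * t ^ 4 - 52 * t ^ 3 + 68 * t\<^sup>2 - 12 * t"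
  by (simp_all add: Phi_poly_def Phi_poly1_def Phi_poly2_def power2_eq_square power3_eq_cube
      power4_eq_xxxx algebra_simps)

text \<open>For u \<ge> 0 the first term of the series has t \<ge> pi > 3, and all later ones have t
  \<ge> 4 * 3 = 12. These are the two thresholds; at t = 3 the polynomial \<open>Phi_poly2\<close>
  is still negative.\<close>

lemma poly_Phi_bounds:
  assumes "t \<ge> 3"
  shows "0 < poly Phi_poly t" "poly Phi_poly t \<le> 2 * t\<^sup>2" "poly Phi_poly1 t \<le> 0"
    "poly Phi_poly2 t \<le> 8 * t ^ 4"
    and "t \<ge> 12 \<Longrightarrow> 0 \<le> poly Phi_poly2 t"
proof -
  have "poly Phi_poly t = t * (2 * t - 3)"
    by (simp add: poly_Phi power2_eq_square algebra_simps)
  then show "0 < poly Phi_poly t" using assms by simp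
  show "poly Phi_poly t \<le> 2 * t\<^sup>2" using assms by (simp add: poly_Phi)
  have "poly Phi_poly1 t = - (2 * t * ((t - 3) * (2 * t - 1)))"
    by (simp add: poly_Phi power2_eq_square power3_eq_cube algebra_simps)
  then show "poly Phi_poly1 t \<le> 0" using assms by simp
  have "poly Phi_poly2 t = 8 * t ^ 4 - (52 * t\<^sup>2 * (t - 3) + 88 * t\<^sup>2 + 12 * t)"
    by (simp add: poly_Phi power2_eq_square power3_eq_cube power4_eq_xxxx algebra_simps)
  moreover have "52 * t\<^sup>2 * (t - 3) + 88 * t\<^sup>2 + 12 * t \<ge> 0" using assms by simp
  ultimately show "poly Phi_poly2 t \<le> 8 * t ^ 4" by linarith
  assume "t \<ge> 12"
  \<comment> \<open>Repeated division by t - 12, which leaves only nonnegative summands.\<close>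
  have "poly Phi_poly2 t = t * (8 * t\<^sup>2 * (t - 12) + 44 * t * (t - 12) + 596 * (t - 12) + 7140)"
    by (simp add: poly_Phi power2_eq_square power3_eq_cube power4_eq_xxxx algebra_simps)
  moreover have "8 * t\<^sup>2 * (t - 12) + 44 * t * (t - 12) + 596 * (t - 12) + 7140 \<ge> 0"
    using \<open>t \<ge> 12\<close> by (intro add_nonneg_nonneg mult_nonneg_nonneg) auto
  ultimately show "0 \<le> poly Phi_poly2 t" using \<open>t \<ge> 12\<close> by (simp only: zero_le_mult_iff) simp
qed

text \<open>The number \<open>Y\<close> bounds the terms of index at least 2 of the theta series relative to \<open>exp (- t)\<close>;
  it is small enough for the first term to decide the sign of \<open>\<Phi>'\<^sup>2 - \<Phi> \<Phi>''\<close>.\<close>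

lemma theta_tail_bound:
  fixes t :: real
  assumes "t \<ge> 3"
  defines "Y \<equiv> (\<Sum>n. (real (n + 2)) ^ 8 * exp (- ((real (n + 2))\<^sup>2 - 1) * t))"
  shows "summable (\<lambda>n. (real (n + 2)) ^ 8 * exp (- ((real (n + 2))\<^sup>2 - 1) * t))"
    and "0 \<le> Y" "Y * t ^ 3 \<le> 3 / 2" "Y \<le> 1 / 10"
proof -
  let ?f = "\<lambda>n. (real (n + 2)) ^ 8 * exp (- ((real (n + 2))\<^sup>2 - 1) * t)"
  define w where "w = exp (- 3 * t)"
  \<comment> \<open>Uses exp(1/2) \<ge> 1 + 1/2 + 1/8 = 13/8, whose sixth power exceeds 18. It leads
    to exp t \<ge> 6 t for t \<ge> 3, hence to w \<le> 1 / (6 t)^3 and w \<le> 1 / 5832.\<close>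
  have exp3: "exp (3::real) \<ge> 18"
  proof -
    have "(13/8) ^ 6 \<le> exp (1/2 :: real) ^ 6"
      using exp_lower_Taylor_quadratic[of "1/2"] by (intro power_mono) (auto simp: power2_eq_square)
    also have "\<dots> = exp 3" by (simp flip: exp_of_nat_mult)
    finally show ?thesis by (simp add: power_divide)
  qed
  have "t / 3 \<le> exp (t - 3)"
    using exp_ge_add_one_self[of "t - 3"] assms by linarith
  then have "exp 3 * (t / 3) \<le> exp t" by (simp add: exp_diff field_simps)
  moreover have "18 * (t / 3) \<le> exp 3 * (t / 3)" using exp3 assms by (intro mult_right_mono) auto
  ultimately have "6 * t \<le> exp t" by simp
  then have "(6 * t) ^ 3 \<le> exp t ^ 3" using assms by (intro power_mono) auto
  also have "exp t ^ 3 = 1 / w" by (simp add: w_def exp_minus divide_inverse flip: exp_of_nat_mult)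
  finally have w: "216 * (w * t ^ 3) \<le> 1" by (simp add: w_def power_mult_distrib field_simps)
  have w0: "w > 0" by (simp add: w_def)
  have "3 ^ 3 \<le> t ^ 3" using assms by (intro power_mono) auto
  then have "w * 27 \<le> w * t ^ 3" using w0 by simp
  with w have w26: "5832 * w \<le> 1" by simp
  \<comment> \<open>The start is 2^8 = 256, and the quotient of consecutive terms is at most (3/2)^8
    < 26. This gives a geometric majorant with ratio 26 w.\<close>
  have poly: "(real (n + 2)) ^ 8 \<le> 256 * 26 ^ n" for n
  proof (induction n)
    case (Suc n)
    have "real (Suc n + 2) \<le> 3 / 2 * real (n + 2)" by simp
    then have "real (Suc n + 2) ^ 8 \<le> (3 / 2 * real (n + 2)) ^ 8" by (intro power_mono) auto
    also have "\<dots> \<le> 26 * real (n + 2) ^ 8"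
      unfolding power_mult_distrib by (intro mult_right_mono) (auto simp: power_divide)
    also have "\<dots> \<le> 26 * (256 * 26 ^ n)" using Suc.IH by simp
    finally show ?case by simp
  qed simp
  have le: "?f n \<le> 256 * w * (26 * w) ^ n" for n
  proof -
    \<comment> \<open>With equality at n = 0, so the leading tail term is kept exactly as 256
      w.\<close>
    have "3 * real (Suc n) \<le> (real (n + 2))\<^sup>2 - 1"
      by (simp add: power2_eq_square algebra_simps)
    then have "3 * real (Suc n) * t \<le> ((real (n + 2))\<^sup>2 - 1) * t" using assms by (intro mult_right_mono) auto
    then have "exp (- ((real (n + 2))\<^sup>2 - 1) * t) \<le> exp (- (3 * real (Suc n) * t))"
      by (simp only: exp_le_cancel_iff mult_minus_left neg_le_iff_le)
    also have "\<dots> = w ^ Suc n"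
      using exp_of_nat_mult[of "Suc n" "- 3 * t"] by (simp add: w_def algebra_simps)
    finally have "?f n \<le> (256 * 26 ^ n) * w ^ Suc n" using poly[of n] by (intro mult_mono) auto
    then show ?thesis by (simp add: power_mult_distrib mult_ac)
  qed
  have geo: "summable (\<lambda>n. (26 * w) ^ n)" using w0 w26 by (intro summable_geometric) auto
  show sum: "summable ?f"
    by (rule summable_comparison_test'[OF summable_mult[OF geo], of 0 _ "256 * w"]) (use le in auto)
  show "0 \<le> Y" unfolding Y_def by (intro suminf_nonneg sum) auto
  have "Y \<le> (\<Sum>n. 256 * w * (26 * w) ^ n)"
    unfolding Y_def by (intro suminf_le sum summable_mult geo le)
  also have "\<dots> = 256 * w * (1 / (1 - 26 * w))"
    using w0 w26 by (subst suminf_mult[OF geo], subst suminf_geometric) auto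
  also have "1 / (1 - 26 * w) \<le> 260 / 256" using w0 w26 by (simp add: field_simps)
  finally have Y: "Y \<le> 260 * w" using w0 by simp
  then have "Y * t ^ 3 \<le> 260 * w * t ^ 3" using assms by (intro mult_right_mono) auto
  with w show "Y * t ^ 3 \<le> 3 / 2" by simp
  show "Y \<le> 1 / 10" using Y w26 by simp
qed

text \<open>For the first term alone the difference F1^2 - F0 F2 is 4 t^3 (4 t^2 - 12 t + 15), at
  least 60 t^3. The tails of the sums for \<open>Phi_poly\<close> and \<open>Phi_poly2\<close>
  disturb this by at most 16 t^6 (2 Y + Y^2), which is smaller since Y t^3 \<le> 3/2. The tail for
  \<open>Phi_poly1\<close> works in the right direction.\<close>

lemma theta_sum_logconcave:
  assumes "u \<ge> 0"
  shows "theta_sum Phi_poly u > 0"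
    and "theta_sum Phi_poly u * theta_sum Phi_poly2 u \<le> (theta_sum Phi_poly1 u)\<^sup>2"
proof -
  define t where "t = thetat 0 u"
  have "pi * 1 \<le> pi * exp (2 * u)" using assms by (intro mult_left_mono) auto
  moreover have "t = pi * exp (2 * u)" by (simp add: t_def thetat_def)
  ultimately have t3: "t \<ge> 3" using pi_gt3 by linarith
  define T where "T = (\<lambda>n. thetat (Suc n) u)"
  have T: "T n = (real (n + 2))\<^sup>2 * t" for n by (simp add: T_def t_def thetat_def)
  have T12: "T n \<ge> 12" for n
  proof -
    have "2\<^sup>2 \<le> (real (n + 2))\<^sup>2" by (intro power_mono) auto
    then have "4 * 3 \<le> (real (n + 2))\<^sup>2 * t" using t3 by (intro mult_mono) auto
    then show ?thesis by (simp add: T)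
  qed
  let ?R = "\<lambda>P. \<Sum>n. poly P (T n) * exp (- T n)"
  have split: "theta_sum P u = poly P t * exp (- t) + ?R P" for P
    using suminf_split_head[OF summable_theta_sum'[of P u]] by (simp add: theta_sum_def t_def T_def)
  have sm: "summable (\<lambda>n. poly P (T n) * exp (- T n))" for P
    using summable_theta_sum'[of P u] unfolding T_def by (subst summable_Suc_iff)
  let ?f = "\<lambda>n. (real (n + 2)) ^ 8 * exp (- ((real (n + 2))\<^sup>2 - 1) * t)"
  define Y where "Y = suminf ?f"
  note Y = theta_tail_bound[OF t3, folded Y_def]
  \<comment> \<open>T n is (n + 2)^2 t, so its k-th power carries (n + 2)^(2 k). As k \<le> 4, the
    eighth power in Y serves for all the polynomials.\<close>
  have R_bound: "?R P \<le> c * t ^ k * (exp (- t) * Y)"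
    if P: "\<And>n. poly P (T n) \<le> c * T n ^ k" and k: "k \<le> 4" and c: "c \<ge> 0" for P c k
  proof -
    have "poly P (T n) * exp (- T n) \<le> c * t ^ k * exp (- t) * ?f n" for n
    proof -
      have "(real (n + 2)) ^ (2 * k) \<le> (real (n + 2)) ^ 8" using k by (intro power_increasing) auto
      then have "c * (t ^ k * real (n + 2) ^ (2 * k)) \<le> c * (t ^ k * real (n + 2) ^ 8)"
        using c t3 by (intro mult_left_mono) auto
      moreover have "T n ^ k = t ^ k * real (n + 2) ^ (2 * k)" unfolding T power_mult_distrib power_mult by simp
      ultimately have "poly P (T n) * exp (- T n) \<le> c * (t ^ k * real (n + 2) ^ 8) * exp (- T n)"
        using P[of n] by (intro mult_right_mono) auto
      also have "c * (t ^ k * real (n + 2) ^ 8) * exp (- T n) = c * t ^ k * exp (- t) * ?f n"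
      proof -
        have "exp (- T n) = exp (- t) * exp (- ((real (n + 2))\<^sup>2 - 1) * t)"
          by (simp add: T algebra_simps flip: exp_add)
        then show ?thesis by (simp only: mult_ac)
      qed
      finally show ?thesis .
    qed
    then have "?R P \<le> (\<Sum>n. c * t ^ k * exp (- t) * ?f n)"
      by (intro suminf_le sm summable_mult Y(1))
    also have "\<dots> = c * t ^ k * (exp (- t) * Y)"
      unfolding Y_def by (subst suminf_mult[OF Y(1)]) simp
    finally show ?thesis .
  qed
  have T3: "T n \<ge> 3" for n using T12[of n] by simp
  have R0: "0 \<le> ?R Phi_poly" "?R Phi_poly \<le> 2 * t\<^sup>2 * (exp (- t) * Y)"
    by (rule suminf_nonneg[OF sm], use poly_Phi_bounds(1)[OF T3] in \<open>simp add: less_imp_le\<close>,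
        rule R_bound, use poly_Phi_bounds(2)[OF T3] in auto)
  have R2: "0 \<le> ?R Phi_poly2" "?R Phi_poly2 \<le> 8 * t ^ 4 * (exp (- t) * Y)"
    by (rule suminf_nonneg[OF sm], use poly_Phi_bounds(5)[OF T3 T12] in simp,
        rule R_bound, use poly_Phi_bounds(4)[OF T3] in auto)
  have R1: "?R Phi_poly1 \<le> 0"
    using suminf_le[OF _ sm[of Phi_poly1] summable_zero] poly_Phi_bounds(3)[OF T3]
    by (auto simp: mult_nonpos_nonneg)
  show "theta_sum Phi_poly u > 0"
    unfolding split using R0(1) poly_Phi_bounds(1)[OF t3] by (intro add_pos_nonneg) auto
  let ?e = "exp (- t)"
  define F0 F1 F2 where "F0 = poly Phi_poly t" and "F1 = poly Phi_poly1 t" and "F2 = poly Phi_poly2 t"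
  have F: "0 < F0" "F0 \<le> 2 * t\<^sup>2" "F1 \<le> 0" "F2 \<le> 8 * t ^ 4"
    using poly_Phi_bounds[OF t3] by (auto simp: F0_def F1_def F2_def)
  \<comment> \<open>After cancelling 4 t^3 this compares 4 (Y t^3)(2 + Y) \<le> 12.6 with
    15.\<close>
  have key: "16 * t ^ 6 * (2 * Y + Y\<^sup>2) \<le> F1\<^sup>2 - F0 * F2"
  proof -
    have "F1\<^sup>2 - F0 * F2 = 4 * t ^ 3 * (4 * t\<^sup>2 - 12 * t + 15)"
      unfolding F0_def F1_def F2_def poly_Phi by (simp add: power2_eq_square power3_eq_cube power4_eq_xxxx algebra_simps)
    moreover have "4 * t\<^sup>2 - 12 * t + 15 = 4 * t * (t - 3) + 15"
      by (simp add: power2_eq_square algebra_simps)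
    then have "15 \<le> 4 * t\<^sup>2 - 12 * t + 15" using t3 by simp
    moreover have "4 * (Y * t ^ 3) * (2 + Y) \<le> 4 * (3 / 2) * (2 + 1 / 10)"
      using Y t3 by (intro mult_mono) auto
    ultimately have "4 * t ^ 3 * (4 * (Y * t ^ 3) * (2 + Y)) \<le> F1\<^sup>2 - F0 * F2"
      using t3 by (auto intro!: mult_left_mono)
    then show ?thesis by (simp add: power2_eq_square algebra_simps eval_nat_numeral)
  qed
  have "(F0 * ?e + ?R Phi_poly) * (F2 * ?e + ?R Phi_poly2) =
      F0 * F2 * ?e\<^sup>2 + F0 * ?e * ?R Phi_poly2 + ?R Phi_poly * (F2 * ?e + ?R Phi_poly2)"
    by (simp add: power2_eq_square algebra_simps)
  also have "F0 * ?e * ?R Phi_poly2 \<le> 2 * t\<^sup>2 * ?e * (8 * t ^ 4 * (?e * Y))"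
    using F R2 by (intro mult_mono) auto
  also have "?R Phi_poly * (F2 * ?e + ?R Phi_poly2) \<le> ?R Phi_poly * (8 * t ^ 4 * ?e + 8 * t ^ 4 * (?e * Y))"
    using F R0 R2 by (intro mult_left_mono add_mono mult_right_mono) auto
  also have "\<dots> \<le> 2 * t\<^sup>2 * (?e * Y) * (8 * t ^ 4 * ?e + 8 * t ^ 4 * (?e * Y))"
    using R0 t3 Y(2) by (intro mult_right_mono add_nonneg_nonneg mult_nonneg_nonneg) auto
  also have "F0 * F2 * ?e\<^sup>2 + 2 * t\<^sup>2 * ?e * (8 * t ^ 4 * (?e * Y)) + \<dots> =
      F0 * F2 * ?e\<^sup>2 + 16 * t ^ 6 * (2 * Y + Y\<^sup>2) * ?e\<^sup>2"
    by (simp add: power2_eq_square algebra_simps eval_nat_numeral)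
  also have "\<dots> \<le> F0 * F2 * ?e\<^sup>2 + (F1\<^sup>2 - F0 * F2) * ?e\<^sup>2"
    using key by (intro add_left_mono mult_right_mono) auto
  also have "\<dots> = (- (F1 * ?e))\<^sup>2" by (simp add: power2_eq_square algebra_simps)
  \<comment> \<open>F1 and the tail are both at most 0, so adding the tail enlarges the
    square.\<close>
  also have "\<dots> \<le> (- (F1 * ?e + ?R Phi_poly1))\<^sup>2"
    using F R1 by (intro power_mono) (auto simp: mult_nonpos_nonneg)
  finally show "theta_sum Phi_poly u * theta_sum Phi_poly2 u \<le> (theta_sum Phi_poly1 u)\<^sup>2"
    unfolding split F0_def F1_def F2_def power2_minus by this simp_all
qed

lemma Phi_pos: "Phi u > 0"
proof -
  have "Phi v > 0" if "v \<ge> 0" for v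
    using theta_sum_logconcave(1)[OF that] by (simp add: Phi_def)
  from this[of "\<bar>u\<bar>"] show ?thesis using Phi_even[of u] by (cases "u \<ge> 0") auto
qed

definition Phi' :: "real \<Rightarrow> real" where
  "Phi' u = exp (u / 2) * (theta_sum Phi_poly u + 2 * theta_sum Phi_poly1 u)"

lemma has_real_derivative_Phi: "(Phi has_real_derivative Phi' u) (at u)"
  unfolding Phi_def Phi'_def
  by (auto intro!: derivative_eq_intros has_real_derivative_theta_sum simp: theta_deriv_Phi_poly algebra_simps)

text \<open>The factor exp(u/2) adds only the constant 1/2 to the logarithmic derivative; what
  remains is the logarithmic derivative of \<open>theta_sum Phi_poly\<close>.\<close>

lemma Phi_ratio_antimono:
  assumes "0 \<le> a" "a \<le> b"
  shows "Phi' b / Phi b \<le> Phi' a / Phi a"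
proof -
  let ?r = "\<lambda>u. theta_sum Phi_poly1 u / theta_sum Phi_poly u"
  have eq: "Phi' u / Phi u = 1 / 2 + ?r u" if "u \<ge> 0" for u
    using theta_sum_logconcave(1)[OF that] by (simp add: Phi_def Phi'_def field_simps)
  have "?r b \<le> ?r a"
  proof (rule DERIV_nonpos_imp_nonincreasing[OF assms(2)])
    fix u assume "a \<le> u" "u \<le> b"
    then have u: "u \<ge> 0" using assms by simp
    let ?S = "theta_sum Phi_poly u"
    have "(?r has_real_derivative (theta_sum Phi_poly2 u * ?S - theta_sum Phi_poly1 u * theta_sum Phi_poly1 u) / (?S * ?S)) (at u)"
      using theta_sum_logconcave(1)[OF u] has_real_derivative_theta_sum[of Phi_poly1 u] has_real_derivative_theta_sum[of Phi_poly u]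
      by (intro DERIV_divide) (auto simp: theta_deriv_Phi_poly)
    moreover have "(theta_sum Phi_poly2 u * ?S - theta_sum Phi_poly1 u * theta_sum Phi_poly1 u) / (?S * ?S) \<le> 0"
      using theta_sum_logconcave(2)[OF u] by (intro divide_nonpos_nonneg) (auto simp: power2_eq_square mult.commute)
    ultimately show "\<exists>y. DERIV ?r u :> y \<and> y \<le> 0" by blast
  qed
  then show ?thesis using eq assms by simp
qed

lemma continuous_on_theta_sum [continuous_intros]: "continuous_on A (theta_sum P)"
  using has_real_derivative_theta_sum DERIV_isCont continuous_at_imp_continuous_on by blast

lemma continuous_on_Phi [continuous_intros]: "continuous_on A Phi"
  using has_real_derivative_Phi DERIV_isCont continuous_at_imp_continuous_on by blast

lemma continuous_on_Phi' [continuous_intros]: "continuous_on A Phi'"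
  unfolding Phi'_def by (intro continuous_intros) auto

section \<open>Moments of the kernel\<close>

lemma set_integrable_exp_minus: "set_integrable lborel {0<..} (\<lambda>u::real. exp (- u))"
proof -
  have "(\<lambda>u::real. exp (- u)) integrable_on {0..}"
    using integrable_on_exp_minus_to_infinity[of 1 0] by simp
  then have "(\<lambda>u::real. exp (- u)) absolutely_integrable_on {0..}"
    by (rule nonnegative_absolutely_integrable_1) auto
  then have "(\<lambda>u::real. exp (- u)) absolutely_integrable_on {0<..}"
    by (rule set_integrable_subset) auto
  then show ?thesis
    unfolding set_integrable_def
    by (subst (asm) integrable_completion) (auto intro!: borel_measurable_continuous_onI continuous_intros)
qed

lemma set_integrable_exp_bound:
  fixes f :: "real \<Rightarrow> real"
  assumes "continuous_on UNIV f" "\<And>u. u > 0 \<Longrightarrow> \<bar>f u\<bar> \<le> C * exp (- u)"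
  shows "set_integrable lborel {0<..} f"
proof (rule set_integrable_bound)
  show "set_integrable lborel {0<..} (\<lambda>u. C * exp (- u))"
    by (intro set_integrable_mult_right set_integrable_exp_minus)
  show "set_borel_measurable lborel {0<..} f"
    unfolding set_borel_measurable_def using borel_measurable_continuous_onI[OF assms(1)] by measurable
  show "AE x in lborel. x \<in> {0<..} \<longrightarrow> norm (f x) \<le> norm (C * exp (- x))"
    using assms(2) by (auto intro: order_trans[OF _ abs_ge_self])
qed

lemma theta_sum_moment_bound:
  obtains C where "\<And>u. u > 0 \<Longrightarrow> \<bar>u ^ k * exp (c * u) * theta_sum P u\<bar> \<le> C * exp (- u)"
proof -
  \<comment> \<open>The rate 2 (j + 1) has to cover c, one unit spent on u^k, and the remaining
    exp(-u).\<close>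
  obtain j :: nat where j: "real j \<ge> c + 2" using real_arch_simple by blast
  obtain K where K: "K \<ge> 0" "\<And>u. \<bar>theta_sum P u\<bar> \<le> K * exp (- 2 * real (Suc j) * u)"
    using theta_sum_bound[of P j] by blast
  have "\<bar>u ^ k * exp (c * u) * theta_sum P u\<bar> \<le> fact k * K * exp (- u)" if u: "u > 0" for u
  proof -
    have "u ^ k \<le> fact k * exp u"
      using power_exp_minus_le_fact[of u k] u by (simp add: exp_minus field_simps)
    then have "\<bar>u ^ k * exp (c * u) * theta_sum P u\<bar> \<le> (fact k * exp u) * exp (c * u) * (K * exp (- 2 * real (Suc j) * u))"
      unfolding abs_mult using u K by (intro mult_mono) auto
    also have "\<dots> = fact k * K * exp (u + c * u - 2 * real (Suc j) * u)"
    proof -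
      have "- 2 * real (Suc j) * u = - (2 * real (Suc j) * u)" by (simp only: mult_minus_left)
      then show ?thesis by (simp only: diff_conv_add_uminus exp_add mult_ac)
    qed
    also have "\<dots> \<le> fact k * K * exp (- u)"
    proof -
      have "c + 2 \<le> 2 * real (Suc j)" using j by simp
      then have "(c + 2) * u \<le> 2 * real (Suc j) * u" using u by (intro mult_right_mono) auto
      then have "u + c * u - 2 * real (Suc j) * u \<le> - u" by (simp add: algebra_simps)
      then show ?thesis using K(1) by (intro mult_left_mono) auto
    qed
    finally show ?thesis .
  qed
  then show ?thesis using that by blast
qed

lemma set_integrable_theta_sum:
  "set_integrable lborel {0<..} (\<lambda>u. u ^ k * exp (c * u) * theta_sum P u)"
proof -
  obtain C where "\<And>u. u > 0 \<Longrightarrow> \<bar>u ^ k * exp (c * u) * theta_sum P u\<bar> \<le> C * exp (- u)"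
    using theta_sum_moment_bound[of k c P] by blast
  then show ?thesis by (intro set_integrable_exp_bound) (auto intro!: continuous_intros)
qed

lemma set_integrable_Phi: "set_integrable lborel {0<..} (\<lambda>u. u ^ k * exp (c * u) * Phi u)"
proof -
  have "set_integrable lborel {0<..} (\<lambda>u. 2 * (u ^ k * exp ((c + 1/2) * u) * theta_sum Phi_poly u))"
    by (intro set_integrable_mult_right set_integrable_theta_sum)
  also have "(\<lambda>u. 2 * (u ^ k * exp ((c + 1/2) * u) * theta_sum Phi_poly u)) = (\<lambda>u. u ^ k * exp (c * u) * Phi u)"
    by (auto simp: Phi_def algebra_simps exp_add)
  finally show ?thesis .
qed

lemma set_integrable_Phi_moment: "set_integrable lborel {0<..} (\<lambda>u. u ^ k * Phi u)"
  using set_integrable_Phi[of k 0] by simp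

lemma set_integrable_Phi'_moment: "set_integrable lborel {0<..} (\<lambda>u. u ^ k * Phi' u)"
proof -
  have "set_integrable lborel {0<..} (\<lambda>u. u ^ k * exp (1/2 * u) * theta_sum Phi_poly u + 2 * (u ^ k * exp (1/2 * u) * theta_sum Phi_poly1 u))"
    by (intro set_integral_add set_integrable_mult_right set_integrable_theta_sum)
  also have "(\<lambda>u. u ^ k * exp (1/2 * u) * theta_sum Phi_poly u + 2 * (u ^ k * exp (1/2 * u) * theta_sum Phi_poly1 u)) = (\<lambda>u. u ^ k * Phi' u)"
    by (auto simp: Phi'_def algebra_simps)
  finally show ?thesis .
qed

lemma Phi_moment_tendsto: "((\<lambda>u. u ^ k * Phi u) \<longlongrightarrow> 0) at_top"
proof -
  obtain C where C: "\<And>u. u > 0 \<Longrightarrow> \<bar>u ^ k * exp (1/2 * u) * theta_sum Phi_poly u\<bar> \<le> C * exp (- u)"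
    using theta_sum_moment_bound[of k "1/2" Phi_poly] by blast
  show ?thesis
  proof (rule Lim_null_comparison)
    show "eventually (\<lambda>u. norm (u ^ k * Phi u) \<le> 2 * C * exp (- u)) at_top"
      using eventually_gt_at_top[of 0]
    proof eventually_elim
      case (elim u)
      then show ?case using C[of u] by (simp add: Phi_def abs_mult mult_ac)
    qed
    have "((\<lambda>u::real. exp (- u)) \<longlongrightarrow> 0) at_top"
      by (intro filterlim_compose[OF exp_at_bot] filterlim_uminus_at_bot_at_top)
    from tendsto_mult_right_zero[OF this] show "((\<lambda>u. 2 * C * exp (- u)) \<longlongrightarrow> 0) at_top" .
  qed
qed

definition Phi_moment :: "nat \<Rightarrow> real" where
  "Phi_moment k = (LINT u:{0<..}|lborel. u ^ k * Phi u)"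

text \<open>The boundary terms vanish: at 0 by the positive power of u, at infinity by decay. It
  converts moments of the derivative into moments of the kernel.\<close>

lemma Phi_moment_by_parts:
  "(LINT u:{0<..}|lborel. u ^ Suc k * Phi' u) = - (real (Suc k) * Phi_moment k)"
proof -
  let ?f = "\<lambda>u. real (Suc k) * (u ^ k * Phi u) + u ^ Suc k * Phi' u"
  have int: "set_integrable lborel {0<..} ?f"
    by (intro set_integral_add set_integrable_mult_right set_integrable_Phi_moment set_integrable_Phi'_moment)
  have "(LBINT u=ereal 0..\<infinity>. ?f u) = 0 - 0"
  proof (rule interval_integral_FTC_integrable[where F = "\<lambda>u. u ^ Suc k * Phi u"])
    show "((\<lambda>u. u ^ Suc k * Phi u) has_vector_derivative ?f u) (at u)" for u
      unfolding has_real_derivative_iff_has_vector_derivative[symmetric]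
      using DERIV_mult[OF DERIV_pow[of "Suc k"] has_real_derivative_Phi, of u]
      by (simp add: mult_ac del: power_Suc)
    show "isCont ?f u" for u
      using continuous_on_Phi[of UNIV] continuous_on_Phi'[of UNIV]
      by (intro continuous_intros) (auto simp: continuous_on_eq_continuous_at)
    show "set_integrable lborel (einterval (ereal 0) \<infinity>) ?f" using int by simp
    have "isCont (\<lambda>u. u ^ Suc k * Phi u) 0"
      using continuous_on_Phi[of UNIV] by (intro continuous_intros) (auto simp: continuous_on_eq_continuous_at)
    then have "((\<lambda>u. u ^ Suc k * Phi u) \<longlongrightarrow> 0) (at_right 0)"
      by (auto simp: isCont_def intro: tendsto_within_subset)
    then show "(((\<lambda>u. u ^ Suc k * Phi u) \<circ> real_of_ereal) \<longlongrightarrow> 0) (at_right (ereal 0))"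
      by (simp add: ereal_tendsto_simps)
    show "(((\<lambda>u. u ^ Suc k * Phi u) \<circ> real_of_ereal) \<longlongrightarrow> 0) (at_left \<infinity>)"
      using Phi_moment_tendsto[of "Suc k"] by (simp add: ereal_tendsto_simps)
  qed auto
  then have "(LINT u:{0<..}|lborel. ?f u) = 0"
    by (simp add: interval_lebesgue_integral_0_infty zero_ereal_def[symmetric])
  moreover have "(LINT u:{0<..}|lborel. ?f u) = real (Suc k) * Phi_moment k + (LINT u:{0<..}|lborel. u ^ Suc k * Phi' u)"
    unfolding Phi_moment_def
    by (subst set_integral_add(2)[OF set_integrable_mult_right[OF set_integrable_Phi_moment] set_integrable_Phi'_moment]) simp
  ultimately show ?thesis by simp
qed

lemma Phi_moment_pos: "Phi_moment k > 0"
proof -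
  have "Phi_moment k \<ge> 0"
    unfolding Phi_moment_def set_lebesgue_integral_def
    by (rule integral_nonneg_AE) (auto simp: indicator_def Phi_pos less_imp_le)
  moreover have "Phi_moment k \<noteq> 0"
  proof
    assume "Phi_moment k = 0"
    then have "AE u in lborel. indicator {0<..} u *\<^sub>R (u ^ k * Phi u) = 0"
      using set_integrable_Phi_moment[of k] unfolding Phi_moment_def set_lebesgue_integral_def set_integrable_def
      by (subst (asm) integral_nonneg_eq_0_iff_AE) (auto simp: indicator_def Phi_pos less_imp_le)
    then have "AE u in lborel. u \<notin> {0<..<1::real}"
      by eventually_elim (use Phi_pos in \<open>auto simp: indicator_def less_imp_neq[symmetric] split: if_splits\<close>)
    then have zero: "emeasure lborel {0<..<1::real} = 0"
      by (subst (asm) AE_iff_measurable[where N = "{0<..<1}"]) auto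
    have "emeasure lborel {0<..<1::real} = ennreal (1 - 0)"
      by (rule emeasure_lborel_Ioo) simp
    with zero have "ennreal (1 - 0) = 0" by (simp only:)
    then show False by simp
  qed
  ultimately show ?thesis by simp
qed

text \<open>Chebyshev's association inequality for the weight \<open>u ^ k * Phi u\<close> and the increasing functions
  \<open>u\<close> and \<open>- Phi' u / Phi u\<close>. Comparing with their values at the mean \<open>c\<close> of the weight makes the integrand
  nonnegative, so that no double integral is needed.\<close>

lemma Phi_moment_logconcave:
  assumes "k \<ge> 1"
  shows "real k * Phi_moment (k - 1) * Phi_moment (k + 1) \<le> real (k + 1) * (Phi_moment k)\<^sup>2"
proof -
  define c where "c = Phi_moment (k + 1) / Phi_moment k"
  have "c > 0" using Phi_moment_pos by (simp add: c_def)
  define q where "q = Phi' c / Phi c"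
  let ?f = "\<lambda>u. (u - c) * (q * Phi u - Phi' u) * u ^ k"
  have f_eq: "?f u = q * (u ^ (k + 1) * Phi u) - c * q * (u ^ k * Phi u) + c * (u ^ k * Phi' u) - u ^ (k + 1) * Phi' u" for u
    by (simp add: algebra_simps)
  have "0 \<le> (LINT u:{0<..}|lborel. ?f u)"
    unfolding set_lebesgue_integral_def
  proof (rule integral_nonneg_AE, rule AE_I2)
    fix u :: real
    have "0 \<le> ?f u" if u: "u > 0"
    proof -
      have "0 \<le> (u - c) * (q - Phi' u / Phi u)"
      proof (cases "u \<le> c")
        case True
        then show ?thesis using Phi_ratio_antimono[of u c] u by (intro mult_nonpos_nonpos) (auto simp: q_def)
      next
        case False
        then show ?thesis using Phi_ratio_antimono[of c u] \<open>c > 0\<close> by (intro mult_nonneg_nonneg) (auto simp: q_def)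
      qed
      then have "0 \<le> (u - c) * (q - Phi' u / Phi u) * Phi u * u ^ k"
        using Phi_pos[of u] u by (intro mult_nonneg_nonneg[of _ "u ^ k"] mult_nonneg_nonneg[of _ "Phi u"]) simp_all
      also have "\<dots> = ?f u" using Phi_pos[of u] by (simp add: field_simps)
      finally show ?thesis .
    qed
    then show "0 \<le> indicator {0<..} u *\<^sub>R ?f u" by (simp add: indicator_def)
  qed
  also have "(LINT u:{0<..}|lborel. ?f u) = q * Phi_moment (k + 1) - c * q * Phi_moment k
      + c * (LINT u:{0<..}|lborel. u ^ k * Phi' u) - (LINT u:{0<..}|lborel. u ^ (k + 1) * Phi' u)"
    unfolding f_eq Phi_moment_def
    by (simp only: set_integral_add set_integral_diff set_integrable_mult_right set_integral_mult_right
        set_integrable_Phi_moment set_integrable_Phi'_moment)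
  \<comment> \<open>The choice of c as the mean makes the two terms with q cancel.\<close>
  also have "c * q * Phi_moment k = q * Phi_moment (k + 1)"
    using Phi_moment_pos[of k] by (simp add: c_def)
  also have "(LINT u:{0<..}|lborel. u ^ k * Phi' u) = - (real k * Phi_moment (k - 1))"
    using Phi_moment_by_parts[of "k - 1"] assms by simp
  also have "(LINT u:{0<..}|lborel. u ^ (k + 1) * Phi' u) = - (real (k + 1) * Phi_moment k)"
    using Phi_moment_by_parts[of k] by simp
  finally have "c * (real k * Phi_moment (k - 1)) \<le> real (k + 1) * Phi_moment k" by simp
  then have "c * (real k * Phi_moment (k - 1)) * Phi_moment k \<le> real (k + 1) * Phi_moment k * Phi_moment k"
    using Phi_moment_pos[of k] by (intro mult_right_mono) auto
  moreover have "c * (real k * Phi_moment (k - 1)) * Phi_moment k = real k * Phi_moment (k - 1) * Phi_moment (k + 1)"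
    using Phi_moment_pos[of k] by (simp add: c_def)
  ultimately have "real k * Phi_moment (k - 1) * Phi_moment (k + 1) \<le> real (k + 1) * Phi_moment k * Phi_moment k"
    by (simp only:)
  then show ?thesis by (simp only: power2_eq_square mult.assoc)
qed

text \<open>The coefficients of Xi use only even moments, so log-concavity with step 1 has to be
  carried over to step 2. The inequalities at k + 1 and k + 3 are multiplied, the squared one at k +
  2 is inserted, and (l (k + 2))^2 is cancelled. Division by k! turns the factors k and k + 1 of the
  moment inequality into plain log-concavity.\<close>

lemma Phi_moment_fact_logconcave:
  "Phi_moment k / fact k * (Phi_moment (k + 4) / fact (k + 4)) \<le> (Phi_moment (k + 2) / fact (k + 2))\<^sup>2"
proof -
  define l where "l = (\<lambda>k. Phi_moment k / fact k)"
  have pos: "l k > 0" for k using Phi_moment_pos by (simp add: l_def)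
  have step: "l k * l (k + 2) \<le> (l (k + 1))\<^sup>2" for k
  proof -
    have "l k * l (k + 2) = real (k + 1) * Phi_moment k * Phi_moment (k + 2) / (real (k + 2) * (fact (k + 1))\<^sup>2)"
    proof -
      have cancel: "m / f * (m' / (b * g)) = a * m * m' / (b * (g * (a * f)))" if "a > 0" for a b f g m m' :: real
        using that by simp
      have "fact (k + 2) = real (k + 2) * fact (k + 1)" "fact (k + 1) = real (k + 1) * (fact k :: real)"
        by (simp_all add: algebra_simps)
      then show ?thesis
        using cancel[of "real (k + 1)" "Phi_moment k" "fact k" "Phi_moment (k + 2)" "real (k + 2)" "fact (k + 1)"]
        unfolding l_def power2_eq_square by simp
    qed
    also have "\<dots> \<le> real (k + 2) * (Phi_moment (k + 1))\<^sup>2 / (real (k + 2) * (fact (k + 1))\<^sup>2)"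
      using Phi_moment_logconcave[of "k + 1"] by (intro divide_right_mono) (simp_all add: algebra_simps)
    also have "\<dots> = (l (k + 1))\<^sup>2" by (simp add: l_def power_divide)
    finally show ?thesis .
  qed
  have step': "l (k + 1) * l (k + 3) \<le> (l (k + 2))\<^sup>2" "l (k + 2) * l (k + 4) \<le> (l (k + 3))\<^sup>2"
    using step[of "k + 1"] step[of "k + 2"] by (simp_all add: eval_nat_numeral)
  have "(l (k + 1) * l (k + 3))\<^sup>2 \<le> ((l (k + 2))\<^sup>2)\<^sup>2"
    using pos by (intro power_mono step' mult_nonneg_nonneg less_imp_le)
  moreover have "(l k * l (k + 2)) * (l (k + 2) * l (k + 4)) \<le> (l (k + 1))\<^sup>2 * (l (k + 3))\<^sup>2"
    using pos by (intro mult_mono step step' mult_nonneg_nonneg zero_le_power less_imp_le)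
  ultimately have "(l (k + 2))\<^sup>2 * (l k * l (k + 4)) \<le> (l (k + 2))\<^sup>2 * (l (k + 2))\<^sup>2"
    by (simp add: power_mult_distrib power2_eq_square mult_ac)
  then have "l k * l (k + 4) \<le> (l (k + 2))\<^sup>2"
    by (rule mult_left_le_imp_le) (use pos[of "k + 2"] in simp)
  then show ?thesis by (simp add: l_def)
qed

section \<open>The zeta and Xi functions\<close>

definition xi_coeff :: "nat \<Rightarrow> real" where
  "xi_coeff n = 2 * Phi_moment (2 * n) / fact (2 * n)"

lemma xi_coeff_pos: "xi_coeff n > 0"
  by (simp add: xi_coeff_def Phi_moment_pos)

lemma xi_coeff_logconcave: "xi_coeff n * xi_coeff (n + 2) \<le> (xi_coeff (n + 1))\<^sup>2"
proof -
  have "2 * x * (2 * y) \<le> (2 * z)\<^sup>2" if "x * y \<le> z\<^sup>2" for x y z :: real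
    using that by (simp add: power2_eq_square)
  from this[OF Phi_moment_fact_logconcave[of "2 * n"]] show ?thesis
    by (simp only: xi_coeff_def times_divide_eq_right distrib_left) simp
qed

text \<open>(C u)^(2n) is at most (2n)! exp(C u), and the kernel is integrable against every
  exponential. As C is arbitrary, the power series is entire.\<close>

lemma xi_coeff_bound:
  assumes "C > 0"
  obtains K where "\<And>n. xi_coeff n \<le> K / C ^ (2 * n)"
proof -
  define I where "I = (LINT u:{0<..}|lborel. exp (C * u) * Phi u)"
  have "xi_coeff n \<le> 2 * I / C ^ (2 * n)" for n
  proof -
    have "fact (2 * n) / C ^ (2 * n) * I = (LINT u:{0<..}|lborel. fact (2 * n) / C ^ (2 * n) * (exp (C * u) * Phi u))"
      by (simp add: I_def)
    also have "\<dots> \<ge> Phi_moment (2 * n)"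
      unfolding Phi_moment_def
    proof (rule set_integral_mono)
      show "set_integrable lborel {0<..} (\<lambda>u. fact (2 * n) / C ^ (2 * n) * (exp (C * u) * Phi u))"
        using set_integrable_Phi[of 0 C] by (intro set_integrable_mult_right) simp
      fix u :: real assume u: "u \<in> {0<..}"
      have "(C * u) ^ (2 * n) \<le> fact (2 * n) * exp (C * u)"
        using power_exp_minus_le_fact[of "C * u" "2 * n"] u assms by (simp add: exp_minus field_simps)
      then have "u ^ (2 * n) \<le> fact (2 * n) / C ^ (2 * n) * exp (C * u)"
        using assms by (simp add: power_mult_distrib field_simps)
      from mult_right_mono[OF this, of "Phi u"] show "u ^ (2 * n) * Phi u \<le> fact (2 * n) / C ^ (2 * n) * (exp (C * u) * Phi u)"
        using Phi_pos[of u] by (simp add: mult.assoc)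
    qed (rule set_integrable_Phi_moment)
    finally have "Phi_moment (2 * n) / fact (2 * n) \<le> I / C ^ (2 * n)" by (simp add: field_simps)
    then show ?thesis by (simp add: xi_coeff_def)
  qed
  then show ?thesis using that by blast
qed

lemma summable_xi_coeff:
  fixes z :: "'a :: {real_normed_field, banach}"
  shows "summable (\<lambda>n. norm (of_real (xi_coeff n) * z ^ n))"
proof -
  define C where "C = sqrt (2 * norm z + 1)"
  have C: "C > 0" "C\<^sup>2 = 2 * norm z + 1" by (auto simp: C_def add_pos_nonneg intro: add_nonneg_pos)
  obtain K where K: "\<And>n. xi_coeff n \<le> K / C ^ (2 * n)" using xi_coeff_bound[OF C(1)] by blast
  have "summable (\<lambda>n. K * (norm z / C\<^sup>2) ^ n)"
    by (intro summable_mult summable_geometric) (simp add: C(2) divide_less_eq add_nonneg_pos)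
  then show ?thesis
  proof (rule summable_comparison_test'[where N = 0])
    fix n
    have "norm (of_real (xi_coeff n) * z ^ n) = xi_coeff n * norm z ^ n"
      using xi_coeff_pos[of n] by (simp add: norm_mult norm_power)
    also have "\<dots> \<le> K / C ^ (2 * n) * norm z ^ n" by (intro mult_right_mono K) auto
    also have "\<dots> = K * (norm z / C\<^sup>2) ^ n" by (simp add: power_divide power_mult)
    finally show "norm (norm (of_real (xi_coeff n) * z ^ n)) \<le> K * (norm z / C\<^sup>2) ^ n" by simp
  qed
qed

text \<open>The two-sided Laplace transform of the kernel, given by its power series so that it is
  entire from the start. Its variable is s - 1/2 = i z, which removes the signs of the Xi
  series.\<close>

definition XI :: "complex \<Rightarrow> complex" where
  "XI w = (\<Sum>n. of_real (xi_coeff n) * (w\<^sup>2) ^ n)"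

lemma XI_sums: "(\<lambda>n. of_real (xi_coeff n) * (w\<^sup>2) ^ n) sums XI w"
  unfolding XI_def by (rule summable_sums[OF summable_norm_cancel[OF summable_xi_coeff]])

lemma holomorphic_XI [holomorphic_intros]:
  assumes "f holomorphic_on A"
  shows "(\<lambda>z. XI (f z)) holomorphic_on A"
proof -
  have "(\<lambda>z. \<Sum>n. of_real (xi_coeff n) * z ^ n) holomorphic_on ball 0 r" for r :: real
  proof (rule power_series_holomorphic)
    show "(\<lambda>n. of_real (xi_coeff n) * (w - 0) ^ n) sums (\<Sum>n. of_real (xi_coeff n) * w ^ n)" for w :: complex
      using summable_sums[OF summable_norm_cancel[OF summable_xi_coeff[of w]]] by simp
  qed
  then have "(\<lambda>z::complex. \<Sum>n. of_real (xi_coeff n) * z ^ n) holomorphic_on (\<Union>r. ball 0 r)"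
    by (intro holomorphic_on_UN_open) auto
  also have "(\<Union>r. ball 0 r) = (UNIV :: complex set)" by (auto simp: gt_ex)
  finally have "(\<lambda>z::complex. \<Sum>n. of_real (xi_coeff n) * z ^ n) holomorphic_on UNIV" .
  from holomorphic_on_compose_gen[OF _ this, of "\<lambda>z. (f z)\<^sup>2" A] assms show ?thesis
    by (simp add: o_def XI_def holomorphic_intros)
qed

section \<open>The Mellin transform of the kernel\<close>

lemma integral_reflect_half:
  fixes f :: "real \<Rightarrow> real"
  assumes "integrable lborel f"
  shows "(LINT u|lborel. f u) = (LINT u:{0<..}|lborel. f u + f (- u))"
proof -
  have int: "integrable lborel (\<lambda>u. indicator A u *\<^sub>R f u)" if "A \<in> sets borel" for A
    by (rule integrable_mult_indicator) (use that assms in auto)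
  have refl: "(LINT u|lborel. indicator {..<0} u *\<^sub>R f u) = (LINT u|lborel. indicator {0<..} u *\<^sub>R f (- u))"
    by (subst lborel_integral_real_affine[where c = "-1" and t = 0])
       (auto intro!: Bochner_Integration.integral_cong split: split_indicator)
  have int': "integrable lborel (\<lambda>u. indicator {0<..} u *\<^sub>R f (- u))"
    using lborel_integrable_real_affine[OF int[of "{..<0}"], of "-1" 0]
    by (rule Bochner_Integration.integrable_cong[THEN iffD1, rotated -1]) (auto split: split_indicator)
  have "AE u in lborel. u \<noteq> (0::real)" by (rule AE_lborel_singleton)
  then have "(LINT u|lborel. f u) = (LINT u|lborel. indicator {0<..} u *\<^sub>R f u + indicator {..<0} u *\<^sub>R f u)"
    using assms int by (intro integral_cong_AE) (auto split: split_indicator elim!: eventually_mono)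
  also have "\<dots> = (LINT u|lborel. indicator {0<..} u *\<^sub>R f u) + (LINT u|lborel. indicator {0<..} u *\<^sub>R f (- u))"
    unfolding refl[symmetric] by (intro Bochner_Integration.integral_add int) auto
  also have "\<dots> = (LINT u:{0<..}|lborel. f u + f (- u))"
    unfolding set_lebesgue_integral_def
    unfolding scaleR_add_right by (rule Bochner_Integration.integral_add[symmetric]) (rule int int', simp?)+
  finally show ?thesis .
qed

text \<open>Folding the line onto the half-line produces exp(w u) + exp(-w u), whose expansion has
  only even powers and nonnegative terms. Integrating termwise then requires no more than
  convergence of the series for \<open>XI\<close>.\<close>

lemma XI_eq_integral:
  fixes w :: real
  assumes "integrable lborel (\<lambda>u. exp (w * u) * Phi u)"
  shows "XI (of_real w) = of_real (LINT u|lborel. exp (w * u) * Phi u)"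
proof -
  let ?f = "\<lambda>n u. 2 * w ^ (2 * n) / fact (2 * n) * (indicator {0<..} u * (u ^ (2 * n) * Phi u))"
  have exp_sums: "(\<lambda>n. 2 * x ^ (2 * n) / fact (2 * n)) sums (exp x + exp (- x))" for x :: real
  proof -
    have "(\<lambda>n. x ^ n /\<^sub>R fact n + (- x) ^ n /\<^sub>R fact n) sums (exp x + exp (- x))"
      by (intro sums_add exp_converges)
    moreover have "strict_mono (\<lambda>n::nat. 2 * n)" by (simp add: strict_mono_def)
    moreover have "x ^ n /\<^sub>R fact n + (- x) ^ n /\<^sub>R fact n = 0" if "n \<notin> range (\<lambda>n. 2 * n)" for n
    proof -
      have "odd n" using that by (auto elim!: evenE)
      then show ?thesis by simp
    qed
    ultimately have "(\<lambda>n. x ^ (2 * n) /\<^sub>R fact (2 * n) + (- x) ^ (2 * n) /\<^sub>R fact (2 * n)) sums (exp x + exp (- x))"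
      using sums_mono_reindex[of "\<lambda>n. 2 * n" "\<lambda>n. x ^ n /\<^sub>R fact n + (- x) ^ n /\<^sub>R fact n"] by simp
    then show ?thesis by (simp add: divide_inverse mult_ac)
  qed
  have int: "integrable lborel (?f n)" for n
    using set_integrable_Phi_moment[of "2 * n"] by (intro integrable_mult_right) (simp add: set_integrable_def)
  have val: "(LINT u|lborel. ?f n u) = xi_coeff n * (w\<^sup>2) ^ n" for n
    by (simp add: xi_coeff_def Phi_moment_def set_lebesgue_integral_def power_mult)
  have f_sums: "(\<lambda>n. ?f n u) sums (indicator {0<..} u * (exp (w * u) + exp (- (w * u))) * Phi u)" for u
    using sums_mult2[OF exp_sums[of "w * u"], of "indicator {0<..} u * Phi u"]
    by (simp add: power_mult_distrib mult_ac)
  have f_nonneg: "?f n u \<ge> 0" for n u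
    using Phi_pos[of u] by (auto simp: power_mult indicator_def less_imp_le)
  have "(\<lambda>n. LINT u|lborel. ?f n u) sums (LINT u|lborel. (\<Sum>n. ?f n u))"
  proof (rule sums_integral[OF int])
    show "AE u in lborel. summable (\<lambda>n. norm (?f n u))"
      unfolding real_norm_def abs_of_nonneg[OF f_nonneg] by (rule AE_I2) (rule sums_summable[OF f_sums])
    show "summable (\<lambda>n. LINT u|lborel. norm (?f n u))"
      unfolding real_norm_def abs_of_nonneg[OF f_nonneg] val
      using summable_norm_cancel[OF summable_xi_coeff[of "w\<^sup>2"]] by simp
  qed
  also have "(\<lambda>u. \<Sum>n. ?f n u) = (\<lambda>u. indicator {0<..} u *\<^sub>R (exp (w * u) * Phi u + exp (w * (- u)) * Phi (- u)))"
    unfolding sums_unique[OF f_sums, symmetric] by (auto simp: Phi_even algebra_simps)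
  also have "(LINT u|lborel. indicator {0<..} u *\<^sub>R (exp (w * u) * Phi u + exp (w * (- u)) * Phi (- u)))
      = (LINT u|lborel. exp (w * u) * Phi u)"
    using integral_reflect_half[OF assms] by (simp add: set_lebesgue_integral_def)
  finally have "(\<lambda>n. xi_coeff n * (w\<^sup>2) ^ n) sums (LINT u|lborel. exp (w * u) * Phi u)"
    unfolding val .
  then have "(\<lambda>n. of_real (xi_coeff n * (w\<^sup>2) ^ n)) sums (of_real (LINT u|lborel. exp (w * u) * Phi u) :: complex)"
    by (subst sums_of_real_iff)
  then show ?thesis using XI_sums[of "of_real w"] by (auto intro: sums_unique2)
qed

text \<open>Euler's integral for Gamma(s/2 + k) under t = c exp(2u), where dt = 2 t du.\<close>

lemma mellin_exp:
  fixes c s :: real and k :: nat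
  assumes "c > 0" "s > 0"
  shows "integrable lborel (\<lambda>u. exp (s * u) * ((c * exp (2 * u)) ^ k * exp (- (c * exp (2 * u)))))"
    and "(LINT u|lborel. exp (s * u) * ((c * exp (2 * u)) ^ k * exp (- (c * exp (2 * u))))) =
      c powr (- s / 2) * Gamma (s / 2 + real k) / 2"
proof -
  define x where "x = s / 2 + real k"
  have x: "x > 0" using assms by (auto simp: x_def add_pos_nonneg)
  let ?h = "\<lambda>t. c powr (- s / 2) / 2 * (t powr (x - 1) / exp t)"
  let ?g = "\<lambda>u. c * exp (2 * u)"
  let ?f = "\<lambda>u. exp (s * u) * (?g u ^ k * exp (- ?g u))"
  have "((\<lambda>t. t powr (x - 1) / exp t) has_integral Gamma x) {0<..}"
  proof -
    have "((\<lambda>t. if t \<in> {0<..} then t powr (x - 1) / exp t else 0) has_integral Gamma x) {0..}"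
      by (rule has_integral_spike[OF _ _ Gamma_integral_real[OF x], of "{0}"]) auto
    then show ?thesis by (subst (asm) has_integral_restrict) auto
  qed
  then have h: "(?h has_integral (c powr (- s / 2) / 2 * Gamma x)) {0<..}"
    by (rule has_integral_mult_right)
  then have "?h absolutely_integrable_on {0<..}"
    by (intro nonnegative_absolutely_integrable_1) (auto simp: integrable_on_def)
  moreover have img: "range ?g = {0<..}"
  proof (intro equalityI subsetI)
    fix t :: real assume "t \<in> {0<..}"
    then have "?g (ln (t / c) / 2) = t" using assms by simp
    then show "t \<in> range ?g" by (metis rangeI)
  qed (use assms in auto)
  ultimately have h': "?h absolutely_integrable_on range ?g \<and> integral (range ?g) ?h = c powr (- s / 2) / 2 * Gamma x"
    using h by (simp add: integral_unique)
  have "(\<lambda>u. \<bar>2 * ?g u\<bar> * ?h (?g u)) absolutely_integrable_on UNIV \<and>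
      integral UNIV (\<lambda>u. \<bar>2 * ?g u\<bar> * ?h (?g u)) = c powr (- s / 2) / 2 * Gamma x"
    by (rule has_absolute_integral_change_of_variables_1'[THEN iffD2, OF _ _ _ h'])
       (use assms in \<open>auto intro!: derivative_eq_intros simp: inj_on_def\<close>)
  moreover have "\<bar>2 * ?g u\<bar> * ?h (?g u) = ?f u" for u
  proof -
    have "?g u * ?g u powr (x - 1) = ?g u powr x"
      using assms by (simp add: powr_diff)
    also have "\<dots> = c powr (s / 2) * (exp (2 * u) powr (s / 2) * ?g u ^ k)"
      unfolding x_def using assms by (simp add: powr_add powr_mult powr_realpow power_mult_distrib)
    also have "exp (2 * u) powr (s / 2) = exp (s * u)"
      by (simp add: powr_def)
    finally have "?g u * ?g u powr (x - 1) * c powr (- s / 2) =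
        (c powr (- s / 2) * c powr (s / 2)) * (exp (s * u) * ?g u ^ k)"
      by (simp only: mult_ac)
    also have "c powr (- s / 2) * c powr (s / 2) = 1"
      using assms by (simp flip: powr_add)
    finally have "?g u * ?g u powr (x - 1) * c powr (- s / 2) = exp (s * u) * ?g u ^ k"
      by (simp only: mult_1)
    moreover have "\<bar>2 * ?g u\<bar> * ?h (?g u) = (?g u * ?g u powr (x - 1) * c powr (- s / 2)) * exp (- ?g u)"
    proof -
      have "\<bar>2 * y\<bar> * (p / 2 * (q / exp y)) = (y * q * p) * exp (- y)" if "y > 0" for y p q :: real
      proof -
        have "2 * y * (p / 2 * (q / E)) = (y * q * p) * inverse E" for E
          by (simp add: inverse_eq_divide mult_ac)
        then show ?thesis using that unfolding exp_minus by (simp only: abs_of_pos mult_pos_pos zero_less_numeral)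
      qed
      from this[of "?g u"] assms show ?thesis by (simp only: mult_pos_pos exp_gt_zero)
    qed
    ultimately show ?thesis by (simp only: mult.assoc)
  qed
  ultimately have f: "?f absolutely_integrable_on UNIV" "integral UNIV ?f = c powr (- s / 2) / 2 * Gamma x"
    by simp_all
  have meas: "?f \<in> borel_measurable borel"
    by (intro borel_measurable_continuous_onI continuous_intros)
  show int: "integrable lborel ?f"
    using f(1) meas by (simp add: set_integrable_def integrable_completion)
  have "(LINT u|lborel. ?f u) = integral UNIV ?f"
    using has_integral_integral_lborel[OF int] by (simp add: integral_unique)
  then show "(LINT u|lborel. ?f u) = c powr (- s / 2) * Gamma (s / 2 + real k) / 2"
    unfolding f(2) by (simp add: x_def)
qed

lemma summable_Suc_powr_minus:
  fixes s :: real
  assumes "s > 1"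
  shows "summable (\<lambda>n. real (Suc n) powr - s)"
  using assms by (subst summable_Suc_iff[of "\<lambda>n. real n powr - s"]) (simp add: summable_real_powr_iff)

text \<open>Term n yields a multiple of (n+1)^(-s). The polynomial 2 t^2 - 3 t turns into 2
  Gamma(s/2 + 2) - 3 Gamma(s/2 + 1), which is s (s - 1) / 2 times Gamma(s/2): this is how the
  prefactor of Xi arises. The shift by 1/2 compensates exp(u/2) in \<open>Phi\<close>.\<close>

lemma mellin_Phi:
  fixes s :: real
  assumes s: "s > 1"
  shows "integrable lborel (\<lambda>u. exp ((s - 1 / 2) * u) * Phi u)"
    and "(\<lambda>n. s * (s - 1) / 2 * pi powr (- s / 2) * Gamma (s / 2) * real (Suc n) powr - s) sums
      (LINT u|lborel. exp ((s - 1 / 2) * u) * Phi u)"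
proof -
  define E where "E = (\<lambda>k n u. exp (s * u) * (thetat n u ^ k * exp (- thetat n u)))"
  define f where "f = (\<lambda>n u. 4 * E 2 n u - 6 * E 1 n u)"
  define C where "C = (\<lambda>n. pi powr (- s / 2) * real (Suc n) powr - s)"
  have E_int: "integrable lborel (E k n)" for k n
    unfolding E_def thetat_def by (rule mellin_exp(1)) (use s in auto)
  have E_val: "(LINT u|lborel. E k n u) = C n * Gamma (s / 2 + real k) / 2" for k n
  proof -
    have "(pi * (real (Suc n))\<^sup>2) powr (- s / 2) = C n"
    proof -
      have "(real (Suc n))\<^sup>2 = real (Suc n) powr real 2"
        by (rule powr_realpow[symmetric]) simp
      then have "((real (Suc n))\<^sup>2) powr (- s / 2) = real (Suc n) powr (real 2 * (- s / 2))"
        by (simp only: powr_powr)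
      also have "real 2 * (- s / 2) = - s" by simp
      finally show ?thesis unfolding C_def by (subst powr_mult) simp_all
    qed
    moreover have "(LINT u|lborel. E k n u) = (pi * (real (Suc n))\<^sup>2) powr (- s / 2) * Gamma (s / 2 + real k) / 2"
      unfolding E_def thetat_def by (rule mellin_exp(2)) (use s in auto)
    ultimately show ?thesis by (simp only:)
  qed
  have E_nonneg: "E k n u \<ge> 0" for k n u
    using thetat_pos[of n u] by (simp add: E_def)
  have f_int: "integrable lborel (f n)" for n
    unfolding f_def by (intro Bochner_Integration.integrable_diff integrable_mult_right E_int)
  have nonpos: "s / 2 \<notin> \<int>\<^sub>\<le>\<^sub>0" "s / 2 + 1 \<notin> \<int>\<^sub>\<le>\<^sub>0"
    using s by (auto dest!: nonpos_Ints_nonpos)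
  have Gamma1: "Gamma (s / 2 + 1) = s / 2 * Gamma (s / 2)"
    by (rule Gamma_plus1[OF nonpos(1)])
  have Gamma2: "Gamma (s / 2 + 2) = (s / 2 + 1) * (s / 2 * Gamma (s / 2))"
    using Gamma_plus1[OF nonpos(2)] Gamma1 by (simp add: add.assoc)
  have f_val: "(LINT u|lborel. f n u) = s * (s - 1) / 2 * pi powr (- s / 2) * Gamma (s / 2) * real (Suc n) powr - s" for n
  proof -
    have "(LINT u|lborel. f n u) = 4 * (LINT u|lborel. E 2 n u) - 6 * (LINT u|lborel. E 1 n u)"
      unfolding f_def by (subst Bochner_Integration.integral_diff) (auto intro: E_int)
    also have "\<dots> = C n * (2 * Gamma (s / 2 + 2) - 3 * Gamma (s / 2 + 1))"
      unfolding E_val by (simp add: algebra_simps)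
    also have "\<dots> = C n * (s * (s - 1) / 2 * Gamma (s / 2))"
      unfolding Gamma1 Gamma2 by (simp add: field_simps)
    finally show ?thesis by (simp only: C_def mult_ac)
  qed
  have f_theta: "f n u = 2 * exp (s * u) * (poly Phi_poly (thetat n u) * exp (- thetat n u))" for n u
    by (simp add: f_def E_def poly_Phi algebra_simps)
  have f_sum: "(\<Sum>n. f n u) = exp ((s - 1 / 2) * u) * Phi u" for u
  proof -
    have "(\<Sum>n. f n u) = 2 * exp (s * u) * theta_sum Phi_poly u"
      unfolding f_theta theta_sum_def by (rule suminf_mult[OF summable_theta_sum'])
    also have "exp (s * u) = exp ((s - 1 / 2) * u) * exp (u / 2)"
      by (simp add: algebra_simps flip: exp_add)
    finally show ?thesis by (simp add: Phi_def)
  qed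
  have ae: "AE u in lborel. summable (\<lambda>n. norm (f n u))"
  proof (rule AE_I2)
    fix u
    have "summable (\<lambda>n. 2 * exp (s * u) * \<bar>poly Phi_poly (thetat n u) * exp (- thetat n u)\<bar>)"
      by (rule summable_mult[OF summable_theta_sum])
    then show "summable (\<lambda>n. norm (f n u))"
      unfolding f_theta real_norm_def abs_mult by simp
  qed
  have nrm: "summable (\<lambda>n. LINT u|lborel. norm (f n u))"
  proof (rule summable_comparison_test'[where N = 0])
    let ?K = "pi powr (- s / 2) * (2 * Gamma (s / 2 + real 2) + 3 * Gamma (s / 2 + real 1))"
    show "summable (\<lambda>n. ?K * real (Suc n) powr - s)"
      by (intro summable_mult summable_Suc_powr_minus s)
    fix n
    have "(LINT u|lborel. norm (f n u)) \<le> (LINT u|lborel. 4 * E 2 n u + 6 * E 1 n u)"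
    proof (rule integral_mono)
      show "norm (f n u) \<le> 4 * E 2 n u + 6 * E 1 n u" for u
        using E_nonneg[of 2 n u] E_nonneg[of 1 n u] by (simp add: f_def abs_le_iff)
    qed (auto intro!: Bochner_Integration.integrable_add integrable_mult_right E_int f_int)
    also have "\<dots> = 4 * (LINT u|lborel. E 2 n u) + 6 * (LINT u|lborel. E 1 n u)"
      by (subst Bochner_Integration.integral_add) (auto intro: E_int)
    also have "\<dots> = ?K * real (Suc n) powr - s"
      unfolding E_val C_def by (simp add: algebra_simps)
    finally show "norm (LINT u|lborel. norm (f n u)) \<le> ?K * real (Suc n) powr - s"
      by simp
  qed
  show "integrable lborel (\<lambda>u. exp ((s - 1 / 2) * u) * Phi u)"
    using integrable_suminf[OF f_int ae nrm] unfolding f_sum .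
  show "(\<lambda>n. s * (s - 1) / 2 * pi powr (- s / 2) * Gamma (s / 2) * real (Suc n) powr - s) sums
      (LINT u|lborel. exp ((s - 1 / 2) * u) * Phi u)"
    using sums_integral[OF f_int ae nrm] unfolding f_sum f_val .
qed

text \<open>The formula for Xi solved for zeta. Writing s/2 * Gamma(s/2) as Gamma(s/2 + 1) removes
  the apparent singularity at 0, and the reciprocal Gamma function is entire, so only s = 1 is
  left.\<close>

definition zeta_continuation :: "complex \<Rightarrow> complex" where
  "zeta_continuation s = (if s = 1 then 0
     else XI (s - 1 / 2) * of_real pi powr (s / 2) * rGamma (s / 2 + 1) / (s - 1))"

lemma zeta_continuation_holomorphic: "zeta_continuation holomorphic_on - {1}"
proof -
  have "(\<lambda>s. XI (s - 1 / 2) * of_real pi powr (s / 2) * rGamma (s / 2 + 1) / (s - 1)) holomorphic_on - {1}"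
    by (auto intro!: holomorphic_intros)
  then show ?thesis
    by (rule holomorphic_transform) (auto simp: zeta_continuation_def)
qed

lemma norm_dirichlet_term:
  "norm (1 / of_nat (Suc n) powr s :: complex) = real (Suc n) powr - Re s"
proof -
  have "norm (of_nat (Suc n) powr s :: complex) = real (Suc n) powr Re s"
    by (subst norm_powr_real_powr) (auto simp del: of_nat_Suc)
  then show ?thesis by (simp only: norm_divide norm_one powr_minus inverse_eq_divide)
qed

lemma dirichlet_series_holomorphic:
  "(\<lambda>s::complex. \<Sum>n. 1 / of_nat (Suc n) powr s) holomorphic_on {s. Re s > 1}"
proof (rule holomorphic_uniform_sequence)
  show "open {s. Re s > 1}" by (rule open_halfspace_Re_gt)
  show "(\<lambda>s. \<Sum>i<n. 1 / of_nat (Suc i) powr s) holomorphic_on {s. Re s > 1}" for n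
    by (intro holomorphic_intros) (auto simp del: of_nat_Suc)
  fix x :: complex assume "x \<in> {s. Re s > 1}"
  then have x: "Re x > 1" by simp
  define d where "d = (Re x - 1) / 2"
  have d: "d > 0" using x by (simp add: d_def)
  have Re: "Re s \<ge> 1 + d" if "s \<in> cball x d" for s
  proof -
    have "\<bar>Re (x - s)\<bar> \<le> d" using that abs_Re_le_cmod[of "x - s"] by (simp add: dist_norm)
    then have "Re x - Re s \<le> d" by simp
    moreover have "Re x = 1 + 2 * d" by (simp add: d_def field_simps)
    ultimately show ?thesis by linarith
  qed
  have "uniform_limit (cball x d) (\<lambda>n s. \<Sum>i<n. 1 / of_nat (Suc i) powr s) (\<lambda>s. \<Sum>n. 1 / of_nat (Suc n) powr s) sequentially"
  proof (rule Weierstrass_m_test)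
    show "summable (\<lambda>n. real (Suc n) powr - (1 + d))"
      using d by (intro summable_Suc_powr_minus) simp
    show "norm (1 / of_nat (Suc n) powr s :: complex) \<le> real (Suc n) powr - (1 + d)" if "s \<in> cball x d" for n s
      unfolding norm_dirichlet_term using Re[OF that] by (intro powr_mono) auto
  qed
  moreover have "cball x d \<subseteq> {s. Re s > 1}" using Re d by force
  ultimately show "\<exists>d>0. cball x d \<subseteq> {s. Re s > 1} \<and>
      uniform_limit (cball x d) (\<lambda>n s. \<Sum>i<n. 1 / of_nat (Suc i) powr s) (\<lambda>s. \<Sum>n. 1 / of_nat (Suc n) powr s) sequentially"
    using d by blast
qed

lemma dirichlet_series_summable:
  assumes "Re s > 1"
  shows "summable (\<lambda>n. 1 / of_nat (Suc n) powr s :: complex)"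
  by (rule summable_norm_cancel) (use assms in \<open>simp only: norm_dirichlet_term summable_Suc_powr_minus\<close>)

lemma zeta_continuation_real:
  fixes s :: real
  assumes s: "s > 1"
  shows "(\<Sum>n. 1 / of_nat (Suc n) powr of_real s) = zeta_continuation (of_real s)"
proof -
  define k where "k = s * (s - 1) / 2 * pi powr (- s / 2) * Gamma (s / 2)"
  have "Gamma (s / 2) > 0" using s by (intro Gamma_real_pos) simp
  have "(\<lambda>n. k * real (Suc n) powr - s) sums (LINT u|lborel. exp ((s - 1 / 2) * u) * Phi u)"
    using mellin_Phi(2)[OF s] by (simp only: k_def)
  then have "(\<lambda>n. of_real (k * real (Suc n) powr - s)) sums XI (of_real (s - 1 / 2))"
    unfolding XI_eq_integral[OF mellin_Phi(1)[OF s]] by (subst sums_of_real_iff)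
  moreover have "of_real (k * real (Suc n) powr - s) = of_real k * (1 / of_nat (Suc n) powr of_real s :: complex)" for n
    using powr_of_real[of "real (Suc n)" s] by (simp add: powr_minus divide_inverse del: of_nat_Suc)
  ultimately have "(\<lambda>n. of_real k * (1 / of_nat (Suc n) powr of_real s :: complex)) sums XI (of_real (s - 1 / 2))"
    by (simp only:)
  then have XI: "of_real k * (\<Sum>n. 1 / of_nat (Suc n) powr of_real s :: complex) = XI (of_real (s - 1 / 2))"
    using suminf_mult[OF dirichlet_series_summable[of "of_real s"], of "of_real k"] s by (simp add: sums_iff del: of_nat_Suc)
  have "k * (pi powr (s / 2) * rGamma (s / 2 + 1) / (s - 1)) = 1"
  proof -
    have "pi powr (- s / 2) * pi powr (s / 2) = 1" by (simp flip: powr_add)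
    moreover have "rGamma (s / 2 + 1) * (s / 2 * Gamma (s / 2)) = 1"
    proof -
      have "rGamma (s / 2 + 1) * (s / 2 * Gamma (s / 2)) = (s / 2 * rGamma (s / 2 + 1)) * Gamma (s / 2)"
        by (simp only: mult_ac)
      also have "\<dots> = 1"
        unfolding rGamma_plus1 using \<open>Gamma (s / 2) > 0\<close> by (simp add: rGamma_inverse_Gamma)
      finally show ?thesis .
    qed
    moreover have "k * (pi powr (s / 2) * rGamma (s / 2 + 1) / (s - 1)) =
        (pi powr (- s / 2) * pi powr (s / 2)) * (rGamma (s / 2 + 1) * (s / 2 * Gamma (s / 2)))"
    proof -
      have "s * d / 2 * P * G * (P' * r / d) = (P * P') * (r * (s / 2 * G))" if "d \<noteq> 0" for d P P' G r :: real
        using that by (simp add: field_simps)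
      from this[of "s - 1"] s show ?thesis unfolding k_def by simp
    qed
    ultimately show ?thesis by (simp only: mult_1)
  qed
  then have "of_real (k * (pi powr (s / 2) * rGamma (s / 2 + 1) / (s - 1))) = (1 :: complex)" by (simp only: of_real_1)
  then have 1: "of_real k * (of_real pi powr (of_real s / 2) * rGamma (of_real s / 2 + 1) / (of_real s - 1)) = (1 :: complex)"
    using powr_of_real[of pi "s / 2"] by (simp add: rGamma_complex_of_real[symmetric])
  have "zeta_continuation (of_real s) = XI (of_real (s - 1 / 2)) * (of_real pi powr (of_real s / 2) * rGamma (of_real s / 2 + 1) / (of_real s - 1))"
    using s by (simp add: zeta_continuation_def)
  also have "\<dots> = (\<Sum>n. 1 / of_nat (Suc n) powr of_real s :: complex) * (of_real k * (of_real pi powr (of_real s / 2) * rGamma (of_real s / 2 + 1) / (of_real s - 1)))"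
    unfolding XI[symmetric] by (simp only: mult_ac)
  finally show ?thesis unfolding 1 by simp
qed

text \<open>The Mellin transform settles real s > 1; this ray accumulates at 2, and the identity
  theorem extends the equality to the half-plane.\<close>

lemma zeta_continuation_sums:
  assumes "Re s > 1"
  shows "(\<lambda>n. 1 / of_nat (Suc n) powr s) sums zeta_continuation s"
proof -
  let ?D = "\<lambda>s::complex. \<Sum>n. 1 / of_nat (Suc n) powr s"
  let ?S = "{s. Re s > 1}"
  have "?D s - zeta_continuation s = 0"
  proof (rule analytic_continuation[where f = "\<lambda>s. ?D s - zeta_continuation s" and w = s and S = ?S and U = "of_real ` {1<..}" and \<xi> = 2])
    show "(\<lambda>s. ?D s - zeta_continuation s) holomorphic_on ?S"
      by (intro holomorphic_on_diff dirichlet_series_holomorphic holomorphic_on_subset[OF zeta_continuation_holomorphic]) auto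
    show "open ?S" by (rule open_halfspace_Re_gt)
    show "connected ?S" by (intro convex_connected convex_halfspace_Re_gt)
    show "(2::complex) islimpt of_real ` {1<..}"
    proof (rule islimptI)
      fix T :: "complex set" assume "2 \<in> T" "open T"
      then obtain e where e: "e > 0" "ball 2 e \<subseteq> T" using open_contains_ball by blast
      have "of_real (2 + e / 2) \<in> ball (2::complex) e"
        using e by (simp add: dist_norm)
      then have "complex_of_real (2 + e / 2) \<in> T" using e by blast
      moreover have "complex_of_real (2 + e / 2) \<in> of_real ` {1<..}" using e by (intro imageI) simp
      moreover have "complex_of_real (2 + e / 2) \<noteq> 2" using e by (simp add: complex_eq_iff)
      ultimately show "\<exists>y\<in>of_real ` {1<..}. y \<in> T \<and> y \<noteq> 2" by blast
    qed
    show "?D z - zeta_continuation z = 0" if "z \<in> of_real ` {1<..}" for z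
      using that zeta_continuation_real by auto
  qed (use assms in auto)
  then show ?thesis using summable_sums[OF dirichlet_series_summable[OF assms]] by simp
qed

text \<open>Besides existence the description needs uniqueness: two continuations agree on Re s > 1,
  hence on the connected punctured plane, and the value at 1 is prescribed.\<close>

lemma riemann_zeta_eq: "riemann_zeta = zeta_continuation"
  unfolding riemann_zeta_def
proof (rule the_equality)
  show "zeta_continuation holomorphic_on - {1} \<and> zeta_continuation 1 = 0 \<and>
      (\<forall>s. Re s > 1 \<longrightarrow> (\<lambda>n. 1 / of_nat (Suc n) powr s) sums zeta_continuation s)"
    using zeta_continuation_holomorphic zeta_continuation_sums by (simp add: zeta_continuation_def)
next
  fix g :: "complex \<Rightarrow> complex"
  assume g: "g holomorphic_on - {1} \<and> g 1 = 0 \<and> (\<forall>s. Re s > 1 \<longrightarrow> (\<lambda>n. 1 / of_nat (Suc n) powr s) sums g s)"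
  have "g s - zeta_continuation s = 0" if "s \<noteq> 1" for s
  proof (rule analytic_continuation[where f = "\<lambda>s. g s - zeta_continuation s" and w = s and S = "-{1}" and U = "{s. Re s > 1}" and \<xi> = 2])
    show "(\<lambda>s. g s - zeta_continuation s) holomorphic_on - {1}"
      using g zeta_continuation_holomorphic by (intro holomorphic_on_diff) auto
    show "connected (- {1::complex})" by (rule connected_punctured_universe) simp
    show "(2::complex) islimpt {s. Re s > 1}"
      by (rule interior_limit_point) (simp add: interior_open open_halfspace_Re_gt)
    show "g z - zeta_continuation z = 0" if "z \<in> {s. Re s > 1}" for z
      using that g zeta_continuation_sums[of z] sums_unique2 by fastforce
  qed (use that in auto)
  then show "g = zeta_continuation"
    using g by (auto simp: fun_eq_iff zeta_continuation_def)
qed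

lemma riemann_Xi_eq: "riemann_Xi z = XI (\<i> * z)"
proof -
  \<comment> \<open>N vanishes at the poles of Gamma(s/2) and at s = 1. Being entire and nonzero at
    z = 0, where s/2 = 1/4, it has isolated zeros, so near any point the product equals
    \<open>XI (\<i> * w)\<close> with at most that point excepted.\<close>
  define N where "N = (\<lambda>z. rGamma ((1 / 2 + \<i> * z) / 2) * ((1 / 2 + \<i> * z) - 1))"
  have "(1 / 4 :: complex) \<notin> \<int>\<^sub>\<le>\<^sub>0" by (auto elim!: nonpos_Ints_cases simp: complex_eq_iff)
  then have "N 0 \<noteq> 0" by (simp add: N_def rGamma_eq_zero_iff)
  moreover have "N holomorphic_on UNIV" unfolding N_def by (intro holomorphic_intros) simp_all
  ultimately have "eventually (\<lambda>w. N w \<noteq> 0 \<and> w \<in> UNIV) (at z)"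
    by (intro non_zero_neighbour_alt[of N UNIV z 0]) auto
  then have "eventually (\<lambda>w. (let s = 1 / 2 + \<i> * w in
      1 / 2 * s * (s - 1) * of_real pi powr (- s / 2) * Gamma (s / 2) * riemann_zeta s) = XI (\<i> * w)) (at z)"
  proof eventually_elim
    case (elim w)
    define s where "s = 1 / 2 + \<i> * w"
    have s: "s \<noteq> 1" "rGamma (s / 2) \<noteq> 0" using elim unfolding N_def s_def[symmetric] by auto
    have "of_real pi powr (- s / 2) * of_real pi powr (s / 2) = (1 :: complex)"
      by (simp flip: powr_add)
    moreover have "s / 2 * rGamma (s / 2 + 1) * Gamma (s / 2) = 1"
      unfolding rGamma_plus1 using s(2) by (simp add: rGamma_inverse_Gamma)
    moreover have "1 / 2 * s * (s - 1) * of_real pi powr (- s / 2) * Gamma (s / 2) * riemann_zeta s =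
        XI (s - 1 / 2) * (of_real pi powr (- s / 2) * of_real pi powr (s / 2)) * (s / 2 * rGamma (s / 2 + 1) * Gamma (s / 2))"
    proof -
      have "1 / 2 * s * d * P * G * (X * P' * r / d) = X * (P * P') * (s / 2 * r * G)" if "d \<noteq> 0" for d P P' G X r
        using that by (simp add: field_simps)
      from this[of "s - 1"] s(1) show ?thesis unfolding riemann_zeta_eq zeta_continuation_def by simp
    qed
    moreover have "s - 1 / 2 = \<i> * w" by (simp add: s_def)
    ultimately show ?case unfolding Let_def s_def[symmetric] by (simp only: mult_1_right)
  qed
  moreover have "(\<lambda>w. XI (\<i> * w)) \<midarrow>z\<rightarrow> XI (\<i> * z)"
  proof -
    have "(\<lambda>w. XI (\<i> * w)) holomorphic_on UNIV" by (intro holomorphic_intros)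
    then have "continuous_on UNIV (\<lambda>w. XI (\<i> * w))" by (rule holomorphic_on_imp_continuous_on)
    then show ?thesis by (simp add: continuous_on_def)
  qed
  ultimately show ?thesis
    unfolding riemann_Xi_def by (intro remove_sings_eqI) (rule Lim_transform_eventually, auto elim: eventually_mono)
qed

lemma A_flat_eq_xi_coeff: "A_flat n = of_real (xi_coeff n)"
proof -
  define F where "F = Abs_fps (\<lambda>k. if even k then of_real (xi_coeff (k div 2)) * (-1) ^ (k div 2) else (0::complex))"
  have "(\<lambda>k. fps_nth F k * z ^ k) sums riemann_Xi z" for z
  proof -
    have "(\<lambda>n. fps_nth F (2 * n) * z ^ (2 * n)) sums riemann_Xi z"
      using XI_sums[of "\<i> * z"]
      by (simp add: F_def riemann_Xi_eq power_mult power_mult_distrib) (simp add: power_minus[of "z\<^sup>2"] mult.assoc)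
    moreover have "strict_mono (\<lambda>n::nat. 2 * n)" by (simp add: strict_mono_def)
    moreover have "fps_nth F k * z ^ k = 0" if "k \<notin> range (\<lambda>n. 2 * n)" for k
    proof -
      have "odd k" using that by (auto elim!: evenE)
      then show ?thesis by (simp add: F_def)
    qed
    ultimately show ?thesis
      using sums_mono_reindex[of "\<lambda>n. 2 * n" "\<lambda>k. fps_nth F k * z ^ k"] by simp
  qed
  then have "riemann_Xi has_fps_expansion F"
    by (intro has_fps_expansionI always_eventually allI)
  then have "fps_expansion riemann_Xi 0 = F" by (rule fps_expansion_eqI)
  then have "A_flat n = (-1) ^ n * (of_real (xi_coeff n) * (-1) ^ n)" by (simp add: A_flat_def F_def)
  also have "\<dots> = of_real (xi_coeff n)" by (simp flip: power_mult_distrib)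
  finally show ?thesis .
qed

text \<open>Multiplying the argument of \<open>riemann_Xi\<close> by i gives \<open>csqrt x\<close>,
  and \<open>XI\<close> depends only on its square x.\<close>

lemma fps_expansion_f_flat: "fps_expansion f_flat 0 = Abs_fps A_flat"
proof (rule fps_expansion_eqI, intro has_fps_expansionI always_eventually allI)
  show "(\<lambda>n. fps_nth (Abs_fps A_flat) n * x ^ n) sums f_flat x" for x
    using XI_sums[of "csqrt x"] by (simp add: f_flat_def riemann_Xi_eq A_flat_eq_xi_coeff)
qed

section \<open>Proof of the theorem\<close>

text \<open>The terms decrease strictly with r, so below \<open>rho\<close> the total stays strictly
  under one half.\<close>

lemma sums_less_half:
  fixes r rho :: real
  assumes "0 \<le> r" "r < rho" "(\<lambda>k. rho ^ (Suc k)\<^sup>2) sums (1/2)"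
  obtains s where "(\<lambda>k. r ^ (Suc k)\<^sup>2) sums s" "2 * s < 1"
proof -
  have less: "r ^ (Suc k)\<^sup>2 < rho ^ (Suc k)\<^sup>2" for k
    using assms(1,2) by (intro power_strict_mono) auto
  have "summable (\<lambda>k. r ^ (Suc k)\<^sup>2)"
    by (rule summable_comparison_test'[OF sums_summable[OF assms(3)], of 0])
       (use less assms(1) in \<open>auto simp: less_imp_le\<close>)
  then obtain s where s: "(\<lambda>k. r ^ (Suc k)\<^sup>2) sums s" by (auto simp: summable_def)
  have diff: "(\<lambda>k. rho ^ (Suc k)\<^sup>2 - r ^ (Suc k)\<^sup>2) sums (1 / 2 - s)"
    by (rule sums_diff[OF assms(3) s])
  have "0 < (\<Sum>k. rho ^ (Suc k)\<^sup>2 - r ^ (Suc k)\<^sup>2)"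
    by (rule suminf_pos[OF sums_summable[OF diff]]) (use less in simp)
  then have "2 * s < 1" using sums_unique[OF diff] by simp
  with s show ?thesis by (rule that)
qed

theorem theorem2p2:
  fixes rho :: real
  assumes "rho > 0" and "(\<lambda>k. rho ^ (Suc k)\<^sup>2) sums (1/2)"
  shows
    "(\<forall>y::complex. 0 < norm y \<and> norm y < rho\<^sup>2 \<longrightarrow>
        (\<forall>p\<ge>1. summable (\<lambda>n. u_coeff p (p + n) * y ^ (p + n))) \<and>
        {x. y_borel y f_flat x = 0} = {- 1 / alpha p y | p. p \<ge> 1 \<and> alpha p y \<noteq> 0})
   \<and> (\<forall>y::real. 0 < y \<and> y \<le> rho\<^sup>2 \<longrightarrow>
        (\<forall>x::complex. y_borel (of_real y) f_flat x = 0 \<longrightarrow> x \<in> \<real>))"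
proof -
  interpret logconcave_A_flat xi_coeff
    by unfold_locales
       (rule A_flat_eq_xi_coeff xi_coeff_pos xi_coeff_logconcave fps_expansion_f_flat)+
  \<comment> \<open>The first term of the series is \<open>rho\<close> itself, so \<open>rho\<close>
    is at most 1/2.\<close>
  have "rho = (\<Sum>k\<in>{0}. rho ^ (Suc k)\<^sup>2)" by simp
  also have "\<dots> \<le> (\<Sum>k. rho ^ (Suc k)\<^sup>2)"
    by (rule sum_le_suminf[OF sums_summable[OF assms(2)]]) (use assms(1) in auto)
  finally have rho1: "rho < 1" using sums_unique[OF assms(2)] by simp
  have small: "0 < sqrt t" "sqrt t < rho" "sqrt t < 1" "(sqrt t)\<^sup>2 = t" if t: "0 < t" "t < rho\<^sup>2" for t
  proof -
    show "sqrt t < rho" using t assms(1) real_less_lsqrt[of rho t] by simp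
    then show "sqrt t < 1" using rho1 by linarith
  qed (use t in auto)
  have less: "x \<in> \<real>" if t: "0 < t" "t < rho\<^sup>2" and x: "y_borel (of_real t) f_flat x = 0" for t x
  proof -
    obtain s where s: "(\<lambda>k. sqrt t ^ (Suc k)\<^sup>2) sums s" "2 * s < 1"
      using sums_less_half[OF less_imp_le[OF small(1)[OF t]] small(2)[OF t] assms(2)] .
    show ?thesis
      by (rule y_borel_zeros_real[OF small(1,3)[OF t] s]) (use x small(4)[OF t] in simp)
  qed
  show ?thesis
  proof (intro conjI allI impI)
    fix y :: complex assume y: "0 < norm y \<and> norm y < rho\<^sup>2"
    then have t: "0 < norm y" "norm y < rho\<^sup>2" by auto
    obtain s where s: "(\<lambda>k. sqrt (norm y) ^ (Suc k)\<^sup>2) sums s" "2 * s < 1"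
      using sums_less_half[OF less_imp_le[OF small(1)[OF t]] small(2)[OF t] assms(2)] .
    note r = small(1,3)[OF t] s small(4)[OF t, symmetric]
    show "{x. y_borel y f_flat x = 0} = {- 1 / alpha p y | p. p \<ge> 1 \<and> alpha p y \<noteq> 0}"
      by (rule y_borel_zeros[OF r])
    fix p :: nat assume "p \<ge> 1"
    then obtain q where "p = Suc q" by (cases p) auto
    then show "summable (\<lambda>n. u_coeff p (p + n) * y ^ (p + n))"
      using y_borel_zero_alpha(1)[OF r, of q] by simp
  next
    fix y :: real and x :: complex
    assume y: "0 < y \<and> y \<le> rho\<^sup>2" and x: "y_borel (of_real y) f_flat x = 0"
    show "x \<in> \<real>"
    proof (cases "y < rho\<^sup>2")
      case True
      then show ?thesis using less y x by blast
    next
      case False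
      then have "y = rho\<^sup>2" using y by simp
      moreover have "rho\<^sup>2 < 1" using assms(1) rho1 by (simp add: power_less_one_iff)
      ultimately show ?thesis
        using y_borel_zeros_real_limit[of y x] less y x by blast
    qed
  qed
qed

end
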